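(* Let $\mathcal C$ be a (symmetric) monoidal model category, and suppose that $f\colon S'\to S$, $g\colon R'\to R$, $\theta\colon S\to R$, $\psi\colon S'\to R'$ are maps of commutative monoids in $\mathcal C$ with $\theta f=g\psi$. (1) There is a natural isomorphism $f^*\theta^*\cong\psi^*g^*$ of functors $\mathrm{Mod}_R\to\mathrm{Mod}_{S'}$. (2) Suppose that cofibrants are flat in $\mathrm{Mod}_{R'}$ and that there is a natural weak equivalence $S\otimes_{S'}R'\xrightarrow{\sim}R$ of commutative $R'$-algebras. Then there is a natural map $f_*\psi^*M\to\theta^*g_*M$ of $S$-modules, for $M\in \mathrm{Mod}_{R'}$, which is a weak equivalence for cofibrant $R'$-modules $M$.
   Context: For a map of commutative monoids $h\colon A\to B$, $h^*\colon\mathrm{Mod}_B\to\mathrm{Mod}_A$ is restriction of scalars and $h_*=B\otimes_A-$ is extension of scalars. Module categories carry the right lifted model structure (assumed to exist): weak equivalences and fibrations are created by the forgetful functor to $\mathcal C$. "Cofibrants are flat" in a monoidal model category means that for every cofibrant object $X$ the functor $X\otimes-$ preserves all weak equivalences; in $\mathrm{Mod}_{R'}$ the tensor product is $\otimes_{R'}$. *)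

theory Defs
  imports Main "HOL-Library.Infinite_Typeclass"
begin

section \<open>Categories, functors, natural transformations\<close>

record ('o, 'm) cat =
  Obj :: "'o set"
  Arr :: "'m set"
  Dom :: "'m \<Rightarrow> 'o"
  Cod :: "'m \<Rightarrow> 'o"
  Id :: "'o \<Rightarrow> 'm"
  Comp :: "'m \<Rightarrow> 'm \<Rightarrow> 'm"  (infixr "\<cdot>\<index>" 55)

definition Hom :: "('o, 'm, 'z) cat_scheme \<Rightarrow> 'o \<Rightarrow> 'o \<Rightarrow> 'm set" where
  "Hom C X Y = {f \<in> Arr C. Dom C f = X \<and> Cod C f = Y}"

text \<open>\<open>g \<cdot> f\<close> is \<open>g\<close> after \<open>f\<close>; nothing is assumed about it when the two are not composable.\<close>

locale category =
  fixes C :: "('o, 'm, 'z) cat_scheme" (structure)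
  assumes Dom_Obj: "f \<in> Arr C \<Longrightarrow> Dom C f \<in> Obj C"
    and Cod_Obj: "f \<in> Arr C \<Longrightarrow> Cod C f \<in> Obj C"
    and Id_Hom: "X \<in> Obj C \<Longrightarrow> Id C X \<in> Hom C X X"
    and Comp_Hom: "\<lbrakk>f \<in> Hom C X Y; g \<in> Hom C Y Z\<rbrakk> \<Longrightarrow> g \<cdot> f \<in> Hom C X Z"
    and Id_left: "f \<in> Hom C X Y \<Longrightarrow> Id C Y \<cdot> f = f"
    and Id_right: "f \<in> Hom C X Y \<Longrightarrow> f \<cdot> Id C X = f"
    and Comp_assoc:
      "\<lbrakk>f \<in> Hom C W X; g \<in> Hom C X Y; h \<in> Hom C Y Z\<rbrakk> \<Longrightarrow> (h \<cdot> g) \<cdot> f = h \<cdot> g \<cdot> f"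

definition op_cat :: "('o, 'm, 'z) cat_scheme \<Rightarrow> ('o, 'm) cat" where
  "op_cat C = \<lparr>Obj = Obj C, Arr = Arr C, Dom = Cod C, Cod = Dom C, Id = Id C,
     Comp = (\<lambda>g f. Comp C f g)\<rparr>"

record ('o, 'm, 'p, 'n) ftor =
  FO :: "'o \<Rightarrow> 'p"
  FA :: "'m \<Rightarrow> 'n"

definition is_functor ::
  "('o, 'm, 'y) cat_scheme \<Rightarrow> ('p, 'n, 'z) cat_scheme \<Rightarrow> ('o, 'm, 'p, 'n) ftor \<Rightarrow> bool" where
  "is_functor C D F \<longleftrightarrow> category C \<and> category D \<and>
     (\<forall>X \<in> Obj C. FO F X \<in> Obj D) \<and>
     (\<forall>X Y. \<forall>f \<in> Hom C X Y. FA F f \<in> Hom D (FO F X) (FO F Y)) \<and>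
     (\<forall>X \<in> Obj C. FA F (Id C X) = Id D (FO F X)) \<and>
     (\<forall>X Y Z. \<forall>f \<in> Hom C X Y. \<forall>g \<in> Hom C Y Z.
        FA F (g \<cdot>\<^bsub>C\<^esub> f) = FA F g \<cdot>\<^bsub>D\<^esub> FA F f)"

definition fcomp ::
  "('p, 'n, 'q, 'k) ftor \<Rightarrow> ('o, 'm, 'p, 'n) ftor \<Rightarrow> ('o, 'm, 'q, 'k) ftor"
  (infixr "\<circ>\<^sub>F" 55) where
  "G \<circ>\<^sub>F F = \<lparr>FO = FO G \<circ> FO F, FA = FA G \<circ> FA F\<rparr>"

definition nat_trans ::
  "('o, 'm, 'y) cat_scheme \<Rightarrow> ('p, 'n, 'z) cat_scheme \<Rightarrow>
   ('o, 'm, 'p, 'n) ftor \<Rightarrow> ('o, 'm, 'p, 'n) ftor \<Rightarrow> ('o \<Rightarrow> 'n) \<Rightarrow> bool" where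
  "nat_trans C D F G \<tau> \<longleftrightarrow> is_functor C D F \<and> is_functor C D G \<and>
     (\<forall>X \<in> Obj C. \<tau> X \<in> Hom D (FO F X) (FO G X)) \<and>
     (\<forall>X Y. \<forall>f \<in> Hom C X Y. \<tau> Y \<cdot>\<^bsub>D\<^esub> FA F f = FA G f \<cdot>\<^bsub>D\<^esub> \<tau> X)"

context
  fixes C :: "('o, 'm, 'z) cat_scheme" (structure)
begin

definition inverse_arrows :: "'m \<Rightarrow> 'm \<Rightarrow> bool" where
  "inverse_arrows f g \<longleftrightarrow> f \<in> Arr C \<and> g \<in> Hom C (Cod C f) (Dom C f) \<and>
     g \<cdot> f = Id C (Dom C f) \<and> f \<cdot> g = Id C (Cod C f)"

definition is_iso :: "'m \<Rightarrow> bool" where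
  "is_iso f \<longleftrightarrow> (\<exists>g. inverse_arrows f g)"

definition Inv :: "'m \<Rightarrow> 'm" where
  "Inv f = (THE g. inverse_arrows f g)"

end

definition nat_iso ::
  "('o, 'm, 'y) cat_scheme \<Rightarrow> ('p, 'n, 'z) cat_scheme \<Rightarrow>
   ('o, 'm, 'p, 'n) ftor \<Rightarrow> ('o, 'm, 'p, 'n) ftor \<Rightarrow> ('o \<Rightarrow> 'n) \<Rightarrow> bool" where
  "nat_iso C D F G \<tau> \<longleftrightarrow> nat_trans C D F G \<tau> \<and> (\<forall>X \<in> Obj C. is_iso D (\<tau> X))"


section \<open>Limits and colimits\<close>

context
  fixes C :: "('o, 'm, 'z) cat_scheme" (structure)
begin

definition is_cone :: "('i, 'j, 'y) cat_scheme \<Rightarrow> ('i, 'j, 'o, 'm) ftor \<Rightarrow> 'o \<Rightarrow> ('i \<Rightarrow> 'm) \<Rightarrow> bool" where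
  "is_cone J F L \<pi> \<longleftrightarrow> L \<in> Obj C \<and> (\<forall>j \<in> Obj J. \<pi> j \<in> Hom C L (FO F j)) \<and>
     (\<forall>j k. \<forall>u \<in> Hom J j k. FA F u \<cdot> \<pi> j = \<pi> k)"

definition is_limit :: "('i, 'j, 'y) cat_scheme \<Rightarrow> ('i, 'j, 'o, 'm) ftor \<Rightarrow> 'o \<Rightarrow> ('i \<Rightarrow> 'm) \<Rightarrow> bool" where
  "is_limit J F L \<pi> \<longleftrightarrow> is_cone J F L \<pi> \<and>
     (\<forall>L' \<pi>'. is_cone J F L' \<pi>' \<longrightarrow>
        (\<exists>!h. h \<in> Hom C L' L \<and> (\<forall>j \<in> Obj J. \<pi> j \<cdot> h = \<pi>' j)))"

definition initial_object :: "'o \<Rightarrow> bool" where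
  "initial_object Z \<longleftrightarrow> Z \<in> Obj C \<and> (\<forall>X \<in> Obj C. \<exists>!f. f \<in> Hom C Z X)"

definition is_coequalizer :: "'m \<Rightarrow> 'm \<Rightarrow> 'o \<Rightarrow> 'm \<Rightarrow> bool" where
  "is_coequalizer f g Q q \<longleftrightarrow>
     f \<in> Arr C \<and> g \<in> Hom C (Dom C f) (Cod C f) \<and> q \<in> Hom C (Cod C f) Q \<and> q \<cdot> f = q \<cdot> g \<and>
     (\<forall>Z. \<forall>k \<in> Hom C (Cod C f) Z. k \<cdot> f = k \<cdot> g \<longrightarrow> (\<exists>!h. h \<in> Hom C Q Z \<and> h \<cdot> q = k))"

definition is_pushout :: "'m \<Rightarrow> 'm \<Rightarrow> 'o \<Rightarrow> 'm \<Rightarrow> 'm \<Rightarrow> bool" where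
  "is_pushout f g P i j \<longleftrightarrow>
     f \<in> Arr C \<and> g \<in> Arr C \<and> Dom C f = Dom C g \<and>
     i \<in> Hom C (Cod C f) P \<and> j \<in> Hom C (Cod C g) P \<and> i \<cdot> f = j \<cdot> g \<and>
     (\<forall>Z. \<forall>u \<in> Hom C (Cod C f) Z. \<forall>v \<in> Hom C (Cod C g) Z. u \<cdot> f = v \<cdot> g \<longrightarrow>
        (\<exists>!h. h \<in> Hom C P Z \<and> h \<cdot> i = u \<and> h \<cdot> j = v))"

end

text \<open>
  The type \<open>'u\<close> bounds the size of a diagram: a small category is one whose objects and arrows
  are elements of \<open>'u\<close>. The size bound is meant to be an arbitrary infinite type.
\<close>

definition has_small_limits :: "'u itself \<Rightarrow> ('o, 'm, 'z) cat_scheme \<Rightarrow> bool" where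
  "has_small_limits _ C \<longleftrightarrow>
     (\<forall>(J :: ('u, 'u) cat) F. is_functor J C F \<longrightarrow> (\<exists>L \<pi>. is_limit C J F L \<pi>))"

text \<open>A functor from \<open>J\<close> to the opposite of \<open>C\<close> is a functor from the opposite of \<open>J\<close> to \<open>C\<close>,
  so quantifying over all small \<open>J\<close> covers all small diagrams in \<open>C\<close>.\<close>

definition has_small_colimits :: "'u itself \<Rightarrow> ('o, 'm, 'z) cat_scheme \<Rightarrow> bool" where
  "has_small_colimits small C \<longleftrightarrow> has_small_limits small (op_cat C)"


section \<open>Model categories\<close>

record 'm model =
  Weq :: "'m set"
  Cof :: "'m set"
  Fib :: "'m set"

context
  fixes C :: "('o, 'm, 'z) cat_scheme" (structure)
begin

definition llp :: "'m \<Rightarrow> 'm \<Rightarrow> bool" where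
  "llp i p \<longleftrightarrow>
     (\<forall>u \<in> Hom C (Dom C i) (Dom C p). \<forall>v \<in> Hom C (Cod C i) (Cod C p). p \<cdot> u = v \<cdot> i \<longrightarrow>
        (\<exists>h \<in> Hom C (Cod C i) (Dom C p). h \<cdot> i = u \<and> p \<cdot> h = v))"

definition retract_of :: "'m \<Rightarrow> 'm \<Rightarrow> bool" where
  "retract_of f g \<longleftrightarrow> f \<in> Arr C \<and> g \<in> Arr C \<and>
     (\<exists>i \<in> Hom C (Dom C f) (Dom C g). \<exists>r \<in> Hom C (Dom C g) (Dom C f).
      \<exists>j \<in> Hom C (Cod C f) (Cod C g). \<exists>s \<in> Hom C (Cod C g) (Cod C f).
        r \<cdot> i = Id C (Dom C f) \<and> s \<cdot> j = Id C (Cod C f) \<and> g \<cdot> i = j \<cdot> f \<and> f \<cdot> r = s \<cdot> g)"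

definition retract_closed :: "'m set \<Rightarrow> bool" where
  "retract_closed K \<longleftrightarrow> (\<forall>g \<in> K. \<forall>f. retract_of f g \<longrightarrow> f \<in> K)"

definition factorizes :: "'m set \<Rightarrow> 'm set \<Rightarrow> bool" where
  "factorizes L R \<longleftrightarrow> (\<forall>f \<in> Arr C. \<exists>i \<in> L. \<exists>p \<in> R. Dom C p = Cod C i \<and> f = p \<cdot> i)"

definition cofibrant :: "'m model \<Rightarrow> 'o \<Rightarrow> bool" where
  "cofibrant M X \<longleftrightarrow> X \<in> Obj C \<and> (\<exists>Z. initial_object C Z \<and> (\<exists>f \<in> Hom C Z X. f \<in> Cof M))"

end

text \<open>Factorizations are only required to exist, not to be functorial.\<close>

locale model_category = category C for C :: "('o, 'm, 'z) cat_scheme" (structure) +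
  fixes small :: "'u::infinite itself" and M :: "'m model"
  assumes complete: "has_small_limits small C"
    and cocomplete: "has_small_colimits small C"
    and classes: "Weq M \<subseteq> Arr C" "Cof M \<subseteq> Arr C" "Fib M \<subseteq> Arr C"
    and two_out_of_three:
      "\<lbrakk>f \<in> Hom C X Y; g \<in> Hom C Y Z; f \<in> Weq M; g \<in> Weq M\<rbrakk> \<Longrightarrow> g \<cdot> f \<in> Weq M"
      "\<lbrakk>f \<in> Hom C X Y; g \<in> Hom C Y Z; f \<in> Weq M; g \<cdot> f \<in> Weq M\<rbrakk> \<Longrightarrow> g \<in> Weq M"
      "\<lbrakk>f \<in> Hom C X Y; g \<in> Hom C Y Z; g \<in> Weq M; g \<cdot> f \<in> Weq M\<rbrakk> \<Longrightarrow> f \<in> Weq M"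
    and retracts: "retract_closed C (Weq M)" "retract_closed C (Cof M)" "retract_closed C (Fib M)"
    and lifting:
      "\<lbrakk>i \<in> Cof M \<inter> Weq M; p \<in> Fib M\<rbrakk> \<Longrightarrow> llp C i p"
      "\<lbrakk>i \<in> Cof M; p \<in> Fib M \<inter> Weq M\<rbrakk> \<Longrightarrow> llp C i p"
    and factorization:
      "factorizes C (Cof M \<inter> Weq M) (Fib M)"
      "factorizes C (Cof M) (Fib M \<inter> Weq M)"


section \<open>Symmetric monoidal model categories\<close>

record ('o, 'm) moncat = "('o, 'm) cat" +
  TensO :: "'o \<Rightarrow> 'o \<Rightarrow> 'o"  (infixl "\<otimes>\<index>" 70)
  TensA :: "'m \<Rightarrow> 'm \<Rightarrow> 'm"  (infixl "\<odot>\<index>" 70)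
  Unit :: 'o
  Assoc :: "'o \<Rightarrow> 'o \<Rightarrow> 'o \<Rightarrow> 'm"
  LUnit :: "'o \<Rightarrow> 'm"
  RUnit :: "'o \<Rightarrow> 'm"
  Sym :: "'o \<Rightarrow> 'o \<Rightarrow> 'm"

text \<open>\<open>X \<otimes> Y\<close> is the tensor product of objects and \<open>f \<odot> g\<close> that of arrows.\<close>

locale symmetric_monoidal_category =
  category C for C :: "('o, 'm, 'z) moncat_scheme" (structure) +
  assumes TensO_Obj: "\<lbrakk>X \<in> Obj C; Y \<in> Obj C\<rbrakk> \<Longrightarrow> X \<otimes> Y \<in> Obj C"
    and TensA_Hom:
      "\<lbrakk>f \<in> Hom C X Y; g \<in> Hom C X' Y'\<rbrakk> \<Longrightarrow> f \<odot> g \<in> Hom C (X \<otimes> X') (Y \<otimes> Y')"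
    and TensA_Id: "\<lbrakk>X \<in> Obj C; Y \<in> Obj C\<rbrakk> \<Longrightarrow> Id C X \<odot> Id C Y = Id C (X \<otimes> Y)"
    and TensA_Comp:
      "\<lbrakk>f \<in> Hom C X Y; g \<in> Hom C Y Z; f' \<in> Hom C X' Y'; g' \<in> Hom C Y' Z'\<rbrakk> \<Longrightarrow>
         (g \<cdot> f) \<odot> (g' \<cdot> f') = (g \<odot> g') \<cdot> (f \<odot> f')"
    and Unit_Obj: "Unit C \<in> Obj C"
    and Assoc_Hom:
      "\<lbrakk>X \<in> Obj C; Y \<in> Obj C; Z \<in> Obj C\<rbrakk> \<Longrightarrow>
         Assoc C X Y Z \<in> Hom C ((X \<otimes> Y) \<otimes> Z) (X \<otimes> (Y \<otimes> Z))"
    and Assoc_iso: "\<lbrakk>X \<in> Obj C; Y \<in> Obj C; Z \<in> Obj C\<rbrakk> \<Longrightarrow> is_iso C (Assoc C X Y Z)"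
    and Assoc_nat:
      "\<lbrakk>f \<in> Hom C X X'; g \<in> Hom C Y Y'; h \<in> Hom C Z Z'\<rbrakk> \<Longrightarrow>
         Assoc C X' Y' Z' \<cdot> ((f \<odot> g) \<odot> h) = (f \<odot> (g \<odot> h)) \<cdot> Assoc C X Y Z"
    and LUnit_Hom: "X \<in> Obj C \<Longrightarrow> LUnit C X \<in> Hom C (Unit C \<otimes> X) X"
    and LUnit_iso: "X \<in> Obj C \<Longrightarrow> is_iso C (LUnit C X)"
    and LUnit_nat: "f \<in> Hom C X Y \<Longrightarrow> LUnit C Y \<cdot> (Id C (Unit C) \<odot> f) = f \<cdot> LUnit C X"
    and RUnit_Hom: "X \<in> Obj C \<Longrightarrow> RUnit C X \<in> Hom C (X \<otimes> Unit C) X"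
    and RUnit_iso: "X \<in> Obj C \<Longrightarrow> is_iso C (RUnit C X)"
    and RUnit_nat: "f \<in> Hom C X Y \<Longrightarrow> RUnit C Y \<cdot> (f \<odot> Id C (Unit C)) = f \<cdot> RUnit C X"
    and Sym_Hom: "\<lbrakk>X \<in> Obj C; Y \<in> Obj C\<rbrakk> \<Longrightarrow> Sym C X Y \<in> Hom C (X \<otimes> Y) (Y \<otimes> X)"
    and Sym_nat:
      "\<lbrakk>f \<in> Hom C X X'; g \<in> Hom C Y Y'\<rbrakk> \<Longrightarrow> Sym C X' Y' \<cdot> (f \<odot> g) = (g \<odot> f) \<cdot> Sym C X Y"
    and pentagon:
      "\<lbrakk>W \<in> Obj C; X \<in> Obj C; Y \<in> Obj C; Z \<in> Obj C\<rbrakk> \<Longrightarrow>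
         Assoc C W X (Y \<otimes> Z) \<cdot> Assoc C (W \<otimes> X) Y Z =
         (Id C W \<odot> Assoc C X Y Z) \<cdot> Assoc C W (X \<otimes> Y) Z \<cdot> (Assoc C W X Y \<odot> Id C Z)"
    and triangle:
      "\<lbrakk>X \<in> Obj C; Y \<in> Obj C\<rbrakk> \<Longrightarrow>
         (Id C X \<odot> LUnit C Y) \<cdot> Assoc C X (Unit C) Y = RUnit C X \<odot> Id C Y"
    and hexagon:
      "\<lbrakk>X \<in> Obj C; Y \<in> Obj C; Z \<in> Obj C\<rbrakk> \<Longrightarrow>
         Assoc C Y Z X \<cdot> Sym C X (Y \<otimes> Z) \<cdot> Assoc C X Y Z =
         (Id C Y \<odot> Sym C X Z) \<cdot> Assoc C Y X Z \<cdot> (Sym C X Y \<odot> Id C Z)"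
    and symmetry: "\<lbrakk>X \<in> Obj C; Y \<in> Obj C\<rbrakk> \<Longrightarrow> Sym C Y X \<cdot> Sym C X Y = Id C (X \<otimes> Y)"

text \<open>
  The monoidal structure is closed, and satisfies the pushout-product axiom and the unit axiom.
  In the pushout-product axiom \<open>P\<close> is the pushout of the two arrows out of \<open>U \<otimes> V\<close>,
  and \<open>h\<close> is the pushout-product of \<open>f\<close> and \<open>g\<close>.
\<close>

locale symmetric_monoidal_model_category =
  symmetric_monoidal_category C + model_category C small M
  for C :: "('o, 'm, 'z) moncat_scheme" (structure)
    and small :: "'u::infinite itself" and M :: "'m model" +
  assumes closed:
      "\<lbrakk>Y \<in> Obj C; Z \<in> Obj C\<rbrakk> \<Longrightarrow>
         \<exists>H \<in> Obj C. \<exists>ev \<in> Hom C (H \<otimes> Y) Z. \<forall>X \<in> Obj C. \<forall>f \<in> Hom C (X \<otimes> Y) Z.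
           \<exists>!k. k \<in> Hom C X H \<and> ev \<cdot> (k \<odot> Id C Y) = f"
    and pushout_product:
      "\<lbrakk>f \<in> Hom C U U'; g \<in> Hom C V V'; f \<in> Cof M; g \<in> Cof M;
        is_pushout C (f \<odot> Id C V) (Id C U \<odot> g) P i j;
        h \<in> Hom C P (U' \<otimes> V'); h \<cdot> i = Id C U' \<odot> g; h \<cdot> j = f \<odot> Id C V'\<rbrakk> \<Longrightarrow>
         h \<in> Cof M \<and> (f \<in> Weq M \<or> g \<in> Weq M \<longrightarrow> h \<in> Weq M)"
    and unit_axiom:
      "\<lbrakk>cofibrant C M Q; q \<in> Hom C Q (Unit C); q \<in> Weq M \<inter> Fib M; cofibrant C M X\<rbrakk> \<Longrightarrow>
         q \<odot> Id C X \<in> Weq M"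

text \<open>\<open>T X\<close> is the endofunctor \<open>X \<otimes> -\<close>.\<close>

definition cofibrants_flat ::
  "('o, 'm, 'z) cat_scheme \<Rightarrow> 'm model \<Rightarrow> ('o \<Rightarrow> ('o, 'm, 'o, 'm) ftor) \<Rightarrow> bool" where
  "cofibrants_flat C M T \<longleftrightarrow> (\<forall>X. cofibrant C M X \<longrightarrow> (\<forall>f \<in> Weq M. FA (T X) f \<in> Weq M))"


section \<open>Commutative monoids and their modules\<close>

record ('o, 'm) mon =
  Car :: 'o
  Mul :: 'm
  Unt :: 'm

context
  fixes C :: "('o, 'm, 'z) moncat_scheme" (structure)
begin

definition commutative_monoid :: "('o, 'm) mon \<Rightarrow> bool" where
  "commutative_monoid A \<longleftrightarrow> Car A \<in> Obj C \<and>
     Mul A \<in> Hom C (Car A \<otimes> Car A) (Car A) \<and> Unt A \<in> Hom C (Unit C) (Car A) \<and>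
     Mul A \<cdot> (Mul A \<odot> Id C (Car A)) =
       Mul A \<cdot> (Id C (Car A) \<odot> Mul A) \<cdot> Assoc C (Car A) (Car A) (Car A) \<and>
     Mul A \<cdot> (Unt A \<odot> Id C (Car A)) = LUnit C (Car A) \<and>
     Mul A \<cdot> (Id C (Car A) \<odot> Unt A) = RUnit C (Car A) \<and>
     Mul A \<cdot> Sym C (Car A) (Car A) = Mul A"

definition monoid_hom :: "('o, 'm) mon \<Rightarrow> ('o, 'm) mon \<Rightarrow> 'm \<Rightarrow> bool" where
  "monoid_hom A B h \<longleftrightarrow> h \<in> Hom C (Car A) (Car B) \<and>
     h \<cdot> Mul A = Mul B \<cdot> (h \<odot> h) \<and> h \<cdot> Unt A = Unt B"

text \<open>A module is an object \<open>X\<close> paired with an action \<open>a\<close> from \<open>Car A \<otimes> X\<close> to \<open>X\<close>.\<close>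

definition is_module :: "('o, 'm) mon \<Rightarrow> 'o \<times> 'm \<Rightarrow> bool" where
  "is_module A X \<longleftrightarrow> (case X of (X, a) \<Rightarrow>
     X \<in> Obj C \<and> a \<in> Hom C (Car A \<otimes> X) X \<and>
     a \<cdot> (Mul A \<odot> Id C X) = a \<cdot> (Id C (Car A) \<odot> a) \<cdot> Assoc C (Car A) (Car A) X \<and>
     a \<cdot> (Unt A \<odot> Id C X) = LUnit C X)"

definition module_hom :: "('o, 'm) mon \<Rightarrow> 'o \<times> 'm \<Rightarrow> 'o \<times> 'm \<Rightarrow> 'm \<Rightarrow> bool" where
  "module_hom A X Y f \<longleftrightarrow> f \<in> Hom C (fst X) (fst Y) \<and>
     f \<cdot> snd X = snd Y \<cdot> (Id C (Car A) \<odot> f)"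

text \<open>An arrow of the module category is an arrow of \<open>C\<close> together with its source and target
  modules: a single arrow of \<open>C\<close> can be linear for several different actions.\<close>

definition Mod :: "('o, 'm) mon \<Rightarrow> ('o \<times> 'm, ('o \<times> 'm) \<times> ('o \<times> 'm) \<times> 'm) cat" where
  "Mod A = \<lparr>Obj = {X. is_module A X},
     Arr = {(X, Y, f). is_module A X \<and> is_module A Y \<and> module_hom A X Y f},
     Dom = (\<lambda>(X, Y, f). X), Cod = (\<lambda>(X, Y, f). Y),
     Id = (\<lambda>X. (X, X, Id C (fst X))),
     Comp = (\<lambda>(Y', Z, g) (X, Y, f). (X, Z, g \<cdot> f))\<rparr>"

text \<open>The right lifted structure: weak equivalences and fibrations are created by the forgetful
  functor, and so the cofibrations are forced.\<close>

definition lifted_model ::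
  "'m model \<Rightarrow> ('o, 'm) mon \<Rightarrow> (('o \<times> 'm) \<times> ('o \<times> 'm) \<times> 'm) model" where
  "lifted_model M A = (let
     W = {(X, Y, f) \<in> Arr (Mod A). f \<in> Weq M};
     F = {(X, Y, f) \<in> Arr (Mod A). f \<in> Fib M}
   in \<lparr>Weq = W, Cof = {i \<in> Arr (Mod A). \<forall>p \<in> F \<inter> W. llp (Mod A) i p}, Fib = F\<rparr>)"


subsection \<open>Relative tensor products\<close>

text \<open>\<open>rtens A X Y\<close> is a chosen coequalizer of the two arrows from \<open>(X \<otimes> A) \<otimes> Y\<close> to \<open>X \<otimes> Y\<close>
  given by the actions, where the left action on \<open>X\<close> is made a right action by the symmetry.\<close>

definition rtens :: "('o, 'm) mon \<Rightarrow> 'o \<times> 'm \<Rightarrow> 'o \<times> 'm \<Rightarrow> 'o \<times> 'm" where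
  "rtens A X Y = (SOME (Q, q). is_coequalizer C
     ((snd X \<cdot> Sym C (fst X) (Car A)) \<odot> Id C (fst Y))
     ((Id C (fst X) \<odot> snd Y) \<cdot> Assoc C (fst X) (Car A) (fst Y)) Q q)"

abbreviation rtens_obj :: "('o, 'm) mon \<Rightarrow> 'o \<times> 'm \<Rightarrow> 'o \<times> 'm \<Rightarrow> 'o" where
  "rtens_obj A X Y \<equiv> fst (rtens A X Y)"

abbreviation rtens_proj :: "('o, 'm) mon \<Rightarrow> 'o \<times> 'm \<Rightarrow> 'o \<times> 'm \<Rightarrow> 'm" where
  "rtens_proj A X Y \<equiv> snd (rtens A X Y)"

definition rtens_map ::
  "('o, 'm) mon \<Rightarrow> ('o \<times> 'm) \<times> ('o \<times> 'm) \<times> 'm \<Rightarrow> ('o \<times> 'm) \<times> ('o \<times> 'm) \<times> 'm \<Rightarrow> 'm" where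
  "rtens_map A \<phi> \<chi> = (case (\<phi>, \<chi>) of ((X, X', f), (Y, Y', g)) \<Rightarrow>
     THE h. h \<in> Hom C (rtens_obj A X Y) (rtens_obj A X' Y') \<and>
       h \<cdot> rtens_proj A X Y = rtens_proj A X' Y' \<cdot> (f \<odot> g))"

text \<open>The action of \<open>K\<close> on the relative tensor product induced by an \<open>A\<close>-linear action
  \<open>k\<close> of \<open>K\<close> on the left factor.\<close>

definition rtens_act :: "('o, 'm) mon \<Rightarrow> 'o \<Rightarrow> 'm \<Rightarrow> 'o \<times> 'm \<Rightarrow> 'o \<times> 'm \<Rightarrow> 'm" where
  "rtens_act A K k X Y = (THE b. b \<in> Hom C (K \<otimes> rtens_obj A X Y) (rtens_obj A X Y) \<and>
     b \<cdot> (Id C K \<odot> rtens_proj A X Y) =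
       rtens_proj A X Y \<cdot> (k \<odot> Id C (fst Y)) \<cdot> Inv C (Assoc C K (fst X) (fst Y)))"

definition mod_tens :: "('o, 'm) mon \<Rightarrow> 'o \<times> 'm \<Rightarrow> 'o \<times> 'm \<Rightarrow> 'o \<times> 'm" where
  "mod_tens A X Y = (rtens_obj A X Y, rtens_act A (Car A) (snd X) X Y)"

definition mod_tens_ftor ::
  "('o, 'm) mon \<Rightarrow> 'o \<times> 'm \<Rightarrow>
   ('o \<times> 'm, ('o \<times> 'm) \<times> ('o \<times> 'm) \<times> 'm, 'o \<times> 'm, ('o \<times> 'm) \<times> ('o \<times> 'm) \<times> 'm) ftor" where
  "mod_tens_ftor A X = \<lparr>FO = (\<lambda>Y. mod_tens A X Y),
     FA = (\<lambda>(Y, Y', g).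
       (mod_tens A X Y, mod_tens A X Y', rtens_map A (Id (Mod A) X) (Y, Y', g)))\<rparr>"


subsection \<open>Restriction and extension of scalars\<close>

definition restr_mod :: "'m \<Rightarrow> 'o \<times> 'm \<Rightarrow> 'o \<times> 'm" where
  "restr_mod h X = (fst X, snd X \<cdot> (h \<odot> Id C (fst X)))"

definition restr ::
  "'m \<Rightarrow> ('o \<times> 'm, ('o \<times> 'm) \<times> ('o \<times> 'm) \<times> 'm, 'o \<times> 'm, ('o \<times> 'm) \<times> ('o \<times> 'm) \<times> 'm) ftor" where
  "restr h = \<lparr>FO = restr_mod h, FA = (\<lambda>(X, Y, f). (restr_mod h X, restr_mod h Y, f))\<rparr>"

text \<open>The codomain \<open>B\<close> of \<open>h\<close>, regarded as an \<open>A\<close>-module.\<close>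

definition alg_mod :: "('o, 'm) mon \<Rightarrow> 'm \<Rightarrow> 'o \<times> 'm" where
  "alg_mod B h = restr_mod h (Car B, Mul B)"

definition ext_mod :: "('o, 'm) mon \<Rightarrow> ('o, 'm) mon \<Rightarrow> 'm \<Rightarrow> 'o \<times> 'm \<Rightarrow> 'o \<times> 'm" where
  "ext_mod A B h X =
     (rtens_obj A (alg_mod B h) X, rtens_act A (Car B) (Mul B) (alg_mod B h) X)"

definition ext ::
  "('o, 'm) mon \<Rightarrow> ('o, 'm) mon \<Rightarrow> 'm \<Rightarrow>
   ('o \<times> 'm, ('o \<times> 'm) \<times> ('o \<times> 'm) \<times> 'm, 'o \<times> 'm, ('o \<times> 'm) \<times> ('o \<times> 'm) \<times> 'm) ftor" where
  "ext A B h = \<lparr>FO = ext_mod A B h,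
     FA = (\<lambda>(X, Y, f).
       (ext_mod A B h X, ext_mod A B h Y,
        rtens_map A (Id (Mod A) (alg_mod B h)) (X, Y, f)))\<rparr>"


subsection \<open>Tensor products of commutative algebras\<close>

definition interchange :: "'o \<Rightarrow> 'o \<Rightarrow> 'o \<Rightarrow> 'o \<Rightarrow> 'm" where
  "interchange W X Y Z =
     Inv C (Assoc C W Y (X \<otimes> Z)) \<cdot>
     (Id C W \<odot> (Assoc C Y X Z \<cdot> (Sym C X Y \<odot> Id C Z) \<cdot> Inv C (Assoc C X Y Z))) \<cdot>
     Assoc C W X (Y \<otimes> Z)"

text \<open>For monoid maps \<open>h\<close> from \<open>A\<close> to \<open>B\<close> and \<open>k\<close> from \<open>A\<close> to \<open>D\<close>: the relative tensor product of
  \<open>B\<close> and \<open>D\<close> with its factorwise multiplication, and the two coprojections from \<open>B\<close> and \<open>D\<close>.\<close>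

definition alg_tens :: "('o, 'm) mon \<Rightarrow> ('o, 'm) mon \<Rightarrow> 'm \<Rightarrow> ('o, 'm) mon \<Rightarrow> 'm \<Rightarrow> ('o, 'm) mon" where
  "alg_tens A B h D k = (let
     T = rtens_obj A (alg_mod B h) (alg_mod D k);
     q = rtens_proj A (alg_mod B h) (alg_mod D k)
   in \<lparr>Car = T,
       Mul = (THE m. m \<in> Hom C (T \<otimes> T) T \<and>
         m \<cdot> (q \<odot> q) = q \<cdot> (Mul B \<odot> Mul D) \<cdot> interchange (Car B) (Car D) (Car B) (Car D)),
       Unt = q \<cdot> (Unt B \<odot> Unt D) \<cdot> Inv C (LUnit C (Unit C))\<rparr>)"

definition alg_in1 :: "('o, 'm) mon \<Rightarrow> ('o, 'm) mon \<Rightarrow> 'm \<Rightarrow> ('o, 'm) mon \<Rightarrow> 'm \<Rightarrow> 'm" where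
  "alg_in1 A B h D k = rtens_proj A (alg_mod B h) (alg_mod D k) \<cdot>
     (Id C (Car B) \<odot> Unt D) \<cdot> Inv C (RUnit C (Car B))"

definition alg_in2 :: "('o, 'm) mon \<Rightarrow> ('o, 'm) mon \<Rightarrow> 'm \<Rightarrow> ('o, 'm) mon \<Rightarrow> 'm \<Rightarrow> 'm" where
  "alg_in2 A B h D k = rtens_proj A (alg_mod B h) (alg_mod D k) \<cdot>
     (Unt B \<odot> Id C (Car D)) \<cdot> Inv C (LUnit C (Car D))"

text \<open>Commutative \<open>A\<close>-algebras are commutative monoids \<open>B\<close> with a structure map \<open>u\<close> from \<open>A\<close>,
  and their morphisms are the monoid maps under \<open>A\<close>.\<close>

definition algebra_hom :: "('o, 'm) mon \<Rightarrow> 'm \<Rightarrow> ('o, 'm) mon \<Rightarrow> 'm \<Rightarrow> 'm \<Rightarrow> bool" where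
  "algebra_hom B u B' u' c \<longleftrightarrow> monoid_hom B B' c \<and> c \<cdot> u = u'"

text \<open>For a commutative square \<open>\<theta> \<cdot> f = g \<cdot> \<psi>\<close> of commutative monoids with \<open>f\<close> from \<open>S'\<close> to \<open>S\<close>,
  \<open>\<psi>\<close> from \<open>S'\<close> to \<open>R'\<close>, and \<open>\<theta>\<close>, \<open>g\<close> into \<open>R\<close>: \<open>c\<close> is the map of commutative \<open>R'\<close>-algebras from the
  tensor product of \<open>S\<close> and \<open>R'\<close> over \<open>S'\<close> to \<open>R\<close> that extends \<open>\<theta>\<close>. There is exactly one such map.\<close>

definition comparison ::
  "('o, 'm) mon \<Rightarrow> ('o, 'm) mon \<Rightarrow> ('o, 'm) mon \<Rightarrow> ('o, 'm) mon \<Rightarrow>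
   'm \<Rightarrow> 'm \<Rightarrow> 'm \<Rightarrow> 'm \<Rightarrow> 'm \<Rightarrow> bool" where
  "comparison S' S R' R f g \<theta> \<psi> c \<longleftrightarrow>
     algebra_hom (alg_tens S' S f R' \<psi>) (alg_in2 S' S f R' \<psi>) R g c \<and>
     c \<cdot> alg_in1 S' S f R' \<psi> = \<theta>"

end

end

theory Submission
  imports Defs
begin

text \<open>
  The map \<open>f\<^sub>*\<psi>\<^sup>*X \<rightarrow> \<theta>\<^sup>*g\<^sub>*X\<close> is \<open>s \<otimes> x \<mapsto> \<theta> s \<otimes> x\<close>. Up to isomorphisms in \<open>C\<close> it is
  \<open>X \<otimes>\<^bsub>R'\<^esub> c\<close> for the comparison map \<open>c\<close>: on the source,
  \<open>S \<otimes>\<^bsub>S'\<^esub> X \<cong> X \<otimes>\<^bsub>R'\<^esub> (R' \<otimes>\<^bsub>S'\<^esub> S)\<close> by \<open>s \<otimes> x \<mapsto> x \<otimes> (1 \<otimes> s)\<close>, and on the target the two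
  factors are exchanged. So it is a weak equivalence when \<open>X\<close> is cofibrant, because \<open>X\<close> is then flat.

  Equations between arrows are checked on linear elements: an element of \<open>X\<close> is an arrow to \<open>X\<close> from a
  tensor product of labelled variables. Pairing elements with disjoint variables satisfies
  \<open>\<alpha>((a, b), c) = (a, (b, c))\<close> and \<open>\<sigma>(a, b) = (b, a)\<close> strictly, by coherence, and an arrow is
  determined by its values on variables.
\<close>

section \<open>Isomorphisms and unit coherence\<close>

text \<open>The tensor product is not strict, so a direct check that a map descends to a coequalizer
  would be dominated by associators and symmetries. The coherence that removes them is a statement
  about symmetric groups: an arrow made of adjacent transpositions, followed by the arrow that
  insertion sort builds on its target, equals the arrow that insertion sort builds on its source.
  Its inputs are naturality, involutivity and the Yang-Baxter equation for \<open>swap\<close>.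

  Relative tensor products and their maps are given by \<open>SOME\<close> and \<open>THE\<close>,
  so existence and uniqueness have to precede every formula on generators. Uniqueness rests on
  epimorphisms: the product is closed, tensoring preserves them, and so images of variables under
  coequalizer projections still detect equality of arrows.

  The order of factors matters. \<open>mod_tens_ftor\<close> keeps the flat module on the left and
  \<open>rtens_act\<close> lets scalars act on the left factor, whereas \<open>comparison\<close>
  starts at a product with R' on the right. The comparison map is therefore precomposed with an
  exchange of factors before flatness is applied to it.\<close>

lemma functor_comp:
  assumes "is_functor C D F" "is_functor D E G"
  shows "is_functor C E (G \<circ>\<^sub>F F)"
  using assms unfolding is_functor_def fcomp_def by (simp; blast)

context category begin

text \<open>Typing is expressed by \<open>Arr\<close>, \<open>Dom\<close> and \<open>Cod\<close>
  throughout, because these side conditions can be computed by rewriting, while a premise in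
  \<open>Hom C X Y\<close> leaves objects to be guessed.\<close>

lemma in_Hom: "f \<in> Hom C X Y \<longleftrightarrow> f \<in> Arr C \<and> Dom C f = X \<and> Cod C f = Y"
  by (auto simp: Hom_def)

lemma Id_arr [simp]:
  assumes "X \<in> Obj C"
  shows "Id C X \<in> Arr C" "Dom C (Id C X) = X" "Cod C (Id C X) = X"
  using Id_Hom[OF assms] by (auto simp: in_Hom)

lemma comp_arr [simp]:
  assumes "f \<in> Arr C" "g \<in> Arr C" "Dom C g = Cod C f"
  shows "g \<cdot> f \<in> Arr C" "Dom C (g \<cdot> f) = Dom C f" "Cod C (g \<cdot> f) = Cod C g"
  using Comp_Hom[of f "Dom C f" "Cod C f" g "Cod C g"] assms by (auto simp: in_Hom)

lemma comp_Id [simp]: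
  "\<lbrakk>f \<in> Arr C; Y = Cod C f\<rbrakk> \<Longrightarrow> Id C Y \<cdot> f = f"
  "\<lbrakk>f \<in> Arr C; X = Dom C f\<rbrakk> \<Longrightarrow> f \<cdot> Id C X = f"
  using Id_left[of f] Id_right[of f] by (auto simp: in_Hom)

lemma comp_assoc [simp]:
  "\<lbrakk>f \<in> Arr C; g \<in> Arr C; h \<in> Arr C; Dom C g = Cod C f; Dom C h = Cod C g\<rbrakk> \<Longrightarrow>
    (h \<cdot> g) \<cdot> f = h \<cdot> g \<cdot> f"
  using Comp_assoc[of f _ _ g _ h] by (auto simp: in_Hom)

declare Dom_Obj [simp] Cod_Obj [simp]

lemma inverse_arrows_unique:
  assumes "inverse_arrows C f g" "inverse_arrows C f h"
  shows "g = h"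
proof -
  have "g = (h \<cdot> f) \<cdot> g" using assms by (auto simp: inverse_arrows_def in_Hom simp del: comp_assoc)
  also have "\<dots> = h" using assms by (subst comp_assoc) (auto simp: inverse_arrows_def in_Hom)
  finally show ?thesis .
qed

lemma Inv_eqI: "inverse_arrows C f g \<Longrightarrow> Inv C f = g"
  unfolding Inv_def by (blast intro: inverse_arrows_unique)

lemma inverse_arrows_Inv: "is_iso C f \<Longrightarrow> inverse_arrows C f (Inv C f)"
  unfolding is_iso_def using Inv_eqI by auto

lemma is_isoI:
  assumes "f \<in> Arr C" "g \<in> Arr C" "Dom C g = Cod C f" "Cod C g = Dom C f"
    "g \<cdot> f = Id C (Dom C f)" "f \<cdot> g = Id C (Cod C f)"
  shows "is_iso C f"
  using assms by (auto simp: is_iso_def inverse_arrows_def in_Hom)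

lemma iso_arr: "is_iso C f \<Longrightarrow> f \<in> Arr C"
  by (auto simp: is_iso_def inverse_arrows_def)

lemma Inv_arr [simp]:
  assumes "is_iso C f"
  shows "Inv C f \<in> Arr C" "Dom C (Inv C f) = Cod C f" "Cod C (Inv C f) = Dom C f"
    "Inv C f \<cdot> f = Id C (Dom C f)" "f \<cdot> Inv C f = Id C (Cod C f)"
  using inverse_arrows_Inv[OF assms] by (auto simp: inverse_arrows_def in_Hom)

text \<open>Composites are normalised to the right, so a cancelling pair in the middle appears
  together with the tail \<open>k\<close>. Later cancellation rules have a second form for the same
  reason.\<close>

lemma Inv_cancel [simp]:
  assumes "is_iso C f" "k \<in> Arr C"
  shows "Cod C k = Dom C f \<Longrightarrow> Inv C f \<cdot> (f \<cdot> k) = k"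
    "Cod C k = Cod C f \<Longrightarrow> f \<cdot> (Inv C f \<cdot> k) = k"
  using assms iso_arr[OF assms(1)] by (simp_all flip: comp_assoc)

lemma iso_Id [simp]: "X \<in> Obj C \<Longrightarrow> is_iso C (Id C X)"
  by (rule is_isoI[of _ "Id C X"]) auto

lemma iso_Inv [simp]: "is_iso C f \<Longrightarrow> is_iso C (Inv C f)"
  by (rule is_isoI[of _ f]) (auto simp: iso_arr)

lemma iso_comp [simp]:
  "\<lbrakk>is_iso C f; is_iso C g; Dom C g = Cod C f\<rbrakk> \<Longrightarrow> is_iso C (g \<cdot> f)"
  by (rule is_isoI[of _ "Inv C f \<cdot> Inv C g"]) (auto simp: iso_arr)

lemma iso_cancel_right:
  assumes "f \<cdot> p = g \<cdot> p" "is_iso C p" "f \<in> Arr C" "g \<in> Arr C" "Dom C f = Cod C p" "Dom C g = Cod C p"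
  shows "f = g"
proof -
  have "(f \<cdot> p) \<cdot> Inv C p = (g \<cdot> p) \<cdot> Inv C p" using assms(1) by simp
  then show ?thesis using assms(2-) iso_arr[OF assms(2)] by simp
qed

lemma iso_cancel_left:
  assumes "p \<cdot> f = p \<cdot> g" "is_iso C p" "f \<in> Arr C" "g \<in> Arr C" "Cod C f = Dom C p" "Cod C g = Dom C p"
  shows "f = g"
proof -
  have "Inv C p \<cdot> (p \<cdot> f) = Inv C p \<cdot> (p \<cdot> g)" using assms(1) by simp
  then show ?thesis using assms(2-) iso_arr[OF assms(2)] by simp
qed

lemma Inv_left_eqI:
  assumes "f \<cdot> p = g" "is_iso C p" "f \<in> Arr C" "Dom C f = Cod C p"
  shows "f = g \<cdot> Inv C p"
  using assms iso_arr[OF assms(2)] by (auto simp flip: assms(1))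

end

context symmetric_monoidal_category begin

declare TensO_Obj [simp] Unit_Obj [simp] Assoc_iso [simp] LUnit_iso [simp] RUnit_iso [simp]

lemma tens_arr [simp]:
  assumes "f \<in> Arr C" "g \<in> Arr C"
  shows "f \<odot> g \<in> Arr C" "Dom C (f \<odot> g) = Dom C f \<otimes> Dom C g" "Cod C (f \<odot> g) = Cod C f \<otimes> Cod C g"
  using TensA_Hom[of f "Dom C f" "Cod C f" g "Dom C g" "Cod C g"] assms by (auto simp: in_Hom)

lemma structure_arr [simp]:
  assumes "X \<in> Obj C"
  shows "LUnit C X \<in> Arr C" "Dom C (LUnit C X) = Unit C \<otimes> X" "Cod C (LUnit C X) = X"
    "RUnit C X \<in> Arr C" "Dom C (RUnit C X) = X \<otimes> Unit C" "Cod C (RUnit C X) = X"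
    "Y \<in> Obj C \<Longrightarrow> Sym C X Y \<in> Arr C" "Y \<in> Obj C \<Longrightarrow> Dom C (Sym C X Y) = X \<otimes> Y"
    "Y \<in> Obj C \<Longrightarrow> Cod C (Sym C X Y) = Y \<otimes> X"
    "\<lbrakk>Y \<in> Obj C; Z \<in> Obj C\<rbrakk> \<Longrightarrow> Assoc C X Y Z \<in> Arr C"
    "\<lbrakk>Y \<in> Obj C; Z \<in> Obj C\<rbrakk> \<Longrightarrow> Dom C (Assoc C X Y Z) = (X \<otimes> Y) \<otimes> Z"
    "\<lbrakk>Y \<in> Obj C; Z \<in> Obj C\<rbrakk> \<Longrightarrow> Cod C (Assoc C X Y Z) = X \<otimes> (Y \<otimes> Z)"
  using LUnit_Hom[OF assms] RUnit_Hom[OF assms] Sym_Hom[OF assms, of Y] Assoc_Hom[OF assms, of Y Z]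
  by (auto simp: in_Hom)

lemma tens_Id [simp]: "\<lbrakk>X \<in> Obj C; Y \<in> Obj C\<rbrakk> \<Longrightarrow> Id C X \<odot> Id C Y = Id C (X \<otimes> Y)"
  by (rule TensA_Id)

lemma tens_comp [simp]:
  assumes "f \<in> Arr C" "g \<in> Arr C" "f' \<in> Arr C" "g' \<in> Arr C" "Dom C g = Cod C f" "Dom C g' = Cod C f'"
  shows "(g \<odot> g') \<cdot> (f \<odot> f') = (g \<cdot> f) \<odot> (g' \<cdot> f')"
    "\<lbrakk>k \<in> Arr C; Cod C k = Dom C f \<otimes> Dom C f'\<rbrakk> \<Longrightarrow>
      (g \<odot> g') \<cdot> ((f \<odot> f') \<cdot> k) = ((g \<cdot> f) \<odot> (g' \<cdot> f')) \<cdot> k"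
proof -
  show *: "(g \<odot> g') \<cdot> (f \<odot> f') = (g \<cdot> f) \<odot> (g' \<cdot> f')"
    using TensA_Comp[of f _ _ g _ f' _ _ g'] assms by (auto simp: in_Hom)
  show "\<lbrakk>k \<in> Arr C; Cod C k = Dom C f \<otimes> Dom C f'\<rbrakk> \<Longrightarrow>
      (g \<odot> g') \<cdot> ((f \<odot> f') \<cdot> k) = ((g \<cdot> f) \<odot> (g' \<cdot> f')) \<cdot> k"
    using assms by (simp flip: * comp_assoc)
qed

lemma Sym_Sym [simp]:
  assumes "X \<in> Obj C" "Y \<in> Obj C"
  shows "Sym C Y X \<cdot> Sym C X Y = Id C (X \<otimes> Y)"
    "\<lbrakk>k \<in> Arr C; Cod C k = X \<otimes> Y\<rbrakk> \<Longrightarrow> Sym C Y X \<cdot> (Sym C X Y \<cdot> k) = k"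
  using symmetry[OF assms] assms by (auto simp flip: comp_assoc)

lemma Sym_iso [simp]: "\<lbrakk>X \<in> Obj C; Y \<in> Obj C\<rbrakk> \<Longrightarrow> is_iso C (Sym C X Y)"
  by (rule is_isoI[of _ "Sym C Y X"]) auto

lemma tens_iso [simp]: "\<lbrakk>is_iso C f; is_iso C g\<rbrakk> \<Longrightarrow> is_iso C (f \<odot> g)"
  by (rule is_isoI[of _ "Inv C f \<odot> Inv C g"]) (auto simp: iso_arr)

lemma Assoc_natural:
  assumes "f \<in> Arr C" "g \<in> Arr C" "h \<in> Arr C" "X = Cod C f" "Y = Cod C g" "Z = Cod C h"
  shows "Assoc C X Y Z \<cdot> ((f \<odot> g) \<odot> h) = (f \<odot> (g \<odot> h)) \<cdot> Assoc C (Dom C f) (Dom C g) (Dom C h)"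
  using Assoc_nat[of f _ X g _ Y h _ Z] assms by (auto simp: in_Hom)

lemma Inv_Assoc_natural:
  assumes "f \<in> Arr C" "g \<in> Arr C" "h \<in> Arr C" "X = Cod C f" "Y = Cod C g" "Z = Cod C h"
  shows "Inv C (Assoc C X Y Z) \<cdot> (f \<odot> (g \<odot> h)) =
    ((f \<odot> g) \<odot> h) \<cdot> Inv C (Assoc C (Dom C f) (Dom C g) (Dom C h))"
proof (rule iso_cancel_left[of "Assoc C X Y Z"])
  have "(Assoc C X Y Z \<cdot> ((f \<odot> g) \<odot> h)) \<cdot> Inv C (Assoc C (Dom C f) (Dom C g) (Dom C h)) =
     ((f \<odot> (g \<odot> h)) \<cdot> Assoc C (Dom C f) (Dom C g) (Dom C h)) \<cdot> Inv C (Assoc C (Dom C f) (Dom C g) (Dom C h))"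
    using Assoc_natural[OF assms] by (simp only:)
  then show "Assoc C X Y Z \<cdot> (Inv C (Assoc C X Y Z) \<cdot> (f \<odot> (g \<odot> h))) =
    Assoc C X Y Z \<cdot> (((f \<odot> g) \<odot> h) \<cdot> Inv C (Assoc C (Dom C f) (Dom C g) (Dom C h)))"
    using assms by simp
qed (use assms in auto)

lemma Sym_natural:
  assumes "f \<in> Arr C" "g \<in> Arr C" "X = Cod C f" "Y = Cod C g"
  shows "Sym C X Y \<cdot> (f \<odot> g) = (g \<odot> f) \<cdot> Sym C (Dom C f) (Dom C g)"
  using Sym_nat[of f _ X g _ Y] assms by (auto simp: in_Hom)

lemma LUnit_natural:
  assumes "f \<in> Arr C" "X = Cod C f"
  shows "LUnit C X \<cdot> (Id C (Unit C) \<odot> f) = f \<cdot> LUnit C (Dom C f)"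
  using LUnit_nat[of f _ X] assms by (auto simp: in_Hom)

lemma RUnit_natural:
  assumes "f \<in> Arr C" "X = Cod C f"
  shows "RUnit C X \<cdot> (f \<odot> Id C (Unit C)) = f \<cdot> RUnit C (Dom C f)"
  using RUnit_nat[of f _ X] assms by (auto simp: in_Hom)

lemma Unit_tens_cancel:
  assumes "Id C (Unit C) \<odot> f = Id C (Unit C) \<odot> g" "f \<in> Arr C" "g \<in> Arr C" "Dom C f = Dom C g" "Cod C f = Cod C g"
  shows "f = g"
proof (rule iso_cancel_right[of _ "LUnit C (Dom C f)"])
  show "f \<cdot> LUnit C (Dom C f) = g \<cdot> LUnit C (Dom C f)"
    using LUnit_natural[of f "Cod C f"] LUnit_natural[of g "Cod C g"] assms by simp
qed (use assms in auto)

lemma tens_Unit_cancel: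
  assumes "f \<odot> Id C (Unit C) = g \<odot> Id C (Unit C)" "f \<in> Arr C" "g \<in> Arr C" "Dom C f = Dom C g" "Cod C f = Cod C g"
  shows "f = g"
proof (rule iso_cancel_right[of _ "RUnit C (Dom C f)"])
  show "f \<cdot> RUnit C (Dom C f) = g \<cdot> RUnit C (Dom C f)"
    using RUnit_natural[of f "Cod C f"] RUnit_natural[of g "Cod C g"] assms by simp
qed (use assms in auto)

text \<open>Kelly's argument: the unit may be tensored on the left without losing information, and
  then the pentagon for I, I, X, Y and two triangles give the claim.\<close>

lemma LUnit_tens:
  assumes [simp]: "X \<in> Obj C" "Y \<in> Obj C"
  shows "LUnit C (X \<otimes> Y) \<cdot> Assoc C (Unit C) X Y = LUnit C X \<odot> Id C Y"
proof (rule Unit_tens_cancel)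
  let ?I = "Unit C"
  \<comment> \<open>Composing with this isomorphism completes one side of the pentagon, whose other
    side meets the triangle.\<close>
  let ?p = "Assoc C ?I (?I \<otimes> X) Y \<cdot> (Assoc C ?I ?I X \<odot> Id C Y)"
  show "Id C ?I \<odot> (LUnit C (X \<otimes> Y) \<cdot> Assoc C ?I X Y) = Id C ?I \<odot> (LUnit C X \<odot> Id C Y)"
  proof (rule iso_cancel_right[of _ ?p])
    have "(Id C ?I \<odot> (LUnit C (X \<otimes> Y) \<cdot> Assoc C ?I X Y)) \<cdot> ?p =
       (Id C ?I \<odot> LUnit C (X \<otimes> Y)) \<cdot> ((Id C ?I \<odot> Assoc C ?I X Y) \<cdot> ?p)"
      by simp
    also have "\<dots> = (Id C ?I \<odot> LUnit C (X \<otimes> Y)) \<cdot> (Assoc C ?I ?I (X \<otimes> Y) \<cdot> Assoc C (?I \<otimes> ?I) X Y)"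
      by (subst pentagon) auto
    also have "\<dots> = ((Id C ?I \<odot> LUnit C (X \<otimes> Y)) \<cdot> Assoc C ?I ?I (X \<otimes> Y)) \<cdot> Assoc C (?I \<otimes> ?I) X Y"
      by simp
    also have "\<dots> = (RUnit C ?I \<odot> (Id C X \<odot> Id C Y)) \<cdot> Assoc C (?I \<otimes> ?I) X Y"
      by (subst triangle) auto
    also have "\<dots> = Assoc C ?I X Y \<cdot> ((RUnit C ?I \<odot> Id C X) \<odot> Id C Y)"
      by (subst Assoc_natural) auto
    also have "\<dots> = Assoc C ?I X Y \<cdot> (((Id C ?I \<odot> LUnit C X) \<odot> Id C Y) \<cdot> (Assoc C ?I ?I X \<odot> Id C Y))"
      by (subst triangle[symmetric]) auto
    also have "\<dots> = (Assoc C ?I X Y \<cdot> ((Id C ?I \<odot> LUnit C X) \<odot> Id C Y)) \<cdot> (Assoc C ?I ?I X \<odot> Id C Y)"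
      by simp
    also have "\<dots> = (Id C ?I \<odot> (LUnit C X \<odot> Id C Y)) \<cdot> ?p"
      by (subst Assoc_natural) auto
    finally show "(Id C ?I \<odot> (LUnit C (X \<otimes> Y) \<cdot> Assoc C ?I X Y)) \<cdot> ?p = (Id C ?I \<odot> (LUnit C X \<odot> Id C Y)) \<cdot> ?p" .
  qed auto
qed auto

lemma RUnit_tens:
  assumes [simp]: "X \<in> Obj C" "Y \<in> Obj C"
  shows "(Id C X \<odot> RUnit C Y) \<cdot> Assoc C X Y (Unit C) = RUnit C (X \<otimes> Y)"
proof (rule tens_Unit_cancel)
  let ?I = "Unit C"
  show "((Id C X \<odot> RUnit C Y) \<cdot> Assoc C X Y ?I) \<odot> Id C ?I = RUnit C (X \<otimes> Y) \<odot> Id C ?I"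
  proof (rule iso_cancel_left[of "Assoc C X Y ?I"])
    have "Assoc C X Y ?I \<cdot> (((Id C X \<odot> RUnit C Y) \<cdot> Assoc C X Y ?I) \<odot> Id C ?I) =
       (Assoc C X Y ?I \<cdot> ((Id C X \<odot> RUnit C Y) \<odot> Id C ?I)) \<cdot> (Assoc C X Y ?I \<odot> Id C ?I)"
      by simp
    also have "\<dots> = ((Id C X \<odot> (RUnit C Y \<odot> Id C ?I)) \<cdot> Assoc C X (Y \<otimes> ?I) ?I) \<cdot> (Assoc C X Y ?I \<odot> Id C ?I)"
      by (subst Assoc_natural) auto
    also have "\<dots> = ((Id C X \<odot> ((Id C Y \<odot> LUnit C ?I) \<cdot> Assoc C Y ?I ?I)) \<cdot> Assoc C X (Y \<otimes> ?I) ?I) \<cdot> (Assoc C X Y ?I \<odot> Id C ?I)"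
      by (subst triangle) auto
    also have "\<dots> = (Id C X \<odot> (Id C Y \<odot> LUnit C ?I)) \<cdot> ((Id C X \<odot> Assoc C Y ?I ?I) \<cdot> Assoc C X (Y \<otimes> ?I) ?I \<cdot> (Assoc C X Y ?I \<odot> Id C ?I))"
      by simp
    also have "\<dots> = (Id C X \<odot> (Id C Y \<odot> LUnit C ?I)) \<cdot> (Assoc C X Y (?I \<otimes> ?I) \<cdot> Assoc C (X \<otimes> Y) ?I ?I)"
      by (subst pentagon) auto
    also have "\<dots> = ((Id C X \<odot> (Id C Y \<odot> LUnit C ?I)) \<cdot> Assoc C X Y (?I \<otimes> ?I)) \<cdot> Assoc C (X \<otimes> Y) ?I ?I"
      by simp
    also have "\<dots> = (Assoc C X Y ?I \<cdot> ((Id C X \<odot> Id C Y) \<odot> LUnit C ?I)) \<cdot> Assoc C (X \<otimes> Y) ?I ?I"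
      by (subst Assoc_natural) auto
    also have "\<dots> = Assoc C X Y ?I \<cdot> ((Id C (X \<otimes> Y) \<odot> LUnit C ?I) \<cdot> Assoc C (X \<otimes> Y) ?I ?I)"
      by simp
    also have "\<dots> = Assoc C X Y ?I \<cdot> (RUnit C (X \<otimes> Y) \<odot> Id C ?I)"
      by (subst triangle) auto
    finally show "Assoc C X Y ?I \<cdot> (((Id C X \<odot> RUnit C Y) \<cdot> Assoc C X Y ?I) \<odot> Id C ?I) =
      Assoc C X Y ?I \<cdot> (RUnit C (X \<otimes> Y) \<odot> Id C ?I)" .
  qed auto
qed auto

text \<open>Naturality of the left unitor along itself identifies \<open>LUnit\<close> at I
  \<otimes> I with Id \<otimes> \<open>LUnit\<close>; then \<open>LUnit_tens\<close> and the
  triangle differ only in the unitor.\<close>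

lemma LUnit_Unit: "LUnit C (Unit C) = RUnit C (Unit C)"
proof (rule tens_Unit_cancel)
  let ?I = "Unit C"
  have "LUnit C (?I \<otimes> ?I) = Id C ?I \<odot> LUnit C ?I"
    by (rule iso_cancel_left[of "LUnit C ?I"]) (use LUnit_natural[of "LUnit C ?I" ?I] in auto)
  then show "LUnit C ?I \<odot> Id C ?I = RUnit C ?I \<odot> Id C ?I"
    using LUnit_tens[of ?I ?I] triangle[of ?I ?I] by simp
qed auto

text \<open>The hexagon at X, I, I, after tensoring with the unit on the right. This is what makes
  pairing with \<open>star\<close> on the right follow from the left.\<close>

lemma LUnit_Sym:
  assumes [simp]: "X \<in> Obj C"
  shows "LUnit C X \<cdot> Sym C X (Unit C) = RUnit C X"
proof (rule tens_Unit_cancel)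
  let ?I = "Unit C"
  show "(LUnit C X \<cdot> Sym C X ?I) \<odot> Id C ?I = RUnit C X \<odot> Id C ?I"
  proof (rule iso_cancel_left[of "Sym C X ?I"])
    have "Sym C X ?I \<cdot> (RUnit C X \<odot> Id C ?I) = Sym C X ?I \<cdot> ((Id C X \<odot> LUnit C ?I) \<cdot> Assoc C X ?I ?I)"
      by (subst triangle) auto
    also have "\<dots> = (Sym C X ?I \<cdot> (Id C X \<odot> LUnit C ?I)) \<cdot> Assoc C X ?I ?I"
      by simp
    also have "\<dots> = ((LUnit C ?I \<odot> Id C X) \<cdot> Sym C X (?I \<otimes> ?I)) \<cdot> Assoc C X ?I ?I"
      by (subst Sym_natural) auto
    also have "\<dots> = ((LUnit C (?I \<otimes> X) \<cdot> Assoc C ?I ?I X) \<cdot> Sym C X (?I \<otimes> ?I)) \<cdot> Assoc C X ?I ?I"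
      by (subst LUnit_tens) auto
    also have "\<dots> = LUnit C (?I \<otimes> X) \<cdot> (Assoc C ?I ?I X \<cdot> Sym C X (?I \<otimes> ?I) \<cdot> Assoc C X ?I ?I)"
      by simp
    also have "\<dots> = LUnit C (?I \<otimes> X) \<cdot> ((Id C ?I \<odot> Sym C X ?I) \<cdot> Assoc C ?I X ?I \<cdot> (Sym C X ?I \<odot> Id C ?I))"
      by (subst hexagon) auto
    also have "\<dots> = (LUnit C (?I \<otimes> X) \<cdot> (Id C ?I \<odot> Sym C X ?I)) \<cdot> (Assoc C ?I X ?I \<cdot> (Sym C X ?I \<odot> Id C ?I))"
      by simp
    also have "\<dots> = Sym C X ?I \<cdot> (LUnit C (X \<otimes> ?I) \<cdot> Assoc C ?I X ?I) \<cdot> (Sym C X ?I \<odot> Id C ?I)"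
      by (subst LUnit_natural) auto
    also have "\<dots> = Sym C X ?I \<cdot> ((LUnit C X \<odot> Id C ?I) \<cdot> (Sym C X ?I \<odot> Id C ?I))"
      by (subst LUnit_tens) auto
    also have "\<dots> = Sym C X ?I \<cdot> ((LUnit C X \<cdot> Sym C X ?I) \<odot> Id C ?I)"
      by simp
    finally show "Sym C X ?I \<cdot> ((LUnit C X \<cdot> Sym C X ?I) \<odot> Id C ?I) = Sym C X ?I \<cdot> (RUnit C X \<odot> Id C ?I)" ..
  qed auto
qed auto

section \<open>Coherence for permutations\<close>

text \<open>The adjacent transposition in a right-nested product: the first two factors are
  exchanged in front of the rest \<open>Z\<close>.\<close>

definition swap :: "'o \<Rightarrow> 'o \<Rightarrow> 'o \<Rightarrow> 'm" where
  "swap X Y Z = Assoc C Y X Z \<cdot> (Sym C X Y \<odot> Id C Z) \<cdot> Inv C (Assoc C X Y Z)"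

lemma swap_arr [simp]:
  assumes "X \<in> Obj C" "Y \<in> Obj C" "Z \<in> Obj C"
  shows "swap X Y Z \<in> Arr C" "Dom C (swap X Y Z) = X \<otimes> (Y \<otimes> Z)" "Cod C (swap X Y Z) = Y \<otimes> (X \<otimes> Z)"
    "is_iso C (swap X Y Z)"
  using assms by (simp_all add: swap_def)

lemma swap_Assoc:
  assumes "X \<in> Obj C" "Y \<in> Obj C" "Z \<in> Obj C"
  shows "swap X Y Z \<cdot> Assoc C X Y Z = Assoc C Y X Z \<cdot> (Sym C X Y \<odot> Id C Z)"
  using assms by (simp add: swap_def)

lemma swap_swap [simp]:
  assumes "X \<in> Obj C" "Y \<in> Obj C" "Z \<in> Obj C"
  shows "swap Y X Z \<cdot> swap X Y Z = Id C (X \<otimes> (Y \<otimes> Z))"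
    "\<lbrakk>k \<in> Arr C; Cod C k = X \<otimes> (Y \<otimes> Z)\<rbrakk> \<Longrightarrow> swap Y X Z \<cdot> (swap X Y Z \<cdot> k) = k"
  using assms by (simp_all add: swap_def)

lemma swap_natural:
  assumes [simp]: "f \<in> Arr C" "g \<in> Arr C" "h \<in> Arr C" and eq: "X = Cod C f" "Y = Cod C g" "Z = Cod C h"
  shows "swap X Y Z \<cdot> (f \<odot> (g \<odot> h)) = (g \<odot> (f \<odot> h)) \<cdot> swap (Dom C f) (Dom C g) (Dom C h)"
proof -
  have "swap X Y Z \<cdot> (f \<odot> (g \<odot> h)) =
     (Assoc C Y X Z \<cdot> (Sym C X Y \<odot> Id C Z)) \<cdot> (Inv C (Assoc C X Y Z) \<cdot> (f \<odot> (g \<odot> h)))"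
    by (simp add: swap_def eq)
  also have "\<dots> = (Assoc C Y X Z \<cdot> (Sym C X Y \<odot> Id C Z)) \<cdot> (((f \<odot> g) \<odot> h) \<cdot> Inv C (Assoc C (Dom C f) (Dom C g) (Dom C h)))"
    by (subst Inv_Assoc_natural) (auto simp: eq)
  also have "\<dots> = Assoc C Y X Z \<cdot> ((Sym C X Y \<cdot> (f \<odot> g)) \<odot> h) \<cdot> Inv C (Assoc C (Dom C f) (Dom C g) (Dom C h))"
    by (simp add: eq)
  also have "\<dots> = Assoc C Y X Z \<cdot> (((g \<odot> f) \<cdot> Sym C (Dom C f) (Dom C g)) \<odot> h) \<cdot> Inv C (Assoc C (Dom C f) (Dom C g) (Dom C h))"
    by (subst Sym_natural) (auto simp: eq)
  also have "\<dots> = (Assoc C Y X Z \<cdot> ((g \<odot> f) \<odot> h)) \<cdot> ((Sym C (Dom C f) (Dom C g) \<odot> Id C (Dom C h)) \<cdot> Inv C (Assoc C (Dom C f) (Dom C g) (Dom C h)))"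
    by (simp add: eq)
  also have "\<dots> = (g \<odot> (f \<odot> h)) \<cdot> swap (Dom C f) (Dom C g) (Dom C h)"
    by (subst Assoc_natural) (auto simp: eq swap_def)
  finally show ?thesis .
qed

text \<open>Moving X past a product is moving it past the two factors in turn. Composing with
  associators turns \<open>swap\<close> into \<open>Sym\<close> by \<open>swap_Assoc\<close>, after
  which the hexagon and the pentagon apply.\<close>

lemma swap_hexagon:
  assumes [simp]: "X \<in> Obj C" "Y \<in> Obj C" "Z \<in> Obj C" "W \<in> Obj C"
  shows "(Id C Y \<odot> swap X Z W) \<cdot> swap X Y (Z \<otimes> W) \<cdot> (Id C X \<odot> Assoc C Y Z W) =
    Assoc C Y Z (X \<otimes> W) \<cdot> swap X (Y \<otimes> Z) W"
proof (rule iso_cancel_right[of _ "Assoc C X (Y \<otimes> Z) W \<cdot> (Assoc C X Y Z \<odot> Id C W)"])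
  let ?p = "Assoc C X (Y \<otimes> Z) W \<cdot> (Assoc C X Y Z \<odot> Id C W)"
  have "((Id C Y \<odot> swap X Z W) \<cdot> swap X Y (Z \<otimes> W) \<cdot> (Id C X \<odot> Assoc C Y Z W)) \<cdot> ?p =
     ((Id C Y \<odot> swap X Z W) \<cdot> swap X Y (Z \<otimes> W)) \<cdot> ((Id C X \<odot> Assoc C Y Z W) \<cdot> ?p)"
    by simp
  also have "\<dots> = ((Id C Y \<odot> swap X Z W) \<cdot> swap X Y (Z \<otimes> W)) \<cdot> (Assoc C X Y (Z \<otimes> W) \<cdot> Assoc C (X \<otimes> Y) Z W)"
    by (subst pentagon) auto
  also have "\<dots> = (Id C Y \<odot> swap X Z W) \<cdot> (swap X Y (Z \<otimes> W) \<cdot> Assoc C X Y (Z \<otimes> W)) \<cdot> Assoc C (X \<otimes> Y) Z W"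
    by simp
  also have "\<dots> = (Id C Y \<odot> swap X Z W) \<cdot> Assoc C Y X (Z \<otimes> W) \<cdot> (Sym C X Y \<odot> (Id C Z \<odot> Id C W)) \<cdot> Assoc C (X \<otimes> Y) Z W"
    by (subst swap_Assoc) auto
  also have "\<dots> = (Id C Y \<odot> swap X Z W) \<cdot> Assoc C Y X (Z \<otimes> W) \<cdot> (Assoc C (Y \<otimes> X) Z W \<cdot> ((Sym C X Y \<odot> Id C Z) \<odot> Id C W))"
    by (subst Assoc_natural) auto
  also have "\<dots> = (Id C Y \<odot> swap X Z W) \<cdot> (Assoc C Y X (Z \<otimes> W) \<cdot> Assoc C (Y \<otimes> X) Z W) \<cdot> ((Sym C X Y \<odot> Id C Z) \<odot> Id C W)"
    by simp
  also have "\<dots> = (Id C Y \<odot> (swap X Z W \<cdot> Assoc C X Z W)) \<cdot> Assoc C Y (X \<otimes> Z) W \<cdot> ((Assoc C Y X Z \<cdot> (Sym C X Y \<odot> Id C Z)) \<odot> Id C W)"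
    by (subst pentagon) auto
  also have "\<dots> = (Id C Y \<odot> Assoc C Z X W) \<cdot> ((Id C Y \<odot> (Sym C X Z \<odot> Id C W)) \<cdot> Assoc C Y (X \<otimes> Z) W) \<cdot> ((Assoc C Y X Z \<cdot> (Sym C X Y \<odot> Id C Z)) \<odot> Id C W)"
    by (subst swap_Assoc) auto
  also have "\<dots> = (Id C Y \<odot> Assoc C Z X W) \<cdot> (Assoc C Y (Z \<otimes> X) W \<cdot> ((Id C Y \<odot> Sym C X Z) \<odot> Id C W)) \<cdot> ((Assoc C Y X Z \<cdot> (Sym C X Y \<odot> Id C Z)) \<odot> Id C W)"
    by (subst Assoc_natural) auto
  also have "\<dots> = (Id C Y \<odot> Assoc C Z X W) \<cdot> Assoc C Y (Z \<otimes> X) W \<cdot> (((Id C Y \<odot> Sym C X Z) \<cdot> Assoc C Y X Z \<cdot> (Sym C X Y \<odot> Id C Z)) \<odot> Id C W)"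
    by simp
  also have "\<dots> = (Id C Y \<odot> Assoc C Z X W) \<cdot> Assoc C Y (Z \<otimes> X) W \<cdot> ((Assoc C Y Z X \<cdot> Sym C X (Y \<otimes> Z) \<cdot> Assoc C X Y Z) \<odot> Id C W)"
    by (subst hexagon) auto
  also have "\<dots> = ((Id C Y \<odot> Assoc C Z X W) \<cdot> Assoc C Y (Z \<otimes> X) W \<cdot> (Assoc C Y Z X \<odot> Id C W)) \<cdot> ((Sym C X (Y \<otimes> Z) \<cdot> Assoc C X Y Z) \<odot> Id C W)"
    by simp
  also have "\<dots> = (Assoc C Y Z (X \<otimes> W) \<cdot> Assoc C (Y \<otimes> Z) X W) \<cdot> ((Sym C X (Y \<otimes> Z) \<cdot> Assoc C X Y Z) \<odot> Id C W)"
    by (subst pentagon) auto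
  also have "\<dots> = (Assoc C Y Z (X \<otimes> W) \<cdot> (Assoc C (Y \<otimes> Z) X W \<cdot> (Sym C X (Y \<otimes> Z) \<odot> Id C W))) \<cdot> (Assoc C X Y Z \<odot> Id C W)"
    by simp
  also have "\<dots> = (Assoc C Y Z (X \<otimes> W) \<cdot> (swap X (Y \<otimes> Z) W \<cdot> Assoc C X (Y \<otimes> Z) W)) \<cdot> (Assoc C X Y Z \<odot> Id C W)"
    by (subst swap_Assoc) auto
  also have "\<dots> = (Assoc C Y Z (X \<otimes> W) \<cdot> swap X (Y \<otimes> Z) W) \<cdot> ?p"
    by simp
  finally show "((Id C Y \<odot> swap X Z W) \<cdot> swap X Y (Z \<otimes> W) \<cdot> (Id C X \<odot> Assoc C Y Z W)) \<cdot> ?p =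
    (Assoc C Y Z (X \<otimes> W) \<cdot> swap X (Y \<otimes> Z) W) \<cdot> ?p" .
qed auto

text \<open>By \<open>swap_hexagon\<close> both sides carry X past a product of Y and Z; by
  naturality the exchange of Y and Z may come before or after that.\<close>

lemma yang_baxter:
  assumes [simp]: "X \<in> Obj C" "Y \<in> Obj C" "Z \<in> Obj C" "W \<in> Obj C"
  shows "swap Y Z (X \<otimes> W) \<cdot> (Id C Y \<odot> swap X Z W) \<cdot> swap X Y (Z \<otimes> W) =
    (Id C Z \<odot> swap X Y W) \<cdot> swap X Z (Y \<otimes> W) \<cdot> (Id C X \<odot> swap Y Z W)"
proof (rule iso_cancel_right[of _ "Id C X \<odot> Assoc C Y Z W"])
  have "(swap Y Z (X \<otimes> W) \<cdot> (Id C Y \<odot> swap X Z W) \<cdot> swap X Y (Z \<otimes> W)) \<cdot> (Id C X \<odot> Assoc C Y Z W) =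
    swap Y Z (X \<otimes> W) \<cdot> ((Id C Y \<odot> swap X Z W) \<cdot> swap X Y (Z \<otimes> W) \<cdot> (Id C X \<odot> Assoc C Y Z W))"
    by simp
  also have "\<dots> = (swap Y Z (X \<otimes> W) \<cdot> Assoc C Y Z (X \<otimes> W)) \<cdot> swap X (Y \<otimes> Z) W"
    by (subst swap_hexagon) auto
  also have "\<dots> = Assoc C Z Y (X \<otimes> W) \<cdot> ((Sym C Y Z \<odot> (Id C X \<odot> Id C W)) \<cdot> swap X (Y \<otimes> Z) W)"
    by (subst swap_Assoc) auto
  also have "\<dots> = Assoc C Z Y (X \<otimes> W) \<cdot> (swap X (Z \<otimes> Y) W \<cdot> (Id C X \<odot> (Sym C Y Z \<odot> Id C W)))"
    by (subst swap_natural) auto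
  also have "\<dots> = (Assoc C Z Y (X \<otimes> W) \<cdot> swap X (Z \<otimes> Y) W) \<cdot> (Id C X \<odot> (Sym C Y Z \<odot> Id C W))"
    by simp
  also have "\<dots> = ((Id C Z \<odot> swap X Y W) \<cdot> swap X Z (Y \<otimes> W)) \<cdot> (Id C X \<odot> (Assoc C Z Y W \<cdot> (Sym C Y Z \<odot> Id C W)))"
    by (subst swap_hexagon[symmetric]) auto
  also have "\<dots> = ((Id C Z \<odot> swap X Y W) \<cdot> swap X Z (Y \<otimes> W)) \<cdot> (Id C X \<odot> (swap Y Z W \<cdot> Assoc C Y Z W))"
    by (subst swap_Assoc) auto
  also have "\<dots> = ((Id C Z \<odot> swap X Y W) \<cdot> swap X Z (Y \<otimes> W) \<cdot> (Id C X \<odot> swap Y Z W)) \<cdot> (Id C X \<odot> Assoc C Y Z W)"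
    by simp
  finally show "(swap Y Z (X \<otimes> W) \<cdot> (Id C Y \<odot> swap X Z W) \<cdot> swap X Y (Z \<otimes> W)) \<cdot> (Id C X \<odot> Assoc C Y Z W) =
    ((Id C Z \<odot> swap X Y W) \<cdot> swap X Z (Y \<otimes> W) \<cdot> (Id C X \<odot> swap Y Z W)) \<cdot> (Id C X \<odot> Assoc C Y Z W)" .
qed auto

text \<open>Lets a transposition inside the left one of two blocks be carried out after the blocks
  are joined; used in \<open>perm_merge_left\<close>.\<close>

lemma swap_tens:
  assumes [simp]: "X \<in> Obj C" "Y \<in> Obj C" "Z \<in> Obj C" "W \<in> Obj C"
  shows "(Id C Y \<odot> Assoc C X Z W) \<cdot> Assoc C Y (X \<otimes> Z) W \<cdot> (swap X Y Z \<odot> Id C W) =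
    swap X Y (Z \<otimes> W) \<cdot> (Id C X \<odot> Assoc C Y Z W) \<cdot> Assoc C X (Y \<otimes> Z) W"
proof (rule iso_cancel_right[of _ "Assoc C X Y Z \<odot> Id C W"])
  let ?p = "Assoc C X Y Z \<odot> Id C W"
  have "((Id C Y \<odot> Assoc C X Z W) \<cdot> Assoc C Y (X \<otimes> Z) W \<cdot> (swap X Y Z \<odot> Id C W)) \<cdot> ?p =
     (Id C Y \<odot> Assoc C X Z W) \<cdot> Assoc C Y (X \<otimes> Z) W \<cdot> ((swap X Y Z \<cdot> Assoc C X Y Z) \<odot> Id C W)"
    by simp
  also have "\<dots> = ((Id C Y \<odot> Assoc C X Z W) \<cdot> Assoc C Y (X \<otimes> Z) W \<cdot> (Assoc C Y X Z \<odot> Id C W)) \<cdot> ((Sym C X Y \<odot> Id C Z) \<odot> Id C W)"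
    by (subst swap_Assoc) auto
  also have "\<dots> = Assoc C Y X (Z \<otimes> W) \<cdot> (Assoc C (Y \<otimes> X) Z W \<cdot> ((Sym C X Y \<odot> Id C Z) \<odot> Id C W))"
    by (subst pentagon[symmetric]) auto
  also have "\<dots> = (Assoc C Y X (Z \<otimes> W) \<cdot> (Sym C X Y \<odot> Id C (Z \<otimes> W))) \<cdot> Assoc C (X \<otimes> Y) Z W"
    by (subst Assoc_natural) auto
  also have "\<dots> = (swap X Y (Z \<otimes> W) \<cdot> Assoc C X Y (Z \<otimes> W)) \<cdot> Assoc C (X \<otimes> Y) Z W"
    by (subst swap_Assoc) auto
  also have "\<dots> = swap X Y (Z \<otimes> W) \<cdot> (Assoc C X Y (Z \<otimes> W) \<cdot> Assoc C (X \<otimes> Y) Z W)"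
    by simp
  also have "\<dots> = (swap X Y (Z \<otimes> W) \<cdot> (Id C X \<odot> Assoc C Y Z W) \<cdot> Assoc C X (Y \<otimes> Z) W) \<cdot> ?p"
    by (subst pentagon) auto
  finally show "((Id C Y \<odot> Assoc C X Z W) \<cdot> Assoc C Y (X \<otimes> Z) W \<cdot> (swap X Y Z \<odot> Id C W)) \<cdot> ?p =
    (swap X Y (Z \<otimes> W) \<cdot> (Id C X \<odot> Assoc C Y Z W) \<cdot> Assoc C X (Y \<otimes> Z) W) \<cdot> ?p" .
qed auto

lemma swap_Unit:
  assumes [simp]: "X \<in> Obj C" "Z \<in> Obj C"
  shows "LUnit C (X \<otimes> Z) \<cdot> swap X (Unit C) Z = Id C X \<odot> LUnit C Z"
proof (rule iso_cancel_right[of _ "Assoc C X (Unit C) Z"])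
  have "(LUnit C (X \<otimes> Z) \<cdot> swap X (Unit C) Z) \<cdot> Assoc C X (Unit C) Z =
    (LUnit C (X \<otimes> Z) \<cdot> Assoc C (Unit C) X Z) \<cdot> (Sym C X (Unit C) \<odot> Id C Z)"
    by (simp add: swap_Assoc)
  also have "\<dots> = (Id C X \<odot> LUnit C Z) \<cdot> Assoc C X (Unit C) Z"
    by (simp add: LUnit_tens LUnit_Sym triangle)
  finally show "(LUnit C (X \<otimes> Z) \<cdot> swap X (Unit C) Z) \<cdot> Assoc C X (Unit C) Z =
    (Id C X \<odot> LUnit C Z) \<cdot> Assoc C X (Unit C) Z" .
qed auto

text \<open>The hexagon splits the second argument of \<open>Sym\<close>. Composing with the
  opposite symmetry makes it split the first, which is the form needed for induction on
  lists.\<close>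

lemma Sym_tens:
  assumes [simp]: "X \<in> Obj C" "Y \<in> Obj C" "Z \<in> Obj C"
  shows "Sym C (X \<otimes> Y) Z = swap X Z Y \<cdot> (Id C X \<odot> Sym C Y Z) \<cdot> Assoc C X Y Z"
proof (rule iso_cancel_right[of _ "Sym C Z (X \<otimes> Y) \<cdot> Assoc C Z X Y"])
  have "(swap X Z Y \<cdot> (Id C X \<odot> Sym C Y Z) \<cdot> Assoc C X Y Z) \<cdot> (Sym C Z (X \<otimes> Y) \<cdot> Assoc C Z X Y) =
    swap X Z Y \<cdot> (Id C X \<odot> Sym C Y Z) \<cdot> (Assoc C X Y Z \<cdot> Sym C Z (X \<otimes> Y) \<cdot> Assoc C Z X Y)"
    by simp
  also have "\<dots> = (swap X Z Y \<cdot> Assoc C X Z Y) \<cdot> (Sym C Z X \<odot> Id C Y)"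
    by (subst hexagon) auto
  also have "\<dots> = Assoc C Z X Y"
    by (subst swap_Assoc) auto
  finally show "Sym C (X \<otimes> Y) Z \<cdot> (Sym C Z (X \<otimes> Y) \<cdot> Assoc C Z X Y) =
    (swap X Z Y \<cdot> (Id C X \<odot> Sym C Y Z) \<cdot> Assoc C X Y Z) \<cdot> (Sym C Z (X \<otimes> Y) \<cdot> Assoc C Z X Y)"
    by simp
qed auto

section \<open>Products of lists of variables and their permutations\<close>

text \<open>The product is nested to the right and ends in the unit, so even a single variable
  contributes a factor \<open>Unit C\<close>.\<close>

primrec list_tens :: "(nat \<times> 'o) list \<Rightarrow> 'o" where
  "list_tens [] = Unit C"
| "list_tens (x # xs) = snd x \<otimes> list_tens xs"

definition obj_list :: "(nat \<times> 'o) list \<Rightarrow> bool" where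
  "obj_list xs \<longleftrightarrow> snd ` set xs \<subseteq> Obj C"

lemma obj_list_simps [simp]:
  "obj_list []" "obj_list (x # xs) \<longleftrightarrow> snd x \<in> Obj C \<and> obj_list xs" "obj_list (xs @ ys) \<longleftrightarrow> obj_list xs \<and> obj_list ys"
  "obj_list (sort_key k xs) \<longleftrightarrow> obj_list xs" "obj_list (insort_key k x xs) \<longleftrightarrow> snd x \<in> Obj C \<and> obj_list xs"
  by (auto simp: obj_list_def set_insort_key)

lemma list_tens_Obj [simp]: "obj_list xs \<Longrightarrow> list_tens xs \<in> Obj C"
  by (induction xs) auto

text \<open>The canonical rebracketing isomorphism that joins two blocks. No factors change their
  order.\<close>

primrec merge :: "(nat \<times> 'o) list \<Rightarrow> (nat \<times> 'o) list \<Rightarrow> 'm" where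
  "merge [] ys = LUnit C (list_tens ys)"
| "merge (x # xs) ys = (Id C (snd x) \<odot> merge xs ys) \<cdot> Assoc C (snd x) (list_tens xs) (list_tens ys)"

lemma merge_arr [simp]:
  assumes "obj_list xs" "obj_list ys"
  shows "merge xs ys \<in> Arr C" "Dom C (merge xs ys) = list_tens xs \<otimes> list_tens ys" "Cod C (merge xs ys) = list_tens (xs @ ys)"
    "is_iso C (merge xs ys)"
proof -
  have "merge xs ys \<in> Arr C \<and> Dom C (merge xs ys) = list_tens xs \<otimes> list_tens ys \<and> Cod C (merge xs ys) = list_tens (xs @ ys) \<and>
    is_iso C (merge xs ys)"
    using assms by (induction xs) auto
  then show "merge xs ys \<in> Arr C" "Dom C (merge xs ys) = list_tens xs \<otimes> list_tens ys" "Cod C (merge xs ys) = list_tens (xs @ ys)"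
    "is_iso C (merge xs ys)" by auto
qed

text \<open>Joining three blocks does not depend on the bracketing; the induction step is the
  pentagon. This is the content of \<open>app_Assoc\<close>.\<close>

lemma merge_assoc:
  assumes [simp]: "obj_list ys" "obj_list zs"
  shows "obj_list xs \<Longrightarrow> merge (xs @ ys) zs \<cdot> (merge xs ys \<odot> Id C (list_tens zs)) =
    merge xs (ys @ zs) \<cdot> (Id C (list_tens xs) \<odot> merge ys zs) \<cdot> Assoc C (list_tens xs) (list_tens ys) (list_tens zs)"
proof (induction xs)
  case Nil
  have "merge ys zs \<cdot> (LUnit C (list_tens ys) \<odot> Id C (list_tens zs)) =
    (merge ys zs \<cdot> LUnit C (list_tens ys \<otimes> list_tens zs)) \<cdot> Assoc C (Unit C) (list_tens ys) (list_tens zs)"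
    by (simp add: LUnit_tens)
  also have "\<dots> = (LUnit C (list_tens (ys @ zs)) \<cdot> (Id C (Unit C) \<odot> merge ys zs)) \<cdot> Assoc C (Unit C) (list_tens ys) (list_tens zs)"
    by (subst LUnit_natural) auto
  finally show ?case by simp
next
  case (Cons x xs)
  then have [simp]: "obj_list xs" "snd x \<in> Obj C" by auto
  have "merge ((x # xs) @ ys) zs \<cdot> (merge (x # xs) ys \<odot> Id C (list_tens zs)) =
    (Id C (snd x) \<odot> merge (xs @ ys) zs) \<cdot>
     (Assoc C (snd x) (list_tens (xs @ ys)) (list_tens zs) \<cdot> ((Id C (snd x) \<odot> merge xs ys) \<odot> Id C (list_tens zs))) \<cdot>
     (Assoc C (snd x) (list_tens xs) (list_tens ys) \<odot> Id C (list_tens zs))"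
    by simp
  also have "\<dots> = (Id C (snd x) \<odot> merge (xs @ ys) zs) \<cdot>
     ((Id C (snd x) \<odot> (merge xs ys \<odot> Id C (list_tens zs))) \<cdot> Assoc C (snd x) (list_tens xs \<otimes> list_tens ys) (list_tens zs)) \<cdot>
     (Assoc C (snd x) (list_tens xs) (list_tens ys) \<odot> Id C (list_tens zs))"
    by (subst Assoc_natural) auto
  also have "\<dots> = (Id C (snd x) \<odot> (merge (xs @ ys) zs \<cdot> (merge xs ys \<odot> Id C (list_tens zs)))) \<cdot>
     Assoc C (snd x) (list_tens xs \<otimes> list_tens ys) (list_tens zs) \<cdot> (Assoc C (snd x) (list_tens xs) (list_tens ys) \<odot> Id C (list_tens zs))"
    by simp
  also have "\<dots> = (Id C (snd x) \<odot> (merge xs (ys @ zs) \<cdot> (Id C (list_tens xs) \<odot> merge ys zs))) \<cdot>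
     ((Id C (snd x) \<odot> Assoc C (list_tens xs) (list_tens ys) (list_tens zs)) \<cdot>
     Assoc C (snd x) (list_tens xs \<otimes> list_tens ys) (list_tens zs) \<cdot> (Assoc C (snd x) (list_tens xs) (list_tens ys) \<odot> Id C (list_tens zs)))"
    by (subst Cons.IH) auto
  also have "\<dots> = (Id C (snd x) \<odot> (merge xs (ys @ zs) \<cdot> (Id C (list_tens xs) \<odot> merge ys zs))) \<cdot>
     (Assoc C (snd x) (list_tens xs) (list_tens ys \<otimes> list_tens zs) \<cdot> Assoc C (snd x \<otimes> list_tens xs) (list_tens ys) (list_tens zs))"
    by (subst pentagon) auto
  also have "\<dots> = (Id C (snd x) \<odot> merge xs (ys @ zs)) \<cdot>
     ((Id C (snd x) \<odot> (Id C (list_tens xs) \<odot> merge ys zs)) \<cdot> Assoc C (snd x) (list_tens xs) (list_tens ys \<otimes> list_tens zs)) \<cdot> Assoc C (snd x \<otimes> list_tens xs) (list_tens ys) (list_tens zs)"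
    by simp
  also have "\<dots> = (Id C (snd x) \<odot> merge xs (ys @ zs)) \<cdot>
     (Assoc C (snd x) (list_tens xs) (list_tens (ys @ zs)) \<cdot> ((Id C (snd x) \<odot> Id C (list_tens xs)) \<odot> merge ys zs)) \<cdot> Assoc C (snd x \<otimes> list_tens xs) (list_tens ys) (list_tens zs)"
    by (subst Assoc_natural) auto
  finally show ?case by simp
qed

lemma merge_Nil: "obj_list xs \<Longrightarrow> merge xs [] = RUnit C (list_tens xs)"
  by (induction xs) (auto simp: LUnit_Unit RUnit_tens)

text \<open>The arrow is an index of the relation and not a function of the lists, because different
  words in transpositions may join the same two lists. That they give the same arrow, for distinct
  labels, is the coherence statement.\<close>

inductive perm :: "(nat \<times> 'o) list \<Rightarrow> (nat \<times> 'o) list \<Rightarrow> 'm \<Rightarrow> bool" where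
  perm_Id: "obj_list xs \<Longrightarrow> perm xs xs (Id C (list_tens xs))"
| perm_swap: "obj_list (x # y # zs) \<Longrightarrow> perm (x # y # zs) (y # x # zs) (swap (snd x) (snd y) (list_tens zs))"
| perm_cons: "\<lbrakk>perm xs ys p; snd x \<in> Obj C\<rbrakk> \<Longrightarrow> perm (x # xs) (x # ys) (Id C (snd x) \<odot> p)"
| perm_comp: "\<lbrakk>perm xs ys p; perm ys zs q\<rbrakk> \<Longrightarrow> perm xs zs (q \<cdot> p)"

lemma perm_arr:
  "perm xs ys p \<Longrightarrow> obj_list xs \<and> obj_list ys \<and> p \<in> Arr C \<and> Dom C p = list_tens xs \<and> Cod C p = list_tens ys \<and> is_iso C p"
  by (induction rule: perm.induct) auto

text \<open>A permutation of the left block becomes a permutation of the joined list, by induction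
  on the word; the generator is treated by \<open>swap_tens\<close> and naturality of
  \<open>swap\<close>.\<close>

lemma perm_merge_left:
  assumes "perm xs xs' p" and [simp]: "obj_list ys"
  shows "\<exists>P. perm (xs @ ys) (xs' @ ys) P \<and> P \<cdot> merge xs ys = merge xs' ys \<cdot> (p \<odot> Id C (list_tens ys))"
  using assms(1)
proof (induction rule: perm.induct)
  case (perm_Id xs)
  then show ?case by (intro exI[of _ "Id C (list_tens (xs @ ys))"]) (auto intro: perm.perm_Id)
next
  case (perm_swap x y zs)
  then have [simp]: "snd x \<in> Obj C" "snd y \<in> Obj C" "obj_list zs" by auto
  let ?X = "snd x" and ?Y = "snd y" and ?Z = "list_tens zs" and ?W = "list_tens ys"
  have "merge (y # x # zs) ys \<cdot> (swap ?X ?Y ?Z \<odot> Id C ?W) =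
    (Id C ?Y \<odot> (Id C ?X \<odot> merge zs ys)) \<cdot>
      ((Id C ?Y \<odot> Assoc C ?X ?Z ?W) \<cdot> Assoc C ?Y (?X \<otimes> ?Z) ?W \<cdot> (swap ?X ?Y ?Z \<odot> Id C ?W))"
    by simp
  also have "\<dots> = ((Id C ?Y \<odot> (Id C ?X \<odot> merge zs ys)) \<cdot> swap ?X ?Y (?Z \<otimes> ?W)) \<cdot> (Id C ?X \<odot> Assoc C ?Y ?Z ?W) \<cdot> Assoc C ?X (?Y \<otimes> ?Z) ?W"
    by (subst swap_tens) auto
  also have "\<dots> = (swap ?X ?Y (list_tens (zs @ ys)) \<cdot> (Id C ?X \<odot> (Id C ?Y \<odot> merge zs ys))) \<cdot> (Id C ?X \<odot> Assoc C ?Y ?Z ?W) \<cdot> Assoc C ?X (?Y \<otimes> ?Z) ?W"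
    by (subst swap_natural) auto
  also have "\<dots> = swap ?X ?Y (list_tens (zs @ ys)) \<cdot> merge (x # y # zs) ys"
    by simp
  finally show ?case
    by (intro exI[of _ "swap ?X ?Y (list_tens (zs @ ys))"]) (auto intro: perm.perm_swap)
next
  case (perm_cons xs xs' p x)
  then obtain P where P: "perm (xs @ ys) (xs' @ ys) P" "P \<cdot> merge xs ys = merge xs' ys \<cdot> (p \<odot> Id C (list_tens ys))" by blast
  have [simp]: "obj_list xs" "obj_list xs'" "p \<in> Arr C" "Dom C p = list_tens xs" "Cod C p = list_tens xs'"
    "P \<in> Arr C" "Dom C P = list_tens (xs @ ys)" "Cod C P = list_tens (xs' @ ys)" "snd x \<in> Obj C"
    using perm_arr[OF perm_cons.hyps(1)] perm_arr[OF P(1)] perm_cons.hyps(2) by auto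
  have "merge (x # xs') ys \<cdot> ((Id C (snd x) \<odot> p) \<odot> Id C (list_tens ys)) =
    (Id C (snd x) \<odot> merge xs' ys) \<cdot> (Assoc C (snd x) (list_tens xs') (list_tens ys) \<cdot> ((Id C (snd x) \<odot> p) \<odot> Id C (list_tens ys)))"
    by simp
  also have "\<dots> = (Id C (snd x) \<odot> (merge xs' ys \<cdot> (p \<odot> Id C (list_tens ys)))) \<cdot> Assoc C (snd x) (list_tens xs) (list_tens ys)"
    by (subst Assoc_natural) auto
  also have "\<dots> = (Id C (snd x) \<odot> P) \<cdot> merge (x # xs) ys"
    by (simp flip: P(2))
  finally show ?case
    using perm.perm_cons[OF P(1) perm_cons.hyps(2)] by (intro exI[of _ "Id C (snd x) \<odot> P"]) auto
next
  case (perm_comp xs xs' p xs'' q)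
  then obtain P Q where P: "perm (xs @ ys) (xs' @ ys) P" "P \<cdot> merge xs ys = merge xs' ys \<cdot> (p \<odot> Id C (list_tens ys))"
    and Q: "perm (xs' @ ys) (xs'' @ ys) Q" "Q \<cdot> merge xs' ys = merge xs'' ys \<cdot> (q \<odot> Id C (list_tens ys))" by blast
  have [simp]: "obj_list xs" "obj_list xs'" "obj_list xs''" "p \<in> Arr C" "Dom C p = list_tens xs" "Cod C p = list_tens xs'"
    "q \<in> Arr C" "Dom C q = list_tens xs'" "Cod C q = list_tens xs''"
    "P \<in> Arr C" "Dom C P = list_tens (xs @ ys)" "Cod C P = list_tens (xs' @ ys)"
    "Q \<in> Arr C" "Dom C Q = list_tens (xs' @ ys)" "Cod C Q = list_tens (xs'' @ ys)"
    using perm_arr[OF perm_comp.hyps(1)] perm_arr[OF perm_comp.hyps(2)] perm_arr[OF P(1)] perm_arr[OF Q(1)] by auto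
  have "(Q \<cdot> P) \<cdot> merge xs ys = (Q \<cdot> merge xs' ys) \<cdot> (p \<odot> Id C (list_tens ys))"
    by (simp add: P(2))
  also have "\<dots> = merge xs'' ys \<cdot> ((q \<cdot> p) \<odot> Id C (list_tens ys))"
    by (simp add: Q(2))
  finally show ?case using perm.perm_comp[OF P(1) Q(1)] by blast
qed

lemma perm_merge_right:
  assumes "perm ys ys' p" "obj_list xs"
  shows "\<exists>P. perm (xs @ ys) (xs @ ys') P \<and> P \<cdot> merge xs ys = merge xs ys' \<cdot> (Id C (list_tens xs) \<odot> p)"
  using assms(2)
proof (induction xs)
  case Nil
  then show ?case using assms(1) perm_arr[OF assms(1)] LUnit_natural[of p "list_tens ys'"] by (intro exI[of _ p]) auto
next
  case (Cons x xs)
  then obtain P where P: "perm (xs @ ys) (xs @ ys') P" "P \<cdot> merge xs ys = merge xs ys' \<cdot> (Id C (list_tens xs) \<odot> p)" by auto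
  have [simp]: "obj_list xs" "snd x \<in> Obj C" "obj_list ys" "obj_list ys'" "p \<in> Arr C" "Dom C p = list_tens ys" "Cod C p = list_tens ys'"
    "P \<in> Arr C" "Dom C P = list_tens (xs @ ys)" "Cod C P = list_tens (xs @ ys')"
    using Cons.prems perm_arr[OF assms(1)] perm_arr[OF P(1)] by auto
  have "merge (x # xs) ys' \<cdot> (Id C (list_tens (x # xs)) \<odot> p) =
    (Id C (snd x) \<odot> merge xs ys') \<cdot> (Assoc C (snd x) (list_tens xs) (list_tens ys') \<cdot> ((Id C (snd x) \<odot> Id C (list_tens xs)) \<odot> p))"
    by simp
  also have "\<dots> = (Id C (snd x) \<odot> (merge xs ys' \<cdot> (Id C (list_tens xs) \<odot> p))) \<cdot> Assoc C (snd x) (list_tens xs) (list_tens ys)"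
    by (subst Assoc_natural) auto
  also have "\<dots> = (Id C (snd x) \<odot> P) \<cdot> merge (x # xs) ys"
    by (simp flip: P(2))
  finally show ?case
    using perm.perm_cons[OF P(1), of x] by (intro exI[of _ "Id C (snd x) \<odot> P"]) auto
qed

lemma perm_merge:
  assumes p: "perm xs xs' p" and q: "perm ys ys' q"
  shows "\<exists>P. perm (xs @ ys) (xs' @ ys') P \<and> P \<cdot> merge xs ys = merge xs' ys' \<cdot> (p \<odot> q)"
proof -
  have [simp]: "obj_list xs" "obj_list xs'" "obj_list ys" "obj_list ys'" "p \<in> Arr C" "Dom C p = list_tens xs" "Cod C p = list_tens xs'"
    "q \<in> Arr C" "Dom C q = list_tens ys" "Cod C q = list_tens ys'"
    using perm_arr[OF p] perm_arr[OF q] by auto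
  obtain P where P: "perm (xs @ ys) (xs' @ ys) P" "P \<cdot> merge xs ys = merge xs' ys \<cdot> (p \<odot> Id C (list_tens ys))"
    using perm_merge_left[OF p, of ys] by auto
  obtain Q where Q: "perm (xs' @ ys) (xs' @ ys') Q" "Q \<cdot> merge xs' ys = merge xs' ys' \<cdot> (Id C (list_tens xs') \<odot> q)"
    using perm_merge_right[OF q, of xs'] by auto
  have [simp]: "P \<in> Arr C" "Dom C P = list_tens (xs @ ys)" "Cod C P = list_tens (xs' @ ys)"
    "Q \<in> Arr C" "Dom C Q = list_tens (xs' @ ys)" "Cod C Q = list_tens (xs' @ ys')"
    using perm_arr[OF P(1)] perm_arr[OF Q(1)] by auto
  have "(Q \<cdot> P) \<cdot> merge xs ys = (Q \<cdot> merge xs' ys) \<cdot> (p \<odot> Id C (list_tens ys))"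
    by (simp add: P(2))
  also have "\<dots> = merge xs' ys' \<cdot> (p \<odot> q)"
    by (simp add: Q(2))
  finally show ?thesis using perm.perm_comp[OF P(1) Q(1)] by blast
qed

text \<open>Relates the single transposition of x with the whole block \<open>ys\<close> to a word
  of transpositions with its entries, one entry at a time by \<open>swap_hexagon\<close>.\<close>

lemma perm_move:
  assumes [simp]: "snd x \<in> Obj C" "obj_list zs" and "obj_list ys"
  shows "\<exists>P. perm (x # ys @ zs) (ys @ x # zs) P \<and>
    P \<cdot> (Id C (snd x) \<odot> merge ys zs) = merge ys (x # zs) \<cdot> swap (snd x) (list_tens ys) (list_tens zs)"
  using assms(3)
proof (induction ys)
  case Nil
  then show ?case
    using perm_Id[of "x # zs"] by (intro exI[of _ "Id C (list_tens (x # zs))"]) (auto simp: swap_Unit)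
next
  case (Cons y ys)
  then obtain P where P: "perm (x # ys @ zs) (ys @ x # zs) P"
    "P \<cdot> (Id C (snd x) \<odot> merge ys zs) = merge ys (x # zs) \<cdot> swap (snd x) (list_tens ys) (list_tens zs)" by auto
  let ?X = "snd x" and ?Y = "snd y" and ?L = "list_tens ys" and ?Z = "list_tens zs"
  have [simp]: "obj_list ys" "?Y \<in> Obj C" "P \<in> Arr C" "Dom C P = ?X \<otimes> list_tens (ys @ zs)" "Cod C P = list_tens (ys @ x # zs)"
    using Cons.prems perm_arr[OF P(1)] by auto
  have "merge (y # ys) (x # zs) \<cdot> swap ?X (?Y \<otimes> ?L) ?Z =
    (Id C ?Y \<odot> merge ys (x # zs)) \<cdot> (Assoc C ?Y ?L (?X \<otimes> ?Z) \<cdot> swap ?X (?Y \<otimes> ?L) ?Z)"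
    by simp
  also have "\<dots> = (Id C ?Y \<odot> merge ys (x # zs)) \<cdot> ((Id C ?Y \<odot> swap ?X ?L ?Z) \<cdot> swap ?X ?Y (?L \<otimes> ?Z) \<cdot> (Id C ?X \<odot> Assoc C ?Y ?L ?Z))"
    by (subst swap_hexagon) auto
  also have "\<dots> = (Id C ?Y \<odot> (merge ys (x # zs) \<cdot> swap ?X ?L ?Z)) \<cdot> swap ?X ?Y (?L \<otimes> ?Z) \<cdot> (Id C ?X \<odot> Assoc C ?Y ?L ?Z)"
    by simp
  also have "\<dots> = (Id C ?Y \<odot> P) \<cdot> ((Id C ?Y \<odot> (Id C ?X \<odot> merge ys zs)) \<cdot> swap ?X ?Y (?L \<otimes> ?Z)) \<cdot> (Id C ?X \<odot> Assoc C ?Y ?L ?Z)"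
    by (simp flip: P(2))
  also have "\<dots> = (Id C ?Y \<odot> P) \<cdot> (swap ?X ?Y (list_tens (ys @ zs)) \<cdot> (Id C ?X \<odot> (Id C ?Y \<odot> merge ys zs))) \<cdot> (Id C ?X \<odot> Assoc C ?Y ?L ?Z)"
    by (subst swap_natural) auto
  also have "\<dots> = ((Id C ?Y \<odot> P) \<cdot> swap ?X ?Y (list_tens (ys @ zs))) \<cdot> (Id C ?X \<odot> merge (y # ys) zs)"
    by simp
  finally have "((Id C ?Y \<odot> P) \<cdot> swap ?X ?Y (list_tens (ys @ zs))) \<cdot> (Id C ?X \<odot> merge (y # ys) zs) =
    merge (y # ys) (x # zs) \<cdot> swap ?X (list_tens (y # ys)) ?Z" by simp
  moreover have "perm (x # y # ys @ zs) (y # ys @ x # zs) ((Id C ?Y \<odot> P) \<cdot> swap ?X ?Y (list_tens (ys @ zs)))"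
    by (rule perm_comp[OF perm_swap perm_cons[OF P(1)]]) auto
  ultimately show ?case by auto
qed

text \<open>The symmetry of two blocks decomposes into adjacent transpositions: first the tail of
  \<open>xs\<close> passes \<open>ys\<close>, then the head does, as in
  \<open>Sym_tens\<close>.\<close>

lemma perm_Sym:
  assumes "obj_list xs" and [simp]: "obj_list ys"
  shows "\<exists>P. perm (xs @ ys) (ys @ xs) P \<and> P \<cdot> merge xs ys = merge ys xs \<cdot> Sym C (list_tens xs) (list_tens ys)"
  using assms(1)
proof (induction xs)
  case Nil
  have "RUnit C (list_tens ys) \<cdot> Sym C (Unit C) (list_tens ys) = LUnit C (list_tens ys)"
    by (simp flip: LUnit_Sym)
  then show ?case
    using perm_Id[of ys] by (intro exI[of _ "Id C (list_tens ys)"]) (auto simp: merge_Nil)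
next
  case (Cons x xs)
  then obtain P where P: "perm (xs @ ys) (ys @ xs) P" "P \<cdot> merge xs ys = merge ys xs \<cdot> Sym C (list_tens xs) (list_tens ys)" by auto
  have [simp]: "snd x \<in> Obj C" "obj_list xs" using Cons.prems by auto
  obtain Q where Q: "perm (x # ys @ xs) (ys @ x # xs) Q"
    "Q \<cdot> (Id C (snd x) \<odot> merge ys xs) = merge ys (x # xs) \<cdot> swap (snd x) (list_tens ys) (list_tens xs)"
    using perm_move[of x xs ys] by auto
  have [simp]: "P \<in> Arr C" "Dom C P = list_tens (xs @ ys)" "Cod C P = list_tens (ys @ xs)"
    "Q \<in> Arr C" "Dom C Q = snd x \<otimes> list_tens (ys @ xs)" "Cod C Q = list_tens (ys @ x # xs)"
    using perm_arr[OF P(1)] perm_arr[OF Q(1)] by auto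
  have "merge ys (x # xs) \<cdot> Sym C (list_tens (x # xs)) (list_tens ys) =
    (merge ys (x # xs) \<cdot> swap (snd x) (list_tens ys) (list_tens xs)) \<cdot> (Id C (snd x) \<odot> Sym C (list_tens xs) (list_tens ys)) \<cdot> Assoc C (snd x) (list_tens xs) (list_tens ys)"
    by (simp add: Sym_tens)
  also have "\<dots> = Q \<cdot> (Id C (snd x) \<odot> (merge ys xs \<cdot> Sym C (list_tens xs) (list_tens ys))) \<cdot> Assoc C (snd x) (list_tens xs) (list_tens ys)"
    by (simp flip: Q(2))
  also have "\<dots> = (Q \<cdot> (Id C (snd x) \<odot> P)) \<cdot> merge (x # xs) ys"
    by (simp flip: P(2))
  finally have "(Q \<cdot> (Id C (snd x) \<odot> P)) \<cdot> merge (x # xs) ys = merge ys (x # xs) \<cdot> Sym C (list_tens (x # xs)) (list_tens ys)" ..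
  moreover have "perm (x # xs @ ys) (ys @ x # xs) (Q \<cdot> (Id C (snd x) \<odot> P))"
    by (rule perm_comp[OF perm_cons[OF P(1)] Q(1)]) auto
  ultimately show ?case by auto
qed

section \<open>Insertion sort as a normal form for permutations\<close>

text \<open>Follows the recursion of \<open>insort_key fst\<close>, recording each exchange as a
  \<open>swap\<close>; likewise \<open>sorter\<close> follows \<open>sort_key fst\<close>.\<close>

primrec inserter :: "nat \<times> 'o \<Rightarrow> (nat \<times> 'o) list \<Rightarrow> 'm" where
  "inserter x [] = Id C (list_tens [x])"
| "inserter x (y # ys) = (if fst x \<le> fst y then Id C (list_tens (x # y # ys))
     else (Id C (snd y) \<odot> inserter x ys) \<cdot> swap (snd x) (snd y) (list_tens ys))"

primrec sorter :: "(nat \<times> 'o) list \<Rightarrow> 'm" where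
  "sorter [] = Id C (Unit C)"
| "sorter (x # xs) = inserter x (sort_key fst xs) \<cdot> (Id C (snd x) \<odot> sorter xs)"

lemma perm_ins: "obj_list (x # ys) \<Longrightarrow> perm (x # ys) (insort_key fst x ys) (inserter x ys)"
proof (induction ys)
  case (Cons y ys)
  then have "perm (x # y # ys) (y # insort_key fst x ys) ((Id C (snd y) \<odot> inserter x ys) \<cdot> swap (snd x) (snd y) (list_tens ys))"
    by (intro perm_comp[OF perm_swap perm_cons]) auto
  then show ?case using Cons.prems perm_Id[of "x # y # ys"] by auto
qed (use perm_Id[of "[x]"] in auto)

lemma perm_nm: "obj_list xs \<Longrightarrow> perm xs (sort_key fst xs) (sorter xs)"
proof (induction xs)
  case (Cons x xs)
  then show ?case using perm_comp[OF perm_cons perm_ins[of x "sort_key fst xs"], of xs "sorter xs"] by auto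
qed (use perm_Id[of "[]"] in auto)

lemma inserter_arr [simp]:
  assumes "snd x \<in> Obj C" "obj_list ys"
  shows "inserter x ys \<in> Arr C" "Dom C (inserter x ys) = snd x \<otimes> list_tens ys" "Cod C (inserter x ys) = list_tens (insort_key fst x ys)"
  using perm_arr[OF perm_ins[of x ys]] assms by auto

lemma sorter_arr [simp]:
  assumes "obj_list xs"
  shows "sorter xs \<in> Arr C" "Dom C (sorter xs) = list_tens xs" "Cod C (sorter xs) = list_tens (sort_key fst xs)" "is_iso C (sorter xs)"
  using perm_arr[OF perm_nm[of xs]] assms by auto

text \<open>Two insertions commute up to the exchange of the inserted entries. When both entries
  pass the head z, the two ways of passing it are related by \<open>yang_baxter\<close>.\<close>

lemma inserter_swap_less:
  assumes less: "fst x < fst y" and [simp]: "snd x \<in> Obj C" "snd y \<in> Obj C" and "obj_list zs"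
  shows "inserter y (insort_key fst x zs) \<cdot> (Id C (snd y) \<odot> inserter x zs) \<cdot> swap (snd x) (snd y) (list_tens zs) =
    inserter x (insort_key fst y zs) \<cdot> (Id C (snd x) \<odot> inserter y zs)"
  using assms(4)
proof (induction zs)
  case Nil
  then show ?case using less by simp
next
  case (Cons z zs)
  let ?X = "snd x" and ?Y = "snd y" and ?Z = "snd z" and ?W = "list_tens zs"
  have [simp]: "?Z \<in> Obj C" "obj_list zs" using Cons.prems by auto
  show ?case
  proof (cases "fst x \<le> fst z")
    \<comment> \<open>Here x stays in front, so inserting y begins by exchanging it with x, and this
      cancels the given \<open>swap\<close>.\<close>
    case True
    then show ?thesis using less by auto
  next
    case False
    have "inserter y (insort_key fst x (z # zs)) \<cdot> (Id C ?Y \<odot> inserter x (z # zs)) \<cdot> swap ?X ?Y (list_tens (z # zs)) =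
      (Id C ?Z \<odot> inserter y (insort_key fst x zs)) \<cdot>
        (swap ?Y ?Z (list_tens (insort_key fst x zs)) \<cdot> (Id C ?Y \<odot> (Id C ?Z \<odot> inserter x zs))) \<cdot>
        (Id C ?Y \<odot> swap ?X ?Z ?W) \<cdot> swap ?X ?Y (?Z \<otimes> ?W)"
      using False less by simp
    also have "\<dots> = (Id C ?Z \<odot> inserter y (insort_key fst x zs)) \<cdot>
        ((Id C ?Z \<odot> (Id C ?Y \<odot> inserter x zs)) \<cdot> swap ?Y ?Z (?X \<otimes> ?W)) \<cdot>
        (Id C ?Y \<odot> swap ?X ?Z ?W) \<cdot> swap ?X ?Y (?Z \<otimes> ?W)"
      by (subst swap_natural) auto
    also have "\<dots> = (Id C ?Z \<odot> (inserter y (insort_key fst x zs) \<cdot> (Id C ?Y \<odot> inserter x zs))) \<cdot>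
        (swap ?Y ?Z (?X \<otimes> ?W) \<cdot> (Id C ?Y \<odot> swap ?X ?Z ?W) \<cdot> swap ?X ?Y (?Z \<otimes> ?W))"
      by simp
    also have "\<dots> = (Id C ?Z \<odot> (inserter y (insort_key fst x zs) \<cdot> (Id C ?Y \<odot> inserter x zs) \<cdot> swap ?X ?Y ?W)) \<cdot>
        swap ?X ?Z (?Y \<otimes> ?W) \<cdot> (Id C ?X \<odot> swap ?Y ?Z ?W)"
      by (subst yang_baxter) auto
    also have "\<dots> = (Id C ?Z \<odot> (inserter x (insort_key fst y zs) \<cdot> (Id C ?X \<odot> inserter y zs))) \<cdot>
        swap ?X ?Z (?Y \<otimes> ?W) \<cdot> (Id C ?X \<odot> swap ?Y ?Z ?W)"
      by (subst Cons.IH) auto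
    also have "\<dots> = (Id C ?Z \<odot> inserter x (insort_key fst y zs)) \<cdot>
        ((Id C ?Z \<odot> (Id C ?X \<odot> inserter y zs)) \<cdot> swap ?X ?Z (?Y \<otimes> ?W)) \<cdot> (Id C ?X \<odot> swap ?Y ?Z ?W)"
      by simp
    also have "\<dots> = (Id C ?Z \<odot> inserter x (insort_key fst y zs)) \<cdot>
        (swap ?X ?Z (list_tens (insort_key fst y zs)) \<cdot> (Id C ?X \<odot> (Id C ?Z \<odot> inserter y zs))) \<cdot> (Id C ?X \<odot> swap ?Y ?Z ?W)"
      by (subst swap_natural) auto
    also have "\<dots> = inserter x (insort_key fst y (z # zs)) \<cdot> (Id C ?X \<odot> inserter y (z # zs))"
      using False less by simp
    finally show ?thesis .
  qed
qed

text \<open>The other order of labels is the previous lemma with x and y interchanged, since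
  \<open>swap\<close> is its own inverse.\<close>

lemma inserter_swap:
  assumes "fst x \<noteq> fst y" and [simp]: "snd x \<in> Obj C" "snd y \<in> Obj C" "obj_list zs"
  shows "inserter y (insort_key fst x zs) \<cdot> (Id C (snd y) \<odot> inserter x zs) \<cdot> swap (snd x) (snd y) (list_tens zs) =
    inserter x (insort_key fst y zs) \<cdot> (Id C (snd x) \<odot> inserter y zs)"
proof (cases "fst x < fst y")
  case False
  then have "fst y < fst x" using assms(1) by simp
  then have "(inserter y (insort_key fst x zs) \<cdot> (Id C (snd y) \<odot> inserter x zs)) \<cdot> swap (snd x) (snd y) (list_tens zs) =
    (inserter x (insort_key fst y zs) \<cdot> (Id C (snd x) \<odot> inserter y zs) \<cdot> swap (snd y) (snd x) (list_tens zs)) \<cdot> swap (snd x) (snd y) (list_tens zs)"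
    by (subst inserter_swap_less) auto
  then show ?thesis by (simp add: insort_key_left_comm assms(1))
qed (use assms inserter_swap_less in auto)

text \<open>\<open>sort_key\<close> is stable, so equal labels would keep the order of the input;
  distinct labels make the sorted list independent of it.\<close>

lemma sort_perm:
  assumes "perm xs ys p" "distinct (map fst xs)"
  shows "sort_key fst xs = sort_key fst ys" "distinct (map fst ys)"
proof -
  have "set xs = set ys \<and> distinct (map fst ys) \<and> sort_key fst xs = sort_key fst ys"
    using assms by (induction rule: perm.induct) (auto simp: insort_key_left_comm)
  then show "sort_key fst xs = sort_key fst ys" "distinct (map fst ys)" by auto
qed

text \<open>Coherence: on lists with distinct labels, an arrow built from adjacent transpositions is
  determined by its source and target.\<close>

lemma sorter_perm:
  "perm xs ys p \<Longrightarrow> distinct (map fst xs) \<Longrightarrow> sorter ys \<cdot> p = sorter xs"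
proof (induction rule: perm.induct)
  case (perm_Id xs)
  then show ?case by simp
next
  case (perm_swap x y zs)
  then have [simp]: "snd x \<in> Obj C" "snd y \<in> Obj C" "obj_list zs" and ne: "fst x \<noteq> fst y" by auto
  let ?X = "snd x" and ?Y = "snd y" and ?s = "sort_key fst zs"
  have "sorter (y # x # zs) \<cdot> swap ?X ?Y (list_tens zs) =
    inserter y (insort_key fst x ?s) \<cdot> (Id C ?Y \<odot> inserter x ?s) \<cdot> ((Id C ?Y \<odot> (Id C ?X \<odot> sorter zs)) \<cdot> swap ?X ?Y (list_tens zs))"
    by simp
  also have "\<dots> = inserter y (insort_key fst x ?s) \<cdot> (Id C ?Y \<odot> inserter x ?s) \<cdot> (swap ?X ?Y (list_tens ?s) \<cdot> (Id C ?X \<odot> (Id C ?Y \<odot> sorter zs)))"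
    by (subst swap_natural) auto
  also have "\<dots> = (inserter y (insort_key fst x ?s) \<cdot> (Id C ?Y \<odot> inserter x ?s) \<cdot> swap ?X ?Y (list_tens ?s)) \<cdot> (Id C ?X \<odot> (Id C ?Y \<odot> sorter zs))"
    by (simp add: insort_key_left_comm ne)
  also have "\<dots> = sorter (x # y # zs)"
    by (subst inserter_swap[OF ne]) auto
  finally show ?case .
next
  case (perm_cons xs ys p x)
  note a = perm_arr[OF perm_cons.hyps(1)]
  have "sort_key fst xs = sort_key fst ys"
    by (rule sort_perm[OF perm_cons.hyps(1)]) (use perm_cons.prems in auto)
  then have "sorter (x # ys) \<cdot> (Id C (snd x) \<odot> p) = inserter x (sort_key fst xs) \<cdot> (Id C (snd x) \<odot> (sorter ys \<cdot> p))"
    using a perm_cons.hyps(2) by simp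
  then show ?case using perm_cons by simp
next
  case (perm_comp xs ys p zs q)
  note a = perm_arr[OF perm_comp.hyps(1)] perm_arr[OF perm_comp.hyps(2)]
  have "distinct (map fst ys)" using sort_perm[OF perm_comp.hyps(1)] perm_comp.prems by auto
  then have "(sorter zs \<cdot> q) \<cdot> p = sorter xs" using perm_comp by simp
  then show ?case using a by simp
qed

lemma sort_key_sorted: "sorted (map f xs) \<Longrightarrow> sort_key f xs = xs"
  by (induction xs) (auto simp: insort_is_Cons)

lemma sorter_sorted: "\<lbrakk>obj_list xs; sorted (map fst xs)\<rbrakk> \<Longrightarrow> sorter xs = Id C (list_tens xs)"
proof (induction xs)
  case (Cons x xs)
  have "sort_key fst xs = xs" using Cons.prems by (intro sort_key_sorted) auto
  then show ?case using Cons by (cases xs) auto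
qed simp

section \<open>Linear elements\<close>

text \<open>A triple \<open>(xs, X, e)\<close> is the arrow \<open>e\<close> from the tensor product of the variables \<open>xs\<close> to \<open>X\<close>.
  The variables have distinct labels, and in an element they are sorted by label, so that equal
  elements are equal triples.\<close>

definition raw :: "(nat \<times> 'o) list \<times> 'o \<times> 'm \<Rightarrow> bool" where
  "raw a \<longleftrightarrow> (case a of (xs, X, e) \<Rightarrow> obj_list xs \<and> distinct (map fst xs) \<and> e \<in> Hom C (list_tens xs) X)"

definition elt :: "(nat \<times> 'o) list \<times> 'o \<times> 'm \<Rightarrow> bool" where
  "elt a \<longleftrightarrow> raw a \<and> sorted (map fst (fst a))"

definition ty :: "(nat \<times> 'o) list \<times> 'o \<times> 'm \<Rightarrow> 'o" where
  "ty a = fst (snd a)"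

definition dj :: "(nat \<times> 'o) list \<times> 'o \<times> 'm \<Rightarrow> (nat \<times> 'o) list \<times> 'o \<times> 'm \<Rightarrow> bool" where
  "dj a b \<longleftrightarrow> fst ` set (fst a) \<inter> fst ` set (fst b) = {}"

text \<open>The variables are sorted, and the arrow is corrected by the inverse sorting isomorphism
  so that it still denotes the same element.\<close>

definition nf :: "(nat \<times> 'o) list \<times> 'o \<times> 'm \<Rightarrow> (nat \<times> 'o) list \<times> 'o \<times> 'm" where
  "nf a = (case a of (xs, X, e) \<Rightarrow> (sort_key fst xs, X, e \<cdot> Inv C (sorter xs)))"

definition rpair ::
  "(nat \<times> 'o) list \<times> 'o \<times> 'm \<Rightarrow> (nat \<times> 'o) list \<times> 'o \<times> 'm \<Rightarrow> (nat \<times> 'o) list \<times> 'o \<times> 'm" where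
  "rpair a b = (case (a, b) of ((xs, X, e), (ys, Y, e')) \<Rightarrow>
     (xs @ ys, X \<otimes> Y, (e \<odot> e') \<cdot> Inv C (merge xs ys)))"

definition pair ::
  "(nat \<times> 'o) list \<times> 'o \<times> 'm \<Rightarrow> (nat \<times> 'o) list \<times> 'o \<times> 'm \<Rightarrow> (nat \<times> 'o) list \<times> 'o \<times> 'm"
  ("\<langle>_,/ _\<rangle>") where
  "\<langle>a, b\<rangle> = nf (rpair a b)"

definition app :: "'m \<Rightarrow> (nat \<times> 'o) list \<times> 'o \<times> 'm \<Rightarrow> (nat \<times> 'o) list \<times> 'o \<times> 'm"  (infixr "\<rhd>" 75) where
  "F \<rhd> a = (case a of (xs, X, e) \<Rightarrow> (xs, Cod C F, F \<cdot> e))"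

definition star :: "(nat \<times> 'o) list \<times> 'o \<times> 'm" where
  "star = ([], Unit C, Id C (Unit C))"

text \<open>The generic element of X, essentially the identity. \<open>RUnit\<close> appears because
  the product of a one-entry list is X \<otimes> \<open>Unit C\<close>.\<close>

definition var :: "nat \<Rightarrow> 'o \<Rightarrow> (nat \<times> 'o) list \<times> 'o \<times> 'm" where
  "var n X = ([(n, X)], X, RUnit C X)"

lemma ty_simps [simp]:
  "ty (F \<rhd> a) = Cod C F" "ty \<langle>a, b\<rangle> = ty a \<otimes> ty b" "ty (rpair a b) = ty a \<otimes> ty b" "ty (nf a) = ty a"
  "ty star = Unit C" "ty (var n X) = X"
  by (auto simp: ty_def app_def pair_def nf_def rpair_def star_def var_def split: prod.splits)

lemma dj_simps [simp]:
  "dj (F \<rhd> a) b = dj a b" "dj a (F \<rhd> b) = dj a b"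
  "dj \<langle>a, b\<rangle> c \<longleftrightarrow> dj a c \<and> dj b c" "dj c \<langle>a, b\<rangle> \<longleftrightarrow> dj c a \<and> dj c b"
  "dj (rpair a b) c \<longleftrightarrow> dj a c \<and> dj b c" "dj c (rpair a b) \<longleftrightarrow> dj c a \<and> dj c b"
  "dj star a" "dj a star" "m \<noteq> n \<Longrightarrow> dj (var m X) (var n Y)"
  by (auto simp: dj_def app_def pair_def nf_def rpair_def star_def var_def split: prod.splits)

text \<open>Coherence enters the calculus of elements here, through \<open>sorter_perm\<close>:
  representatives that differ by a word of transpositions have the same normal form.\<close>

lemma nf_eqI:
  assumes "perm xs ys p" "distinct (map fst xs)" "e' \<cdot> p = e" "e' \<in> Arr C" "Dom C e' = list_tens ys"
  shows "nf (xs, X, e) = nf (ys, X, e')"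
proof -
  note p = perm_arr[OF assms(1)]
  have n: "sorter ys \<cdot> p = sorter xs" by (rule sorter_perm[OF assms(1,2)])
  have "e' \<cdot> Inv C (sorter ys) = e \<cdot> Inv C (sorter xs)"
  proof (rule iso_cancel_right[of _ "sorter xs"])
    have "(e' \<cdot> Inv C (sorter ys)) \<cdot> sorter xs = e' \<cdot> Inv C (sorter ys) \<cdot> sorter ys \<cdot> p"
      using p assms by (simp flip: n)
    also have "\<dots> = e" using p assms by simp
    finally show "(e' \<cdot> Inv C (sorter ys)) \<cdot> sorter xs = (e \<cdot> Inv C (sorter xs)) \<cdot> sorter xs"
      using p assms(4,5) by (auto simp flip: assms(3))
  qed (use p assms(4,5) sort_perm[OF assms(1,2)] in \<open>auto simp flip: assms(3)\<close>)
  then show ?thesis using sort_perm[OF assms(1,2)] by (simp add: nf_def)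
qed

lemma raw_nf: "raw a \<Longrightarrow> elt (nf a)"
  by (auto simp: raw_def elt_def nf_def in_Hom distinct_map inj_on_def split: prod.splits)

lemma nf_elt: "elt a \<Longrightarrow> nf a = a"
  by (auto simp: raw_def elt_def nf_def in_Hom sorter_sorted sort_key_sorted Inv_eqI[of "Id C X" "Id C X" for X]
      inverse_arrows_def split: prod.splits)

lemma raw_rpair: "\<lbrakk>raw a; raw b; dj a b\<rbrakk> \<Longrightarrow> raw (rpair a b)"
  by (auto simp: raw_def dj_def rpair_def in_Hom split: prod.splits)

text \<open>Normalising the components before pairing changes nothing in the end, so iterated pairs
  can be compared on unsorted representatives.\<close>

lemma rpair_nf:
  assumes "raw a" "raw b" "dj a b"
  shows "nf (rpair (nf a) (nf b)) = nf (rpair a b)"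
proof -
  obtain xs X e ys Y e' where ab: "a = (xs, X, e)" "b = (ys, Y, e')" by (cases a, cases b) auto
  have [simp]: "obj_list xs" "obj_list ys" "e \<in> Arr C" "Dom C e = list_tens xs" "e' \<in> Arr C" "Dom C e' = list_tens ys"
    and d: "distinct (map fst (xs @ ys))"
    using assms by (auto simp: ab raw_def dj_def in_Hom)
  let ?xs = "sort_key fst xs" and ?ys = "sort_key fst ys"
  obtain P where P: "perm (xs @ ys) (?xs @ ?ys) P" "P \<cdot> merge xs ys = merge ?xs ?ys \<cdot> (sorter xs \<odot> sorter ys)"
    using perm_merge[OF perm_nm[of xs] perm_nm[of ys]] by auto
  note p = perm_arr[OF P(1)]
  let ?e = "((e \<cdot> Inv C (sorter xs)) \<odot> (e' \<cdot> Inv C (sorter ys))) \<cdot> Inv C (merge ?xs ?ys)"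
  have "?e \<cdot> P = (e \<odot> e') \<cdot> Inv C (merge xs ys)"
  proof (rule Inv_left_eqI)
    have "(?e \<cdot> P) \<cdot> merge xs ys = ?e \<cdot> (P \<cdot> merge xs ys)" using p by simp
    also have "\<dots> = e \<odot> e'" unfolding P(2) by simp
    finally show "(?e \<cdot> P) \<cdot> merge xs ys = e \<odot> e'" .
  qed (use p in auto)
  from nf_eqI[OF P(1) d this] show ?thesis by (simp add: ab nf_def rpair_def)
qed

lemma rpair_nf_left: "\<lbrakk>raw a; elt b; dj a b\<rbrakk> \<Longrightarrow> nf (rpair (nf a) b) = nf (rpair a b)"
  and rpair_nf_right: "\<lbrakk>elt a; raw b; dj a b\<rbrakk> \<Longrightarrow> nf (rpair a (nf b)) = nf (rpair a b)"
  using rpair_nf[of a b] nf_elt[of a] nf_elt[of b] by (auto simp: elt_def)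

lemma app_nf: "\<lbrakk>raw a; F \<in> Arr C; Dom C F = ty a\<rbrakk> \<Longrightarrow> F \<rhd> nf a = nf (F \<rhd> a)"
  by (auto simp: nf_def app_def raw_def ty_def in_Hom split: prod.splits)

lemma elt_simps [simp]:
  "\<lbrakk>elt a; F \<in> Arr C; Dom C F = ty a\<rbrakk> \<Longrightarrow> elt (F \<rhd> a)"
  "\<lbrakk>elt a; elt b; dj a b\<rbrakk> \<Longrightarrow> elt \<langle>a, b\<rangle>"
  "elt star" "X \<in> Obj C \<Longrightarrow> elt (var n X)"
  "elt a \<Longrightarrow> ty a \<in> Obj C"
  subgoal by (auto simp: elt_def app_def raw_def ty_def in_Hom split: prod.splits)
  subgoal by (auto simp: pair_def intro!: raw_nf raw_rpair) (auto simp: elt_def)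
  by (auto simp: elt_def raw_def star_def var_def ty_def in_Hom split: prod.splits)

lemma app_comp [simp]:
  "\<lbrakk>elt a; f \<in> Arr C; g \<in> Arr C; Dom C f = ty a; Dom C g = Cod C f\<rbrakk> \<Longrightarrow> (g \<cdot> f) \<rhd> a = g \<rhd> f \<rhd> a"
  by (auto simp: elt_def app_def raw_def ty_def in_Hom split: prod.splits)

lemma app_Id [simp]: "\<lbrakk>elt a; X = ty a\<rbrakk> \<Longrightarrow> Id C X \<rhd> a = a"
  by (auto simp: elt_def app_def raw_def ty_def in_Hom split: prod.splits)

lemma app_tens [simp]:
  assumes "elt a" "elt b" "f \<in> Arr C" "g \<in> Arr C" "Dom C f = ty a" "Dom C g = ty b" "dj a b"
  shows "(f \<odot> g) \<rhd> \<langle>a, b\<rangle> = \<langle>f \<rhd> a, g \<rhd> b\<rangle>"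
proof -
  have "(f \<odot> g) \<rhd> rpair a b = rpair (f \<rhd> a) (g \<rhd> b)"
    using assms by (auto simp: elt_def app_def rpair_def raw_def ty_def in_Hom split: prod.splits)
  then show ?thesis using assms by (simp add: pair_def app_nf raw_rpair elt_def)
qed

text \<open>On unsorted representatives both bracketings list the variables in the same order, since
  appending lists is associative. So naturality and \<open>merge_assoc\<close> suffice, and sorting
  is applied at the end.\<close>

lemma app_Assoc [simp]:
  assumes "elt a" "elt b" "elt c" "dj a b" "dj a c" "dj b c" "X = ty a" "Y = ty b" "Z = ty c"
  shows "Assoc C X Y Z \<rhd> \<langle>\<langle>a, b\<rangle>, c\<rangle> = \<langle>a, \<langle>b, c\<rangle>\<rangle>"
proof -
  have r: "raw a" "raw b" "raw c" using assms by (auto simp: elt_def)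
  have d: "dj (rpair a b) c" "dj a (rpair b c)" using assms by auto
  obtain xs X' e ys Y' e' zs Z' e'' where abc: "a = (xs, X', e)" "b = (ys, Y', e')" "c = (zs, Z', e'')"
    by (cases a, cases b, cases c) auto
  have [simp]: "obj_list xs" "obj_list ys" "obj_list zs" "e \<in> Arr C" "Dom C e = list_tens xs" "e' \<in> Arr C" "Dom C e' = list_tens ys"
    "e'' \<in> Arr C" "Dom C e'' = list_tens zs" "Cod C e = X" "Cod C e' = Y" "Cod C e'' = Z"
    and eq [simp]: "X' = X" "Y' = Y" "Z' = Z"
    using r assms by (auto simp: abc raw_def dj_def in_Hom ty_def)
  have o [simp]: "X \<in> Obj C" "Y \<in> Obj C" "Z \<in> Obj C" using assms by auto
  have "Assoc C X Y Z \<rhd> rpair (rpair a b) c = rpair a (rpair b c)"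
  proof -
    \<comment> \<open>The left side of \<open>merge_assoc\<close>: it cancels the inverse
      rebracketings on one side and can be rewritten to cancel those on the other.\<close>
    let ?m = "merge (xs @ ys) zs \<cdot> (merge xs ys \<odot> Id C (list_tens zs))"
    have "Assoc C X Y Z \<cdot> (((e \<odot> e') \<cdot> Inv C (merge xs ys)) \<odot> e'') \<cdot> Inv C (merge (xs @ ys) zs) =
      (e \<odot> ((e' \<odot> e'') \<cdot> Inv C (merge ys zs))) \<cdot> Inv C (merge xs (ys @ zs))"
    proof (rule iso_cancel_right[of _ ?m])
      have "(Assoc C X Y Z \<cdot> (((e \<odot> e') \<cdot> Inv C (merge xs ys)) \<odot> e'') \<cdot> Inv C (merge (xs @ ys) zs)) \<cdot> ?m =
        Assoc C X Y Z \<cdot> ((e \<odot> e') \<odot> e'')" by simp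
      also have "\<dots> = (e \<odot> (e' \<odot> e'')) \<cdot> Assoc C (list_tens xs) (list_tens ys) (list_tens zs)"
        by (subst Assoc_natural) auto
      also have "\<dots> = (e \<odot> ((e' \<odot> e'') \<cdot> Inv C (merge ys zs))) \<cdot> Inv C (merge xs (ys @ zs)) \<cdot> ?m"
        by (subst merge_assoc) auto
      finally show "(Assoc C X Y Z \<cdot> (((e \<odot> e') \<cdot> Inv C (merge xs ys)) \<odot> e'') \<cdot> Inv C (merge (xs @ ys) zs)) \<cdot> ?m =
        ((e \<odot> ((e' \<odot> e'') \<cdot> Inv C (merge ys zs))) \<cdot> Inv C (merge xs (ys @ zs))) \<cdot> ?m" by simp
    qed auto
    then show ?thesis by (simp add: abc app_def rpair_def)
  qed
  moreover have "Assoc C X Y Z \<rhd> \<langle>\<langle>a, b\<rangle>, c\<rangle> = nf (Assoc C X Y Z \<rhd> rpair (rpair a b) c)"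
    using assms r d o by (simp add: pair_def rpair_nf_left raw_rpair app_nf)
  moreover have "\<langle>a, \<langle>b, c\<rangle>\<rangle> = nf (rpair a (rpair b c))"
    using assms r d o by (simp add: pair_def rpair_nf_right raw_rpair)
  ultimately show ?thesis by simp
qed

text \<open>The two pairs list their variables in different orders, so the equation holds only after
  sorting: \<open>perm_Sym\<close> supplies the permutation and \<open>nf_eqI\<close> absorbs
  it.\<close>

lemma app_Sym [simp]:
  assumes "elt a" "elt b" "dj a b" "X = ty a" "Y = ty b"
  shows "Sym C X Y \<rhd> \<langle>a, b\<rangle> = \<langle>b, a\<rangle>"
proof -
  have r: "raw a" "raw b" using assms by (auto simp: elt_def)
  obtain xs X' e ys Y' e' where ab: "a = (xs, X', e)" "b = (ys, Y', e')" by (cases a, cases b) auto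
  have [simp]: "obj_list xs" "obj_list ys" "e \<in> Arr C" "Dom C e = list_tens xs" "e' \<in> Arr C" "Dom C e' = list_tens ys"
    "Cod C e = X" "Cod C e' = Y" and eq [simp]: "X' = X" "Y' = Y"
    and d: "distinct (map fst (xs @ ys))"
    using r assms by (auto simp: ab raw_def dj_def in_Hom ty_def)
  have o [simp]: "X \<in> Obj C" "Y \<in> Obj C" using assms by auto
  obtain P where P: "perm (xs @ ys) (ys @ xs) P" "P \<cdot> merge xs ys = merge ys xs \<cdot> Sym C (list_tens xs) (list_tens ys)"
    using perm_Sym[of xs ys] by auto
  note p = perm_arr[OF P(1)]
  have "((e' \<odot> e) \<cdot> Inv C (merge ys xs)) \<cdot> P = Sym C X Y \<cdot> (e \<odot> e') \<cdot> Inv C (merge xs ys)"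
  proof (rule iso_cancel_right[of _ "merge xs ys"])
    have "(((e' \<odot> e) \<cdot> Inv C (merge ys xs)) \<cdot> P) \<cdot> merge xs ys = ((e' \<odot> e) \<cdot> Inv C (merge ys xs)) \<cdot> (P \<cdot> merge xs ys)"
      using p by simp
    also have "\<dots> = (e' \<odot> e) \<cdot> Sym C (list_tens xs) (list_tens ys)" unfolding P(2) by simp
    also have "\<dots> = Sym C X Y \<cdot> (e \<odot> e')" by (subst Sym_natural) auto
    finally show "(((e' \<odot> e) \<cdot> Inv C (merge ys xs)) \<cdot> P) \<cdot> merge xs ys =
      (Sym C X Y \<cdot> (e \<odot> e') \<cdot> Inv C (merge xs ys)) \<cdot> merge xs ys" by simp
  qed (use p in auto)
  from nf_eqI[OF P(1) d this] have "nf (Sym C X Y \<rhd> rpair a b) = nf (rpair b a)"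
    by (simp add: ab app_def rpair_def)
  then show ?thesis using assms r o by (simp add: pair_def app_nf raw_rpair)
qed

lemma app_LUnit [simp]:
  assumes "elt a" "X = ty a"
  shows "LUnit C X \<rhd> \<langle>star, a\<rangle> = a"
proof -
  obtain xs X' e where a: "a = (xs, X', e)" by (cases a) auto
  have [simp]: "obj_list xs" "e \<in> Arr C" "Dom C e = list_tens xs" "Cod C e = X" "X' = X"
    using assms by (auto simp: elt_def raw_def ty_def a in_Hom)
  have o [simp]: "X \<in> Obj C" using assms by simp
  have "LUnit C X \<cdot> (Id C (Unit C) \<odot> e) \<cdot> Inv C (LUnit C (list_tens xs)) =
    (LUnit C X \<cdot> (Id C (Unit C) \<odot> e)) \<cdot> Inv C (LUnit C (list_tens xs))" by simp
  also have "\<dots> = e" by (subst LUnit_natural) auto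
  finally have "LUnit C X \<cdot> (Id C (Unit C) \<odot> e) \<cdot> Inv C (LUnit C (list_tens xs)) = e" .
  then have "LUnit C X \<rhd> rpair star a = a"
    by (simp add: a app_def rpair_def star_def)
  moreover have "raw (rpair star a)" using assms elt_simps(3) by (intro raw_rpair) (auto simp: elt_def)
  moreover have "LUnit C X \<rhd> \<langle>star, a\<rangle> = nf (LUnit C X \<rhd> rpair star a)"
    using assms o \<open>raw (rpair star a)\<close> unfolding pair_def by (intro app_nf) auto
  ultimately show ?thesis using nf_elt[OF assms(1)] by simp
qed

lemma app_RUnit [simp]:
  assumes "elt a" "X = ty a"
  shows "RUnit C X \<rhd> \<langle>a, star\<rangle> = a"
  using assms by (simp flip: LUnit_Sym)

lemma app_Inv:
  assumes "F \<rhd> a = b" "is_iso C F" "elt a" "Dom C F = ty a"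
  shows "Inv C F \<rhd> b = a"
proof -
  have "Inv C F \<rhd> b = (Inv C F \<cdot> F) \<rhd> a"
    using assms(2-) iso_arr[OF assms(2)] by (simp del: Inv_arr(4) flip: assms(1))
  then show ?thesis using assms(2-) by simp
qed

lemma app_Inv_simps [simp]:
  "\<lbrakk>elt a; elt b; elt c; dj a b; dj a c; dj b c; X = ty a; Y = ty b; Z = ty c\<rbrakk> \<Longrightarrow>
    Inv C (Assoc C X Y Z) \<rhd> \<langle>a, \<langle>b, c\<rangle>\<rangle> = \<langle>\<langle>a, b\<rangle>, c\<rangle>"
  "\<lbrakk>elt a; X = ty a\<rbrakk> \<Longrightarrow> Inv C (LUnit C X) \<rhd> a = \<langle>star, a\<rangle>"
  "\<lbrakk>elt a; X = ty a\<rbrakk> \<Longrightarrow> Inv C (RUnit C X) \<rhd> a = \<langle>a, star\<rangle>"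
  by (rule app_Inv; simp)+

end

section \<open>Coequalizers and weak equivalences\<close>

context category begin

definition epi :: "'m \<Rightarrow> bool" where
  "epi f \<longleftrightarrow> f \<in> Arr C \<and> (\<forall>g h. g \<in> Arr C \<longrightarrow> h \<in> Arr C \<longrightarrow>
     Dom C g = Cod C f \<longrightarrow> Dom C h = Cod C f \<longrightarrow> g \<cdot> f = h \<cdot> f \<longrightarrow> g = h)"

lemma epi_cancel:
  "\<lbrakk>g \<cdot> f = h \<cdot> f; epi f; g \<in> Arr C; h \<in> Arr C; Dom C g = Cod C f; Dom C h = Cod C f\<rbrakk> \<Longrightarrow> g = h"
  by (auto simp: epi_def)

lemma iso_epi: "is_iso C f \<Longrightarrow> epi f"
  unfolding epi_def using iso_arr iso_cancel_right by blast

lemma epi_comp: "\<lbrakk>epi f; epi g; Dom C g = Cod C f\<rbrakk> \<Longrightarrow> epi (g \<cdot> f)"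
  unfolding epi_def by (auto simp flip: comp_assoc)

lemma coequalizer_epi:
  assumes "is_coequalizer C u v Q q"
  shows "epi q"
  unfolding epi_def
proof (intro conjI allI impI)
  show q: "q \<in> Arr C" using assms by (auto simp: is_coequalizer_def in_Hom)
  fix g h assume gh: "g \<in> Arr C" "h \<in> Arr C" "Dom C g = Cod C q" "Dom C h = Cod C q" "g \<cdot> q = h \<cdot> q"
  \<comment> \<open>\<open>epi\<close> does not presuppose a common codomain of the two arrows; it
    follows from equality of the composites.\<close>
  have "Cod C g = Cod C (g \<cdot> q)" "Cod C h = Cod C (h \<cdot> q)" using gh(1-4) q by simp_all
  then have c: "Cod C g = Cod C h" using gh(5) by simp
  have "(g \<cdot> q) \<cdot> u = g \<cdot> (q \<cdot> u)" "(g \<cdot> q) \<cdot> v = g \<cdot> (q \<cdot> v)"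
    using assms gh(1-4) by (auto simp: is_coequalizer_def in_Hom)
  then have "(g \<cdot> q) \<cdot> u = (g \<cdot> q) \<cdot> v" using assms by (simp add: is_coequalizer_def)
  then have "\<exists>!k. k \<in> Hom C Q (Cod C g) \<and> k \<cdot> q = g \<cdot> q"
    using assms gh(1-4) by (auto simp: is_coequalizer_def in_Hom)
  moreover have "g \<in> Hom C Q (Cod C g)" "h \<in> Hom C Q (Cod C g)"
    using assms gh(1-4) c by (auto simp: is_coequalizer_def in_Hom)
  ultimately show "g = h" using gh(5) by metis
qed

lemma coequalizer_induced:
  assumes "is_coequalizer C u v Q q" "k \<in> Arr C" "Dom C k = Cod C u" "k \<cdot> u = k \<cdot> v"
  shows "\<exists>h. h \<in> Hom C Q (Cod C k) \<and> h \<cdot> q = k"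
proof -
  have "k \<in> Hom C (Cod C u) (Cod C k)" using assms(2,3) by (simp add: in_Hom)
  then have "\<exists>!h. h \<in> Hom C Q (Cod C k) \<and> h \<cdot> q = k"
    using assms(1,4) by (simp only: is_coequalizer_def)
  then show ?thesis by (rule ex1_implies_ex)
qed

lemma retract_ofI:
  assumes "f \<in> Arr C" "g \<in> Arr C" "i \<in> Hom C (Dom C f) (Dom C g)" "r \<in> Hom C (Dom C g) (Dom C f)"
    "j \<in> Hom C (Cod C f) (Cod C g)" "s \<in> Hom C (Cod C g) (Cod C f)"
    "r \<cdot> i = Id C (Dom C f)" "s \<cdot> j = Id C (Cod C f)" "g \<cdot> i = j \<cdot> f" "f \<cdot> r = s \<cdot> g"
  shows "retract_of C f g"
  unfolding retract_of_def using assms by blast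

lemma category_op: "category (op_cat C)"
  by unfold_locales (auto simp: op_cat_def Hom_def)

end

context model_category begin

text \<open>A parallel pair is a diagram over the category with two objects and two parallel
  non-identity arrows, which is small because \<open>'u\<close> is infinite.\<close>

lemma ex_coequalizer:
  assumes u: "u \<in> Arr C" and v: "v \<in> Hom C (Dom C u) (Cod C u)"
  shows "\<exists>Q q. is_coequalizer C u v Q q"
proof -
  \<comment> \<open>Four elements: \<open>a\<close> and \<open>b\<close> name the objects and also
    their identities, \<open>c\<close> and \<open>d\<close> the two parallel arrows.\<close>
  obtain S :: "'u set" where "finite S" "card S = 4"
    using infinite_arbitrarily_large[OF infinite_UNIV] by blast
  then obtain a b c d :: 'u where d [simp]: "a \<noteq> b" "a \<noteq> c" "a \<noteq> d" "b \<noteq> c" "b \<noteq> d" "c \<noteq> d"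
    "b \<noteq> a" "c \<noteq> a" "d \<noteq> a" "c \<noteq> b" "d \<noteq> b" "d \<noteq> c"
    by (auto simp: card_Suc_eq numeral_eq_Suc)
  define J :: "('u, 'u) cat" where
    "J = \<lparr>Obj = {a, b}, Arr = {a, b, c, d}, Dom = (\<lambda>x. if x = b then b else a),
      Cod = (\<lambda>x. if x = a then a else b), Id = (\<lambda>x. x), Comp = (\<lambda>g f. if f = a \<or> f = b then g else f)\<rparr>"
  \<comment> \<open>The target is the opposite category, so \<open>a\<close> goes to the codomain of
    \<open>u\<close> and \<open>b\<close> to its domain. The leg of the limit at \<open>a\<close> is
    then the coequalizer map.\<close>
  define F where "F = \<lparr>FO = (\<lambda>x. if x = a then Cod C u else Dom C u),
    FA = (\<lambda>x. if x = a then Id C (Cod C u) else if x = b then Id C (Dom C u) else if x = c then u else v)\<rparr>"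
  have v': "v \<in> Arr C" "Dom C v = Dom C u" "Cod C v = Cod C u" using v by (auto simp: in_Hom)
  have "category J" by unfold_locales (auto simp: J_def Hom_def)
  then have "is_functor J (op_cat C) F"
    unfolding is_functor_def using u v' category_op
    by (auto simp: J_def F_def Hom_def op_cat_def)
  then obtain L \<pi> where lim: "is_limit (op_cat C) J F L \<pi>"
    using cocomplete unfolding has_small_colimits_def has_small_limits_def by blast
  then have cone: "is_cone (op_cat C) J F L \<pi>" by (simp add: is_limit_def)
  have pa: "\<pi> a \<in> Hom C (Cod C u) L"
    using cone by (auto simp: is_cone_def J_def F_def op_cat_def Hom_def)
  have "c \<in> Hom J a b" "d \<in> Hom J a b" by (auto simp: J_def Hom_def)
  then have pu: "\<pi> a \<cdot> u = \<pi> b" and pv: "\<pi> a \<cdot> v = \<pi> b"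
    using cone unfolding is_cone_def by (fastforce simp: F_def op_cat_def)+
  have "is_coequalizer C u v L (\<pi> a)"
    unfolding is_coequalizer_def
  proof (intro conjI allI ballI impI)
    fix Z k assume k: "k \<in> Hom C (Cod C u) Z" and eq: "k \<cdot> u = k \<cdot> v"
    have "is_cone (op_cat C) J F Z (\<lambda>x. if x = a then k else k \<cdot> u)"
      using k u v' eq by (auto simp: is_cone_def J_def F_def op_cat_def Hom_def)
    then have "\<exists>!h. h \<in> Hom (op_cat C) Z L \<and>
      (\<forall>j \<in> Obj J. \<pi> j \<cdot>\<^bsub>op_cat C\<^esub> h = (if j = a then k else k \<cdot> u))"
      using lim unfolding is_limit_def by blast
    moreover have "h \<in> Hom (op_cat C) Z L \<and>
      (\<forall>j \<in> Obj J. \<pi> j \<cdot>\<^bsub>op_cat C\<^esub> h = (if j = a then k else k \<cdot> u)) \<longleftrightarrow>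
      h \<in> Hom C L Z \<and> h \<cdot> \<pi> a = k" for h
      using pa u by (auto simp: J_def op_cat_def Hom_def simp flip: pu)
    ultimately show "\<exists>!h. h \<in> Hom C L Z \<and> h \<cdot> \<pi> a = k" by simp
  qed (use u v pa pu pv in auto)
  then show ?thesis by blast
qed

text \<open>If the identity factors as \<open>p\<close> after a trivial cofibration
  \<open>i\<close>, then it is a retract of \<open>i\<close>, with \<open>i\<close> and
  \<open>p\<close> on the codomains.\<close>

lemma Id_weq:
  assumes "X \<in> Obj C"
  shows "Id C X \<in> Weq M"
proof -
  obtain i p where ip: "i \<in> Cof M \<inter> Weq M" "p \<in> Fib M" "Dom C p = Cod C i" "Id C X = p \<cdot> i"
    using factorization(1) assms unfolding factorizes_def by (meson Id_arr(1))
  have a: "i \<in> Arr C" "p \<in> Arr C" using ip classes by auto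
  have "Dom C (p \<cdot> i) = X" "Cod C (p \<cdot> i) = X" using ip(4) assms by (simp_all flip: ip(4))
  then have "Dom C i = X" "Cod C p = X" using a ip(3) by simp_all
  then have "retract_of C (Id C X) i"
    using a ip(3) ip(4)[symmetric] assms
    by (intro retract_ofI[of _ _ "Id C X" "Id C X" i p]) (simp_all add: in_Hom)
  then show ?thesis using retracts(1) ip(1) by (auto simp: retract_closed_def)
qed

text \<open>An isomorphism is a retract of the identity of its domain.\<close>

lemma iso_weq:
  assumes "is_iso C f"
  shows "f \<in> Weq M"
proof -
  have f: "f \<in> Arr C" using assms by (rule iso_arr)
  have "retract_of C f (Id C (Dom C f))"
    using assms f
    by (intro retract_ofI[of _ _ "Id C (Dom C f)" "Id C (Dom C f)" "Inv C f" f]) (auto simp: in_Hom)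
  then show ?thesis using retracts(1) Id_weq[of "Dom C f"] f by (auto simp: retract_closed_def)
qed

lemma weq_comp: "\<lbrakk>f \<in> Weq M; g \<in> Weq M; Dom C g = Cod C f\<rbrakk> \<Longrightarrow> g \<cdot> f \<in> Weq M"
  using two_out_of_three(1)[of f "Dom C f" "Cod C f" g "Cod C g"] classes(1) by (auto simp: in_Hom)

end

context symmetric_monoidal_model_category begin

lemma tens_transpose:
  assumes Y [simp]: "Y \<in> Obj C" and "Z \<in> Obj C"
  obtains H ev where "H \<in> Obj C" "ev \<in> Arr C" "Dom C ev = H \<otimes> Y" "Cod C ev = Z"
    "\<And>f X. \<lbrakk>f \<in> Arr C; X \<in> Obj C; Dom C f = X \<otimes> Y; Cod C f = Z\<rbrakk> \<Longrightarrow>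
      \<exists>k \<in> Arr C. Dom C k = X \<and> Cod C k = H \<and> ev \<cdot> (k \<odot> Id C Y) = f"
    "\<And>k k'. \<lbrakk>k \<in> Arr C; k' \<in> Arr C; Dom C k = Dom C k'; Cod C k = H; Cod C k' = H;
      ev \<cdot> (k \<odot> Id C Y) = ev \<cdot> (k' \<odot> Id C Y)\<rbrakk> \<Longrightarrow> k = k'"
proof -
  obtain H ev where H: "H \<in> Obj C" "ev \<in> Hom C (H \<otimes> Y) Z"
    "\<And>X f. \<lbrakk>X \<in> Obj C; f \<in> Hom C (X \<otimes> Y) Z\<rbrakk> \<Longrightarrow> \<exists>!k. k \<in> Hom C X H \<and> ev \<cdot> (k \<odot> Id C Y) = f"
    using closed[OF assms] by blast
  have ev [simp]: "ev \<in> Arr C" "Dom C ev = H \<otimes> Y" "Cod C ev = Z" using H(2) by (auto simp: in_Hom)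
  show ?thesis
  proof (rule that[OF H(1) ev])
    fix f X assume "f \<in> Arr C" "X \<in> Obj C" "Dom C f = X \<otimes> Y" "Cod C f = Z"
    then have "\<exists>k. k \<in> Hom C X H \<and> ev \<cdot> (k \<odot> Id C Y) = f" using H(3)[of X f] by (auto simp: in_Hom)
    then show "\<exists>k \<in> Arr C. Dom C k = X \<and> Cod C k = H \<and> ev \<cdot> (k \<odot> Id C Y) = f" unfolding in_Hom by blast
  next
    fix k k' assume k: "k \<in> Arr C" "k' \<in> Arr C" "Dom C k = Dom C k'" "Cod C k = H" "Cod C k' = H"
      "ev \<cdot> (k \<odot> Id C Y) = ev \<cdot> (k' \<odot> Id C Y)"
    have "ev \<cdot> (k' \<odot> Id C Y) \<in> Hom C (Dom C k' \<otimes> Y) Z" using k(1-5) by (simp add: in_Hom)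
    then have "\<exists>!l. l \<in> Hom C (Dom C k') H \<and> ev \<cdot> (l \<odot> Id C Y) = ev \<cdot> (k' \<odot> Id C Y)"
      using H(3) k(2) by simp
    moreover have "k \<in> Hom C (Dom C k') H" "k' \<in> Hom C (Dom C k') H" using k by (simp_all add: in_Hom)
    ultimately show "k = k'" using k(6) by blast
  qed
qed

text \<open>A left adjoint preserves epimorphisms: arrows out of the tensor product are compared
  through their transposes into the internal hom.\<close>

lemma epi_tens_Id:
  assumes f: "epi f" and Y [simp]: "Y \<in> Obj C"
  shows "epi (f \<odot> Id C Y)"
  unfolding epi_def
proof (intro conjI allI impI)
  have [simp]: "f \<in> Arr C" using f by (simp add: epi_def)
  then show "f \<odot> Id C Y \<in> Arr C" by simp
  fix g h assume [simp]: "g \<in> Arr C" "h \<in> Arr C"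
    and "Dom C g = Cod C (f \<odot> Id C Y)" "Dom C h = Cod C (f \<odot> Id C Y)"
    and eq: "g \<cdot> (f \<odot> Id C Y) = h \<cdot> (f \<odot> Id C Y)"
  then have [simp]: "Dom C g = Cod C f \<otimes> Y" "Dom C h = Cod C f \<otimes> Y" by auto
  have "Cod C (g \<cdot> (f \<odot> Id C Y)) = Cod C (h \<cdot> (f \<odot> Id C Y))" by (simp only: eq)
  then have c [simp]: "Cod C h = Cod C g" by simp
  obtain H ev where H [simp]: "H \<in> Obj C" "ev \<in> Arr C" "Dom C ev = H \<otimes> Y" "Cod C ev = Cod C g"
    and ex: "\<And>f X. \<lbrakk>f \<in> Arr C; X \<in> Obj C; Dom C f = X \<otimes> Y; Cod C f = Cod C g\<rbrakk> \<Longrightarrow>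
      \<exists>k \<in> Arr C. Dom C k = X \<and> Cod C k = H \<and> ev \<cdot> (k \<odot> Id C Y) = f"
    and inj: "\<And>k k'. \<lbrakk>k \<in> Arr C; k' \<in> Arr C; Dom C k = Dom C k'; Cod C k = H; Cod C k' = H;
      ev \<cdot> (k \<odot> Id C Y) = ev \<cdot> (k' \<odot> Id C Y)\<rbrakk> \<Longrightarrow> k = k'"
    by (rule tens_transpose[OF Y Cod_Obj[OF \<open>g \<in> Arr C\<close>]]) (rule that)
  obtain g' where [simp]: "g' \<in> Arr C" "Dom C g' = Cod C f" "Cod C g' = H" and g': "ev \<cdot> (g' \<odot> Id C Y) = g"
    using ex[of g "Cod C f"] by auto
  obtain h' where [simp]: "h' \<in> Arr C" "Dom C h' = Cod C f" "Cod C h' = H" and h': "ev \<cdot> (h' \<odot> Id C Y) = h"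
    using ex[of h "Cod C f"] by auto
  have "ev \<cdot> ((g' \<cdot> f) \<odot> Id C Y) = (ev \<cdot> (g' \<odot> Id C Y)) \<cdot> (f \<odot> Id C Y)" by simp
  also have "\<dots> = (ev \<cdot> (h' \<odot> Id C Y)) \<cdot> (f \<odot> Id C Y)" by (simp only: g' h' eq)
  also have "\<dots> = ev \<cdot> ((h' \<cdot> f) \<odot> Id C Y)" by simp
  finally have "g' \<cdot> f = h' \<cdot> f" by (rule inj[rotated 5]) simp_all
  then have "g' = h'" by (rule epi_cancel[OF _ f]) simp_all
  then show "g = h" using g' h' by simp
qed

text \<open>A product of arrows is a composite of one-sided products, and tensoring on the left is
  conjugate by symmetries to tensoring on the right.\<close>

lemma epi_tens:
  assumes "epi f" "epi g"
  shows "epi (f \<odot> g)"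
proof -
  have [simp]: "f \<in> Arr C" "g \<in> Arr C" using assms by (auto simp: epi_def)
  have "f \<odot> g = (f \<odot> Id C (Cod C g)) \<cdot> (Id C (Dom C f) \<odot> g)" by simp
  also have "Id C (Dom C f) \<odot> g = (Sym C (Cod C g) (Dom C f) \<cdot> (g \<odot> Id C (Dom C f))) \<cdot> Sym C (Dom C f) (Dom C g)"
    by (subst Sym_natural) auto
  finally have *: "f \<odot> g = (f \<odot> Id C (Cod C g)) \<cdot> Sym C (Cod C g) (Dom C f) \<cdot> (g \<odot> Id C (Dom C f)) \<cdot> Sym C (Dom C f) (Dom C g)"
    by simp
  show ?thesis unfolding *
    by (intro epi_comp epi_tens_Id assms iso_epi[OF Sym_iso]) simp_all
qed

text \<open>The tensor product is closed, so \<open>- \<otimes> Y\<close> is a left adjoint.\<close>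

lemma coequalizer_tens:
  assumes coeq: "is_coequalizer C u v Q q" and Y [simp]: "Y \<in> Obj C"
  shows "is_coequalizer C (u \<odot> Id C Y) (v \<odot> Id C Y) (Q \<otimes> Y) (q \<odot> Id C Y)"
proof -
  have [simp]: "u \<in> Arr C" "v \<in> Arr C" "Dom C v = Dom C u" "Cod C v = Cod C u"
    "q \<in> Arr C" "Dom C q = Cod C u" "Cod C q = Q" and eq: "q \<cdot> u = q \<cdot> v"
    using coeq by (auto simp: is_coequalizer_def in_Hom)
  have Q [simp]: "Q \<in> Obj C" using Cod_Obj[of q] by simp
  have ex: "\<exists>h. h \<in> Hom C (Q \<otimes> Y) Z \<and> h \<cdot> (q \<odot> Id C Y) = k"
    if k: "k \<in> Hom C (Cod C u \<otimes> Y) Z" and ke: "k \<cdot> (u \<odot> Id C Y) = k \<cdot> (v \<odot> Id C Y)" for Z k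
  proof -
    have [simp]: "k \<in> Arr C" "Dom C k = Cod C u \<otimes> Y" "Cod C k = Z" using k by (auto simp: in_Hom)
    have [simp]: "Z \<in> Obj C" using Cod_Obj[of k] by simp
    obtain H ev where H [simp]: "H \<in> Obj C" "ev \<in> Arr C" "Dom C ev = H \<otimes> Y" "Cod C ev = Z"
      and ex: "\<And>f X. \<lbrakk>f \<in> Arr C; X \<in> Obj C; Dom C f = X \<otimes> Y; Cod C f = Z\<rbrakk> \<Longrightarrow>
        \<exists>k \<in> Arr C. Dom C k = X \<and> Cod C k = H \<and> ev \<cdot> (k \<odot> Id C Y) = f"
      and inj: "\<And>k k'. \<lbrakk>k \<in> Arr C; k' \<in> Arr C; Dom C k = Dom C k'; Cod C k = H; Cod C k' = H;
        ev \<cdot> (k \<odot> Id C Y) = ev \<cdot> (k' \<odot> Id C Y)\<rbrakk> \<Longrightarrow> k = k'"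
      by (rule tens_transpose[OF Y \<open>Z \<in> Obj C\<close>]) (rule that)
    obtain k' where [simp]: "k' \<in> Arr C" "Dom C k' = Cod C u" "Cod C k' = H" and k': "ev \<cdot> (k' \<odot> Id C Y) = k"
      using ex[of k "Cod C u"] by auto
    have "ev \<cdot> ((k' \<cdot> u) \<odot> Id C Y) = (ev \<cdot> (k' \<odot> Id C Y)) \<cdot> (u \<odot> Id C Y)" by simp
    also have "\<dots> = (ev \<cdot> (k' \<odot> Id C Y)) \<cdot> (v \<odot> Id C Y)" by (simp only: k' ke)
    also have "\<dots> = ev \<cdot> ((k' \<cdot> v) \<odot> Id C Y)" by simp
    finally have "k' \<cdot> u = k' \<cdot> v" by (rule inj[rotated 5]) simp_all
    moreover have "k' \<in> Hom C (Cod C u) H" by (simp add: in_Hom)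
    ultimately obtain h where h: "h \<in> Hom C Q H" "h \<cdot> q = k'"
      using coeq unfolding is_coequalizer_def by blast
    have [simp]: "h \<in> Arr C" "Dom C h = Q" "Cod C h = H" using h by (auto simp: in_Hom)
    have "(ev \<cdot> (h \<odot> Id C Y)) \<cdot> (q \<odot> Id C Y) = k" using h(2) k' by simp
    then show ?thesis by (intro exI[of _ "ev \<cdot> (h \<odot> Id C Y)"]) (simp add: in_Hom)
  qed
  have e: "epi (q \<odot> Id C Y)" using coequalizer_epi[OF coeq] by (simp add: epi_tens_Id)
  have "\<exists>!h. h \<in> Hom C (Q \<otimes> Y) Z \<and> h \<cdot> (q \<odot> Id C Y) = k"
    if k: "k \<in> Hom C (Cod C u \<otimes> Y) Z" and ke: "k \<cdot> (u \<odot> Id C Y) = k \<cdot> (v \<odot> Id C Y)" for Z k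
  proof (rule ex_ex1I)
    show "\<exists>h. h \<in> Hom C (Q \<otimes> Y) Z \<and> h \<cdot> (q \<odot> Id C Y) = k" by (rule ex[OF that])
    fix h h' assume h: "h \<in> Hom C (Q \<otimes> Y) Z \<and> h \<cdot> (q \<odot> Id C Y) = k" "h' \<in> Hom C (Q \<otimes> Y) Z \<and> h' \<cdot> (q \<odot> Id C Y) = k"
    show "h = h'" by (rule epi_cancel[OF _ e]) (use h in \<open>simp_all add: in_Hom\<close>)
  qed
  note uniq = this
  show ?thesis
    unfolding is_coequalizer_def
  proof (intro conjI allI ballI impI)
    fix Z k assume "k \<in> Hom C (Cod C (u \<odot> Id C Y)) Z" "k \<cdot> (u \<odot> Id C Y) = k \<cdot> (v \<odot> Id C Y)"
    then show "\<exists>!h. h \<in> Hom C (Q \<otimes> Y) Z \<and> h \<cdot> (q \<odot> Id C Y) = k" by (intro uniq) simp_all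
  qed (simp_all add: in_Hom eq)
qed

section \<open>Elements that detect equality of arrows\<close>

text \<open>A generic element: its arrow is epi, so arrows agreeing on it are equal. Besides
  variables this includes generators x \<otimes> y of a relative tensor product, being images of
  variables under an epi projection.\<close>

definition cover :: "(nat \<times> 'o) list \<times> 'o \<times> 'm \<Rightarrow> bool" where
  "cover a \<longleftrightarrow> elt a \<and> epi (snd (snd a))"

lemma cover_simps [simp]:
  "X \<in> Obj C \<Longrightarrow> cover (var n X)" "cover star" "\<lbrakk>cover a; cover b; dj a b\<rbrakk> \<Longrightarrow> cover \<langle>a, b\<rangle>"
  "\<lbrakk>cover a; epi q; Dom C q = ty a\<rbrakk> \<Longrightarrow> cover (q \<rhd> a)" "cover a \<Longrightarrow> elt a"
proof -
  assume *: "cover a" "cover b" "dj a b"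
  then have "epi (snd (snd \<langle>a, b\<rangle>))"
    by (auto simp: cover_def elt_def raw_def in_Hom pair_def nf_def rpair_def
        intro!: epi_comp iso_epi[OF iso_Inv] epi_tens split: prod.splits)
  then show "cover \<langle>a, b\<rangle>" using * by (auto simp: cover_def)
next
  assume *: "cover a" "epi q" "Dom C q = ty a"
  then have "epi (snd (snd (q \<rhd> a)))"
    by (auto simp: cover_def elt_def raw_def in_Hom app_def ty_def intro!: epi_comp split: prod.splits)
  then show "cover (q \<rhd> a)" using * by (auto simp: cover_def epi_def)
qed (auto simp: cover_def, auto simp: star_def var_def intro: iso_epi)

lemma cover_ext:
  assumes "F \<rhd> a = G \<rhd> a" "cover a" "F \<in> Arr C" "G \<in> Arr C" "Dom C F = ty a" "Dom C G = ty a"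
  shows "F = G"
  using assms by (intro epi_cancel[of F "snd (snd a)" G])
    (auto simp: cover_def elt_def raw_def in_Hom app_def ty_def split: prod.splits)

lemma dj_commute: "dj a b \<longleftrightarrow> dj b a"
  by (auto simp: dj_def)

section \<open>Modules and relative tensor products\<close>

lemma cmon_arr [simp]:
  assumes "commutative_monoid C A"
  shows "Car A \<in> Obj C" "Mul A \<in> Arr C" "Dom C (Mul A) = Car A \<otimes> Car A" "Cod C (Mul A) = Car A"
    "Unt A \<in> Arr C" "Dom C (Unt A) = Unit C" "Cod C (Unt A) = Car A"
  using assms by (auto simp: commutative_monoid_def in_Hom)

lemma Mul_assoc:
  assumes A: "commutative_monoid C A" and "elt a" "elt b" "elt c" "ty a = Car A" "ty b = Car A" "ty c = Car A"
    "dj a b" "dj a c" "dj b c"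
  shows "Mul A \<rhd> \<langle>Mul A \<rhd> \<langle>a, b\<rangle>, c\<rangle> = Mul A \<rhd> \<langle>a, Mul A \<rhd> \<langle>b, c\<rangle>\<rangle>"
proof -
  have "Mul A \<cdot> (Mul A \<odot> Id C (Car A)) = Mul A \<cdot> (Id C (Car A) \<odot> Mul A) \<cdot> Assoc C (Car A) (Car A) (Car A)"
    using A by (auto simp: commutative_monoid_def)
  from arg_cong[OF this, of "\<lambda>F. F \<rhd> \<langle>\<langle>a, b\<rangle>, c\<rangle>"] show ?thesis using assms by simp
qed

lemma Mul_commute:
  assumes A: "commutative_monoid C A" and "elt a" "elt b" "ty a = Car A" "ty b = Car A" "dj a b"
  shows "Mul A \<rhd> \<langle>a, b\<rangle> = Mul A \<rhd> \<langle>b, a\<rangle>"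
proof -
  have "Mul A \<cdot> Sym C (Car A) (Car A) = Mul A" using A by (auto simp: commutative_monoid_def)
  from arg_cong[OF this, of "\<lambda>F. F \<rhd> \<langle>b, a\<rangle>"] show ?thesis using assms by (simp add: dj_commute)
qed

lemma Mul_left_commute:
  assumes A: "commutative_monoid C A" and "elt a" "elt b" "elt c" "ty a = Car A" "ty b = Car A" "ty c = Car A"
    "dj a b" "dj a c" "dj b c"
  shows "Mul A \<rhd> \<langle>a, Mul A \<rhd> \<langle>b, c\<rangle>\<rangle> = Mul A \<rhd> \<langle>b, Mul A \<rhd> \<langle>a, c\<rangle>\<rangle>"
proof -
  have "Mul A \<rhd> \<langle>a, Mul A \<rhd> \<langle>b, c\<rangle>\<rangle> = Mul A \<rhd> \<langle>Mul A \<rhd> \<langle>a, b\<rangle>, c\<rangle>"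
    by (rule Mul_assoc[symmetric]) (use assms in auto)
  also have "\<dots> = Mul A \<rhd> \<langle>Mul A \<rhd> \<langle>b, a\<rangle>, c\<rangle>"
    using assms by (subst Mul_commute) auto
  also have "\<dots> = Mul A \<rhd> \<langle>b, Mul A \<rhd> \<langle>a, c\<rangle>\<rangle>"
    by (rule Mul_assoc) (use assms in \<open>auto simp: dj_commute\<close>)
  finally show ?thesis .
qed

lemma Mul_Unt [simp]:
  assumes A: "commutative_monoid C A" and "elt a" "ty a = Car A"
  shows "Mul A \<rhd> \<langle>Unt A \<rhd> star, a\<rangle> = a" "Mul A \<rhd> \<langle>a, Unt A \<rhd> star\<rangle> = a"
proof -
  have "Mul A \<cdot> (Unt A \<odot> Id C (Car A)) = LUnit C (Car A)" "Mul A \<cdot> (Id C (Car A) \<odot> Unt A) = RUnit C (Car A)"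
    using A by (auto simp: commutative_monoid_def)
  from arg_cong[OF this(1), of "\<lambda>F. F \<rhd> \<langle>star, a\<rangle>"] arg_cong[OF this(2), of "\<lambda>F. F \<rhd> \<langle>a, star\<rangle>"]
  show "Mul A \<rhd> \<langle>Unt A \<rhd> star, a\<rangle> = a" "Mul A \<rhd> \<langle>a, Unt A \<rhd> star\<rangle> = a" using assms by simp_all
qed

lemma monoid_hom_arr:
  assumes "monoid_hom C A B h"
  shows "h \<in> Arr C" "Dom C h = Car A" "Cod C h = Car B"
  using assms by (auto simp: monoid_hom_def in_Hom)

lemma monoid_hom_Mul:
  assumes A: "commutative_monoid C A" "commutative_monoid C B" and h: "monoid_hom C A B h"
    and "elt a" "elt b" "ty a = Car A" "ty b = Car A" "dj a b"
  shows "h \<rhd> Mul A \<rhd> \<langle>a, b\<rangle> = Mul B \<rhd> \<langle>h \<rhd> a, h \<rhd> b\<rangle>"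
proof -
  have "h \<cdot> Mul A = Mul B \<cdot> (h \<odot> h)" using h by (auto simp: monoid_hom_def)
  from arg_cong[OF this, of "\<lambda>F. F \<rhd> \<langle>a, b\<rangle>"] show ?thesis using assms monoid_hom_arr[OF h] by simp
qed

lemma monoid_hom_Unt:
  assumes A: "commutative_monoid C A" and h: "monoid_hom C A B h"
  shows "h \<rhd> Unt A \<rhd> star = Unt B \<rhd> star"
proof -
  have "h \<cdot> Unt A = Unt B" using h by (auto simp: monoid_hom_def)
  from arg_cong[OF this, of "\<lambda>F. F \<rhd> star"] show ?thesis using assms monoid_hom_arr[OF h] by simp
qed

lemma module_arr:
  assumes "is_module C A X"
  shows "fst X \<in> Obj C" "snd X \<in> Arr C" "Dom C (snd X) = Car A \<otimes> fst X" "Cod C (snd X) = fst X"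
  using assms by (auto simp: is_module_def in_Hom split: prod.splits)

lemma act_Mul:
  assumes A: "commutative_monoid C A" and X: "is_module C A X" and "elt a" "elt b" "elt m"
    "ty a = Car A" "ty b = Car A" "ty m = fst X" "dj a b" "dj a m" "dj b m"
  shows "snd X \<rhd> \<langle>Mul A \<rhd> \<langle>a, b\<rangle>, m\<rangle> = snd X \<rhd> \<langle>a, snd X \<rhd> \<langle>b, m\<rangle>\<rangle>"
proof -
  have "snd X \<cdot> (Mul A \<odot> Id C (fst X)) = snd X \<cdot> (Id C (Car A) \<odot> snd X) \<cdot> Assoc C (Car A) (Car A) (fst X)"
    using X by (auto simp: is_module_def split: prod.splits)
  from arg_cong[OF this, of "\<lambda>F. F \<rhd> \<langle>\<langle>a, b\<rangle>, m\<rangle>"] show ?thesis using assms module_arr[OF X] by simp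
qed

lemma act_commute:
  assumes A: "commutative_monoid C A" and X: "is_module C A X" and "elt a" "elt b" "elt m"
    "ty a = Car A" "ty b = Car A" "ty m = fst X" "dj a b" "dj a m" "dj b m"
  shows "snd X \<rhd> \<langle>a, snd X \<rhd> \<langle>b, m\<rangle>\<rangle> = snd X \<rhd> \<langle>b, snd X \<rhd> \<langle>a, m\<rangle>\<rangle>"
proof -
  have "snd X \<rhd> \<langle>a, snd X \<rhd> \<langle>b, m\<rangle>\<rangle> = snd X \<rhd> \<langle>Mul A \<rhd> \<langle>a, b\<rangle>, m\<rangle>"
    by (rule act_Mul[symmetric]) (use assms in auto)
  also have "\<dots> = snd X \<rhd> \<langle>Mul A \<rhd> \<langle>b, a\<rangle>, m\<rangle>"
    using assms by (subst Mul_commute) auto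
  also have "\<dots> = snd X \<rhd> \<langle>b, snd X \<rhd> \<langle>a, m\<rangle>\<rangle>"
    by (rule act_Mul) (use assms in \<open>auto simp: dj_commute\<close>)
  finally show ?thesis .
qed

lemma act_Unt:
  assumes A: "commutative_monoid C A" and X: "is_module C A X" and "elt m" "ty m = fst X"
  shows "snd X \<rhd> \<langle>Unt A \<rhd> star, m\<rangle> = m"
proof -
  have "snd X \<cdot> (Unt A \<odot> Id C (fst X)) = LUnit C (fst X)"
    using X by (auto simp: is_module_def split: prod.splits)
  from arg_cong[OF this, of "\<lambda>F. F \<rhd> \<langle>star, m\<rangle>"] show ?thesis using assms module_arr[OF X] by simp
qed

text \<open>One generic triple replaces a quantification over all elements. As \<open>m\<close> may
  be any cover, a module structure on a relative tensor product can be checked on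
  generators.\<close>

lemma is_moduleI:
  assumes A: "commutative_monoid C A" and "x \<in> Arr C" "Dom C x = Car A \<otimes> X" "Cod C x = X"
    and c: "cover a" "cover b" "cover m" "ty a = Car A" "ty b = Car A" "ty m = X" "dj a b" "dj a m" "dj b m"
    and "x \<rhd> \<langle>Mul A \<rhd> \<langle>a, b\<rangle>, m\<rangle> = x \<rhd> \<langle>a, x \<rhd> \<langle>b, m\<rangle>\<rangle>" and "x \<rhd> \<langle>Unt A \<rhd> star, m\<rangle> = m"
  shows "is_module C A (X, x)"
proof -
  have [simp]: "X \<in> Obj C" using assms Cod_Obj[of x] by simp
  have "x \<cdot> (Mul A \<odot> Id C X) = x \<cdot> (Id C (Car A) \<odot> x) \<cdot> Assoc C (Car A) (Car A) X"
    using assms by (intro cover_ext[of _ "\<langle>\<langle>a, b\<rangle>, m\<rangle>"]) auto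
  moreover have "x \<cdot> (Unt A \<odot> Id C X) = LUnit C X"
    using assms by (intro cover_ext[of _ "\<langle>star, m\<rangle>"]) auto
  ultimately show ?thesis using assms by (simp add: is_module_def in_Hom)
qed

lemma module_hom_arr:
  assumes "module_hom C A X Y f"
  shows "f \<in> Arr C" "Dom C f = fst X" "Cod C f = fst Y"
  using assms by (auto simp: module_hom_def in_Hom)

lemma module_hom_act:
  assumes A: "commutative_monoid C A" and X: "is_module C A X" and Y: "is_module C A Y" and f: "module_hom C A X Y f"
    and "elt a" "elt m" "ty a = Car A" "ty m = fst X" "dj a m"
  shows "f \<rhd> snd X \<rhd> \<langle>a, m\<rangle> = snd Y \<rhd> \<langle>a, f \<rhd> m\<rangle>"
proof -
  have "f \<cdot> snd X = snd Y \<cdot> (Id C (Car A) \<odot> f)" using f by (auto simp: module_hom_def)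
  from arg_cong[OF this, of "\<lambda>F. F \<rhd> \<langle>a, m\<rangle>"] show ?thesis
    using assms module_arr[OF X] module_arr[OF Y] module_hom_arr[OF f] by simp
qed

lemma module_homI:
  assumes A: "commutative_monoid C A" and X: "is_module C A X" and Y: "is_module C A Y"
    and "f \<in> Arr C" "Dom C f = fst X" "Cod C f = fst Y"
    and "cover a" "cover m" "ty a = Car A" "ty m = fst X" "dj a m"
    and "f \<rhd> snd X \<rhd> \<langle>a, m\<rangle> = snd Y \<rhd> \<langle>a, f \<rhd> m\<rangle>"
  shows "module_hom C A X Y f"
proof -
  have "f \<cdot> snd X = snd Y \<cdot> (Id C (Car A) \<odot> f)"
    using assms module_arr[OF X] module_arr[OF Y] by (intro cover_ext[of _ "\<langle>a, m\<rangle>"]) auto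
  then show ?thesis using assms by (simp add: module_hom_def in_Hom)
qed

section \<open>Relative tensor products on generators\<close>

lemma rtens_coequalizer:
  assumes A: "commutative_monoid C A" and X: "is_module C A X" and Y: "is_module C A Y"
  shows "is_coequalizer C ((snd X \<cdot> Sym C (fst X) (Car A)) \<odot> Id C (fst Y))
    ((Id C (fst X) \<odot> snd Y) \<cdot> Assoc C (fst X) (Car A) (fst Y)) (rtens_obj C A X Y) (rtens_proj C A X Y)"
proof -
  have "\<exists>Q q. is_coequalizer C ((snd X \<cdot> Sym C (fst X) (Car A)) \<odot> Id C (fst Y))
    ((Id C (fst X) \<odot> snd Y) \<cdot> Assoc C (fst X) (Car A) (fst Y)) Q q"
    using A module_arr[OF X] module_arr[OF Y] by (intro ex_coequalizer) (simp_all add: in_Hom)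
  then have "\<exists>z. case z of (Q, q) \<Rightarrow> is_coequalizer C ((snd X \<cdot> Sym C (fst X) (Car A)) \<odot> Id C (fst Y))
    ((Id C (fst X) \<odot> snd Y) \<cdot> Assoc C (fst X) (Car A) (fst Y)) Q q"
    by (simp only: split_paired_Ex prod.case)
  from someI_ex[OF this] have "case rtens C A X Y of (Q, q) \<Rightarrow>
      is_coequalizer C ((snd X \<cdot> Sym C (fst X) (Car A)) \<odot> Id C (fst Y))
        ((Id C (fst X) \<odot> snd Y) \<cdot> Assoc C (fst X) (Car A) (fst Y)) Q q"
    by (simp only: rtens_def)
  then show ?thesis by (simp only: case_prod_beta)
qed

lemma rtens_arr:
  assumes "commutative_monoid C A" "is_module C A X" "is_module C A Y"
  shows "rtens_proj C A X Y \<in> Arr C" "Dom C (rtens_proj C A X Y) = fst X \<otimes> fst Y"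
    "Cod C (rtens_proj C A X Y) = rtens_obj C A X Y" "rtens_obj C A X Y \<in> Obj C" "epi (rtens_proj C A X Y)"
proof -
  show *: "rtens_proj C A X Y \<in> Arr C" "Dom C (rtens_proj C A X Y) = fst X \<otimes> fst Y"
    "Cod C (rtens_proj C A X Y) = rtens_obj C A X Y"
    using rtens_coequalizer[OF assms] module_arr[OF assms(2)] module_arr[OF assms(3)] assms(1)
    by (auto simp: is_coequalizer_def in_Hom)
  show "rtens_obj C A X Y \<in> Obj C" using Cod_Obj[OF *(1)] *(3) by simp
  show "epi (rtens_proj C A X Y)" by (rule coequalizer_epi[OF rtens_coequalizer[OF assms]])
qed

lemma rtens_balance:
  assumes A: "commutative_monoid C A" and X: "is_module C A X" and Y: "is_module C A Y"
    and "elt a" "elt m" "elt n" "ty a = Car A" "ty m = fst X" "ty n = fst Y" "dj a m" "dj a n" "dj m n"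
  shows "rtens_proj C A X Y \<rhd> \<langle>snd X \<rhd> \<langle>a, m\<rangle>, n\<rangle> = rtens_proj C A X Y \<rhd> \<langle>m, snd Y \<rhd> \<langle>a, n\<rangle>\<rangle>"
proof -
  have "rtens_proj C A X Y \<cdot> ((snd X \<cdot> Sym C (fst X) (Car A)) \<odot> Id C (fst Y)) =
    rtens_proj C A X Y \<cdot> ((Id C (fst X) \<odot> snd Y) \<cdot> Assoc C (fst X) (Car A) (fst Y))"
    using rtens_coequalizer[OF A X Y] by (simp add: is_coequalizer_def)
  from arg_cong[OF this, of "\<lambda>F. F \<rhd> \<langle>\<langle>m, a\<rangle>, n\<rangle>"] show ?thesis
    using assms module_arr[OF X] module_arr[OF Y] rtens_arr[OF A X Y] by (simp add: dj_commute)
qed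

text \<open>The coequalizer remains one after tensoring with the spectator \<open>K\<close>, by
  \<open>coequalizer_tens\<close>, and its condition is tested on generic elements.\<close>

lemma rtens_induced_right:
  assumes A: "commutative_monoid C A" and X: "is_module C A X" and Y: "is_module C A Y"
    and K: "K \<in> Obj C" and k: "k \<in> Arr C" "Dom C k = (fst X \<otimes> fst Y) \<otimes> K"
    and c: "cover a" "cover m" "cover n" "cover b" "ty a = Car A" "ty m = fst X" "ty n = fst Y" "ty b = K"
      "dj a m" "dj a n" "dj m n" "dj a b" "dj m b" "dj n b"
    and eq: "k \<rhd> \<langle>\<langle>snd X \<rhd> \<langle>a, m\<rangle>, n\<rangle>, b\<rangle> = k \<rhd> \<langle>\<langle>m, snd Y \<rhd> \<langle>a, n\<rangle>\<rangle>, b\<rangle>"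
  shows "\<exists>h. h \<in> Hom C (rtens_obj C A X Y \<otimes> K) (Cod C k) \<and> h \<cdot> (rtens_proj C A X Y \<odot> Id C K) = k"
proof -
  note [simp] = module_arr[OF X] module_arr[OF Y] rtens_arr[OF A X Y] assms(1,4)
  let ?u = "(snd X \<cdot> Sym C (fst X) (Car A)) \<odot> Id C (fst Y)"
  let ?v = "(Id C (fst X) \<odot> snd Y) \<cdot> Assoc C (fst X) (Car A) (fst Y)"
  have "k \<cdot> (?u \<odot> Id C K) = k \<cdot> (?v \<odot> Id C K)"
    using k c eq by (intro cover_ext[of _ "\<langle>\<langle>\<langle>m, a\<rangle>, n\<rangle>, b\<rangle>"]) (simp_all add: dj_commute)
  then show ?thesis
    using k by (intro coequalizer_induced[OF coequalizer_tens[OF rtens_coequalizer[OF A X Y] K]]) simp_all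
qed

lemma rtens_induced_left:
  assumes A: "commutative_monoid C A" and X: "is_module C A X" and Y: "is_module C A Y"
    and K: "K \<in> Obj C" and k: "k \<in> Arr C" "Dom C k = K \<otimes> (fst X \<otimes> fst Y)"
    and c: "cover a" "cover m" "cover n" "cover b" "ty a = Car A" "ty m = fst X" "ty n = fst Y" "ty b = K"
      "dj a m" "dj a n" "dj m n" "dj a b" "dj m b" "dj n b"
    and eq: "k \<rhd> \<langle>b, \<langle>snd X \<rhd> \<langle>a, m\<rangle>, n\<rangle>\<rangle> = k \<rhd> \<langle>b, \<langle>m, snd Y \<rhd> \<langle>a, n\<rangle>\<rangle>\<rangle>"
  shows "\<exists>h. h \<in> Hom C (K \<otimes> rtens_obj C A X Y) (Cod C k) \<and> h \<cdot> (Id C K \<odot> rtens_proj C A X Y) = k"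
proof -
  note [simp] = module_arr[OF X] module_arr[OF Y] rtens_arr[OF A X Y] assms(1,4)
  let ?q = "rtens_proj C A X Y" and ?XY = "fst X \<otimes> fst Y"
  have "\<exists>h. h \<in> Hom C (rtens_obj C A X Y \<otimes> K) (Cod C (k \<cdot> Sym C ?XY K)) \<and> h \<cdot> (?q \<odot> Id C K) = k \<cdot> Sym C ?XY K"
    using k c eq by (intro rtens_induced_right[OF A X Y K, of _ a m n b]) (simp_all add: dj_commute)
  then obtain h where h: "h \<in> Hom C (rtens_obj C A X Y \<otimes> K) (Cod C k)" "h \<cdot> (?q \<odot> Id C K) = k \<cdot> Sym C ?XY K"
    using k by auto
  have [simp]: "h \<in> Arr C" "Dom C h = rtens_obj C A X Y \<otimes> K" "Cod C h = Cod C k" using h(1) by (auto simp: in_Hom)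
  have "(h \<cdot> Sym C K (rtens_obj C A X Y)) \<cdot> (Id C K \<odot> ?q) = h \<cdot> (?q \<odot> Id C K) \<cdot> Sym C K ?XY"
    by (simp add: Sym_natural)
  also have "\<dots> = (h \<cdot> (?q \<odot> Id C K)) \<cdot> Sym C K ?XY" by simp
  also have "\<dots> = k" unfolding h(2) using k by simp
  finally show ?thesis by (intro exI[of _ "h \<cdot> Sym C K (rtens_obj C A X Y)"]) (simp add: in_Hom)
qed

lemma rtens_induced:
  assumes A: "commutative_monoid C A" and X: "is_module C A X" and Y: "is_module C A Y"
    and k: "k \<in> Arr C" "Dom C k = fst X \<otimes> fst Y"
    and c: "cover a" "cover m" "cover n" "ty a = Car A" "ty m = fst X" "ty n = fst Y"
      "dj a m" "dj a n" "dj m n"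
    and eq: "k \<rhd> \<langle>snd X \<rhd> \<langle>a, m\<rangle>, n\<rangle> = k \<rhd> \<langle>m, snd Y \<rhd> \<langle>a, n\<rangle>\<rangle>"
  shows "\<exists>h. h \<in> Hom C (rtens_obj C A X Y) (Cod C k) \<and> h \<cdot> rtens_proj C A X Y = k"
proof -
  note [simp] = module_arr[OF X] module_arr[OF Y] assms(1)
  let ?u = "(snd X \<cdot> Sym C (fst X) (Car A)) \<odot> Id C (fst Y)"
  let ?v = "(Id C (fst X) \<odot> snd Y) \<cdot> Assoc C (fst X) (Car A) (fst Y)"
  have "k \<cdot> ?u = k \<cdot> ?v"
    using k c eq by (intro cover_ext[of _ "\<langle>\<langle>m, a\<rangle>, n\<rangle>"]) (simp_all add: dj_commute)
  then show ?thesis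
    using k by (intro coequalizer_induced[OF rtens_coequalizer[OF A X Y]]) simp_all
qed

text \<open>Justifies the \<open>THE\<close> in \<open>rtens_map\<close>: linearity of both arrows
  gives balance and hence existence, and the projection being epi gives uniqueness.\<close>

lemma rtens_map_unique:
  assumes A: "commutative_monoid C A" and X: "is_module C A X" and Y: "is_module C A Y"
    and X': "is_module C A X'" and Y': "is_module C A Y'"
    and f: "module_hom C A X X' f" and g: "module_hom C A Y Y' g"
  shows "rtens_map C A (X, X', f) (Y, Y', g) \<in> Hom C (rtens_obj C A X Y) (rtens_obj C A X' Y') \<and>
    rtens_map C A (X, X', f) (Y, Y', g) \<cdot> rtens_proj C A X Y = rtens_proj C A X' Y' \<cdot> (f \<odot> g)"
proof -
  note [simp] = module_arr[OF X] module_arr[OF Y] rtens_arr[OF A X Y] module_arr[OF X'] module_arr[OF Y']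
    rtens_arr[OF A X' Y'] module_hom_arr[OF f] module_hom_arr[OF g] A
    module_hom_act[OF A X X' f] module_hom_act[OF A Y Y' g]
  let ?q = "rtens_proj C A X Y" and ?q' = "rtens_proj C A X' Y'"
  have "\<exists>h. h \<in> Hom C (rtens_obj C A X Y) (Cod C (?q' \<cdot> (f \<odot> g))) \<and> h \<cdot> ?q = ?q' \<cdot> (f \<odot> g)"
    \<comment> \<open>The numbers are arbitrary labels; being different, they make the variables
      disjoint.\<close>
    by (rule rtens_induced[OF A X Y, of _ "var 0 (Car A)" "var 1 (fst X)" "var 2 (fst Y)"])
      (simp_all add: rtens_balance[OF A X' Y'])
  then have "\<exists>h. h \<in> Hom C (rtens_obj C A X Y) (rtens_obj C A X' Y') \<and> h \<cdot> ?q = ?q' \<cdot> (f \<odot> g)" by simp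
  then have "\<exists>!h. h \<in> Hom C (rtens_obj C A X Y) (rtens_obj C A X' Y') \<and> h \<cdot> ?q = ?q' \<cdot> (f \<odot> g)"
    by (rule ex_ex1I) (rule epi_cancel[of _ ?q], simp_all add: in_Hom)
  from theI'[OF this] show ?thesis by (simp only: rtens_map_def prod.case)
qed

lemma rtens_map_arr:
  assumes "commutative_monoid C A" "is_module C A X" "is_module C A Y" "is_module C A X'" "is_module C A Y'"
    "module_hom C A X X' f" "module_hom C A Y Y' g"
  shows "rtens_map C A (X, X', f) (Y, Y', g) \<in> Arr C"
    "Dom C (rtens_map C A (X, X', f) (Y, Y', g)) = rtens_obj C A X Y"
    "Cod C (rtens_map C A (X, X', f) (Y, Y', g)) = rtens_obj C A X' Y'"
  using rtens_map_unique[OF assms] by (auto simp: in_Hom)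

lemma rtens_map_app:
  assumes "commutative_monoid C A" "is_module C A X" "is_module C A Y" "is_module C A X'" "is_module C A Y'"
    "module_hom C A X X' f" "module_hom C A Y Y' g"
    and "elt m" "elt n" "ty m = fst X" "ty n = fst Y" "dj m n"
  shows "rtens_map C A (X, X', f) (Y, Y', g) \<rhd> rtens_proj C A X Y \<rhd> \<langle>m, n\<rangle> = rtens_proj C A X' Y' \<rhd> \<langle>f \<rhd> m, g \<rhd> n\<rangle>"
proof -
  have "rtens_map C A (X, X', f) (Y, Y', g) \<cdot> rtens_proj C A X Y = rtens_proj C A X' Y' \<cdot> (f \<odot> g)"
    using rtens_map_unique[OF assms(1-7)] by simp
  from arg_cong[OF this, of "\<lambda>F. F \<rhd> \<langle>m, n\<rangle>"] show ?thesis
    using assms rtens_map_arr[OF assms(1-7)] rtens_arr[OF assms(1-3)] rtens_arr[OF assms(1,4,5)]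
      module_hom_arr[OF assms(6)] module_hom_arr[OF assms(7)] by simp
qed

text \<open>Says that \<open>k\<close> commutes with the action of \<open>A\<close>, which is
  exactly what lets it descend to the coequalizer as a map of \<open>K\<close>. Module laws for the
  result are checked separately.\<close>

definition linear_action :: "('o, 'm) mon \<Rightarrow> 'o \<times> 'm \<Rightarrow> 'o \<Rightarrow> 'm \<Rightarrow> bool" where
  "linear_action A X K k \<longleftrightarrow> K \<in> Obj C \<and> k \<in> Arr C \<and> Dom C k = K \<otimes> fst X \<and> Cod C k = fst X \<and>
     (\<forall>a b m. elt a \<and> elt b \<and> elt m \<and> ty a = Car A \<and> ty b = K \<and> ty m = fst X \<and> dj a b \<and> dj a m \<and> dj b m \<longrightarrow>
        k \<rhd> \<langle>b, snd X \<rhd> \<langle>a, m\<rangle>\<rangle> = snd X \<rhd> \<langle>a, k \<rhd> \<langle>b, m\<rangle>\<rangle>)"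

lemma rtens_act_unique:
  assumes A: "commutative_monoid C A" and X: "is_module C A X" and Y: "is_module C A Y"
    and lin: "linear_action A X K k"
  shows "rtens_act C A K k X Y \<in> Hom C (K \<otimes> rtens_obj C A X Y) (rtens_obj C A X Y) \<and>
    rtens_act C A K k X Y \<cdot> (Id C K \<odot> rtens_proj C A X Y) =
      rtens_proj C A X Y \<cdot> (k \<odot> Id C (fst Y)) \<cdot> Inv C (Assoc C K (fst X) (fst Y))"
proof -
  note [simp] = module_arr[OF X] module_arr[OF Y] rtens_arr[OF A X Y] A
  have K [simp]: "K \<in> Obj C" "k \<in> Arr C" "Dom C k = K \<otimes> fst X" "Cod C k = fst X"
    using lin by (auto simp: linear_action_def)
  have lin': "k \<rhd> \<langle>b, snd X \<rhd> \<langle>a, m\<rangle>\<rangle> = snd X \<rhd> \<langle>a, k \<rhd> \<langle>b, m\<rangle>\<rangle>"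
    if "elt a" "elt b" "elt m" "ty a = Car A" "ty b = K" "ty m = fst X" "dj a b" "dj a m" "dj b m" for a b m
    using lin that unfolding linear_action_def by blast
  let ?q = "rtens_proj C A X Y" and ?T = "rtens_obj C A X Y"
  let ?k = "?q \<cdot> (k \<odot> Id C (fst Y)) \<cdot> Inv C (Assoc C K (fst X) (fst Y))"
  have "\<exists>h. h \<in> Hom C (K \<otimes> ?T) (Cod C ?k) \<and> h \<cdot> (Id C K \<odot> ?q) = ?k"
    by (rule rtens_induced_left[OF A X Y K(1), of _ "var 0 (Car A)" "var 1 (fst X)" "var 2 (fst Y)" "var 3 K"])
      (simp_all add: lin' rtens_balance[OF A X Y])
  then have "\<exists>h. h \<in> Hom C (K \<otimes> ?T) ?T \<and> h \<cdot> (Id C K \<odot> ?q) = ?k" by simp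
  moreover have "epi (Id C K \<odot> ?q)" by (intro epi_tens iso_epi[OF iso_Id]) simp_all
  ultimately have "\<exists>!h. h \<in> Hom C (K \<otimes> ?T) ?T \<and> h \<cdot> (Id C K \<odot> ?q) = ?k"
    by (intro ex_ex1I) (assumption, rule epi_cancel[of _ "Id C K \<odot> ?q"], simp_all add: in_Hom)
  from theI'[OF this] show ?thesis by (simp only: rtens_act_def)
qed

lemma rtens_act_arr:
  assumes "commutative_monoid C A" "is_module C A X" "is_module C A Y"
    and "linear_action A X K k"
  shows "rtens_act C A K k X Y \<in> Arr C" "Dom C (rtens_act C A K k X Y) = K \<otimes> rtens_obj C A X Y"
    "Cod C (rtens_act C A K k X Y) = rtens_obj C A X Y"
  using rtens_act_unique[OF assms, THEN conjunct1] by (simp_all add: in_Hom)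

lemma rtens_act_app:
  assumes A: "commutative_monoid C A" and X: "is_module C A X" and Y: "is_module C A Y"
    and lin: "linear_action A X K k"
    and e: "elt b" "elt m" "elt n" "ty b = K" "ty m = fst X" "ty n = fst Y" "dj b m" "dj b n" "dj m n"
  shows "rtens_act C A K k X Y \<rhd> \<langle>b, rtens_proj C A X Y \<rhd> \<langle>m, n\<rangle>\<rangle> = rtens_proj C A X Y \<rhd> \<langle>k \<rhd> \<langle>b, m\<rangle>, n\<rangle>"
proof -
  note u = rtens_act_unique[OF A X Y lin] and [simp] = rtens_act_arr[OF A X Y lin]
  have K: "K \<in> Obj C" "k \<in> Arr C" "Dom C k = K \<otimes> fst X" "Cod C k = fst X"
    using lin by (auto simp: linear_action_def)
  have "rtens_act C A K k X Y \<cdot> (Id C K \<odot> rtens_proj C A X Y) =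
      rtens_proj C A X Y \<cdot> (k \<odot> Id C (fst Y)) \<cdot> Inv C (Assoc C K (fst X) (fst Y))"
    by (rule u[THEN conjunct2])
  from arg_cong[OF this, of "\<lambda>F. F \<rhd> \<langle>b, \<langle>m, n\<rangle>\<rangle>"] show ?thesis
    using A K e module_arr[OF X] module_arr[OF Y] rtens_arr[OF A X Y] by simp
qed

lemma restr_mod_simps:
  assumes A: "commutative_monoid C A" "commutative_monoid C B" and h: "monoid_hom C A B h" and X: "is_module C B X"
  shows "fst (restr_mod C h X) = fst X"
    "\<lbrakk>elt a; elt m; ty a = Car A; ty m = fst X; dj a m\<rbrakk> \<Longrightarrow>
      snd (restr_mod C h X) \<rhd> \<langle>a, m\<rangle> = snd X \<rhd> \<langle>h \<rhd> a, m\<rangle>"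
  using A module_arr[OF X] monoid_hom_arr[OF h] by (simp_all add: restr_mod_def)

lemma restr_module:
  assumes A: "commutative_monoid C A" and B: "commutative_monoid C B" and h: "monoid_hom C A B h" and X: "is_module C B X"
  shows "is_module C A (restr_mod C h X)"
  unfolding restr_mod_def
  by (rule is_moduleI[OF A, of _ _ "var 0 (Car A)" "var 1 (Car A)" "var 2 (fst X)"])
    (use A B module_arr[OF X] monoid_hom_arr[OF h] in
      \<open>simp_all add: monoid_hom_Mul[OF A B h] monoid_hom_Unt[OF A h] act_Mul[OF B X] act_Unt[OF B X]\<close>)

lemma self_module:
  assumes A: "commutative_monoid C A"
  shows "is_module C A (Car A, Mul A)"
  by (rule is_moduleI[OF A, of _ _ "var 0 (Car A)" "var 1 (Car A)" "var 2 (Car A)"])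
    (use A in \<open>simp_all add: Mul_assoc[OF A]\<close>)

lemma alg_module:
  "\<lbrakk>commutative_monoid C A; commutative_monoid C B; monoid_hom C A B h\<rbrakk> \<Longrightarrow> is_module C A (alg_mod C B h)"
  unfolding alg_mod_def by (rule restr_module[OF _ _ _ self_module])

lemma alg_mod_simps:
  assumes A: "commutative_monoid C A" "commutative_monoid C B" and h: "monoid_hom C A B h"
  shows "fst (alg_mod C B h) = Car B"
    "\<lbrakk>elt a; elt b; ty a = Car A; ty b = Car B; dj a b\<rbrakk> \<Longrightarrow>
      snd (alg_mod C B h) \<rhd> \<langle>a, b\<rangle> = Mul B \<rhd> \<langle>h \<rhd> a, b\<rangle>"
  using restr_mod_simps[OF A h self_module[OF A(2)]] by (simp_all add: alg_mod_def)

section \<open>Restriction and extension of scalars\<close>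

lemma in_Hom_Mod:
  "\<phi> \<in> Hom (Mod C A) X Y \<longleftrightarrow>
    is_module C A X \<and> is_module C A Y \<and> module_hom C A X Y (snd (snd \<phi>)) \<and> \<phi> = (X, Y, snd (snd \<phi>))"
  by (cases \<phi>) (auto simp: Hom_def Mod_def)

lemma Mod_simps:
  "X \<in> Obj (Mod C A) \<longleftrightarrow> is_module C A X" "Id (Mod C A) X = (X, X, Id C (fst X))"
  "\<phi> \<in> Arr (Mod C A) \<longleftrightarrow> \<phi> \<in> Hom (Mod C A) (Dom (Mod C A) \<phi>) (Cod (Mod C A) \<phi>)"
  "Dom (Mod C A) \<phi> = fst \<phi>" "Cod (Mod C A) \<phi> = fst (snd \<phi>)"
  "(Y', Z, g) \<cdot>\<^bsub>Mod C A\<^esub> (X, Y, f) = (X, Z, g \<cdot> f)"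
  by (auto simp: Mod_def Hom_def split: prod.splits)

lemma module_hom_Id:
  "\<lbrakk>commutative_monoid C A; is_module C A X\<rbrakk> \<Longrightarrow> module_hom C A X X (Id C (fst X))"
  using module_arr[of A X] by (simp add: module_hom_def in_Hom)

lemma module_hom_comp:
  assumes A: "commutative_monoid C A" and X: "is_module C A X" and Y: "is_module C A Y" and Z: "is_module C A Z"
    and f: "module_hom C A X Y f" and g: "module_hom C A Y Z g"
  shows "module_hom C A X Z (g \<cdot> f)"
  by (rule module_homI[OF A X Z, of _ "var 0 (Car A)" "var 1 (fst X)"])
    (use A module_arr[OF X] module_arr[OF Y] module_arr[OF Z] module_hom_arr[OF f] module_hom_arr[OF g] in
      \<open>simp_all add: module_hom_act[OF A X Y f] module_hom_act[OF A Y Z g]\<close>)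

lemma category_Mod:
  assumes A: "commutative_monoid C A"
  shows "category (Mod C A)"
proof
  show "\<phi> \<in> Arr (Mod C A) \<Longrightarrow> Dom (Mod C A) \<phi> \<in> Obj (Mod C A)" for \<phi>
    by (simp add: Mod_simps in_Hom_Mod)
  show "\<phi> \<in> Arr (Mod C A) \<Longrightarrow> Cod (Mod C A) \<phi> \<in> Obj (Mod C A)" for \<phi>
    by (simp add: Mod_simps in_Hom_Mod)
  show "X \<in> Obj (Mod C A) \<Longrightarrow> Id (Mod C A) X \<in> Hom (Mod C A) X X" for X
    by (simp add: Mod_simps in_Hom_Mod module_hom_Id[OF A])
  show "\<lbrakk>f \<in> Hom (Mod C A) X Y; g \<in> Hom (Mod C A) Y Z\<rbrakk> \<Longrightarrow> g \<cdot>\<^bsub>Mod C A\<^esub> f \<in> Hom (Mod C A) X Z" for f g X Y Z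
    by (cases f, cases g) (auto simp: Mod_simps in_Hom_Mod intro: module_hom_comp[OF A])
  show "f \<in> Hom (Mod C A) X Y \<Longrightarrow> Id (Mod C A) Y \<cdot>\<^bsub>Mod C A\<^esub> f = f" for f X Y
    by (cases f) (auto simp: Mod_simps in_Hom_Mod module_hom_arr)
  show "f \<in> Hom (Mod C A) X Y \<Longrightarrow> f \<cdot>\<^bsub>Mod C A\<^esub> Id (Mod C A) X = f" for f X Y
    by (cases f) (auto simp: Mod_simps in_Hom_Mod module_hom_arr)
  show "\<lbrakk>f \<in> Hom (Mod C A) W X; g \<in> Hom (Mod C A) X Y; h \<in> Hom (Mod C A) Y Z\<rbrakk> \<Longrightarrow>
      (h \<cdot>\<^bsub>Mod C A\<^esub> g) \<cdot>\<^bsub>Mod C A\<^esub> f = h \<cdot>\<^bsub>Mod C A\<^esub> g \<cdot>\<^bsub>Mod C A\<^esub> f" for f g h W X Y Z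
    by (cases f, cases g, cases h) (auto simp: Mod_simps in_Hom_Mod module_hom_arr)
qed

lemma Mod_functorI:
  assumes A: "commutative_monoid C A" and B: "commutative_monoid C B"
    and FO: "\<And>X. is_module C A X \<Longrightarrow> is_module C B (FO F X)"
    and FA: "\<And>X Y f. FA F (X, Y, f) = (FO F X, FO F Y, \<Phi> X Y f)"
    and hom: "\<And>X Y f. \<lbrakk>is_module C A X; is_module C A Y; module_hom C A X Y f\<rbrakk> \<Longrightarrow>
      module_hom C B (FO F X) (FO F Y) (\<Phi> X Y f)"
    and Id: "\<And>X. is_module C A X \<Longrightarrow> \<Phi> X X (Id C (fst X)) = Id C (fst (FO F X))"
    and comp: "\<And>X Y Z f g. \<lbrakk>is_module C A X; is_module C A Y; is_module C A Z; module_hom C A X Y f; module_hom C A Y Z g\<rbrakk> \<Longrightarrow>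
      \<Phi> X Z (g \<cdot> f) = \<Phi> Y Z g \<cdot> \<Phi> X Y f"
  shows "is_functor (Mod C A) (Mod C B) F"
  unfolding is_functor_def
proof (intro conjI ballI allI)
  show "FA F f \<in> Hom (Mod C B) (FO F X) (FO F Y)" if "f \<in> Hom (Mod C A) X Y" for f X Y
    using that by (cases f) (auto simp: in_Hom_Mod FO FA hom)
  show "FA F (Id (Mod C A) X) = Id (Mod C B) (FO F X)" if "X \<in> Obj (Mod C A)" for X
    using that by (simp add: Mod_simps FA Id)
  show "FA F (g \<cdot>\<^bsub>Mod C A\<^esub> f) = FA F g \<cdot>\<^bsub>Mod C B\<^esub> FA F f"
    if "f \<in> Hom (Mod C A) X Y" "g \<in> Hom (Mod C A) Y Z" for f g X Y Z
    using that by (cases f, cases g) (auto simp: in_Hom_Mod Mod_simps FA comp)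
qed (use category_Mod[OF A] category_Mod[OF B] in \<open>auto simp: Mod_simps FO\<close>)

lemma restr_module_hom:
  assumes A: "commutative_monoid C A" and B: "commutative_monoid C B" and h: "monoid_hom C A B h"
    and X: "is_module C B X" and Y: "is_module C B Y" and f: "module_hom C B X Y f"
  shows "module_hom C A (restr_mod C h X) (restr_mod C h Y) f"
  by (rule module_homI[OF A restr_module[OF A B h X] restr_module[OF A B h Y], of _ "var 0 (Car A)" "var 1 (fst X)"])
    (use A B module_arr[OF X] module_arr[OF Y] module_hom_arr[OF f] monoid_hom_arr[OF h] in
      \<open>simp_all add: module_hom_act[OF B X Y f] restr_mod_simps[OF A B h X] restr_mod_simps[OF A B h Y]\<close>)

lemma restr_functor:
  assumes A: "commutative_monoid C A" and B: "commutative_monoid C B" and h: "monoid_hom C A B h"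
  shows "is_functor (Mod C B) (Mod C A) (restr C h)"
  by (rule Mod_functorI[OF B A, where \<Phi> = "\<lambda>X Y f. f"])
    (auto simp: restr_def restr_module[OF A B h] restr_module_hom[OF A B h], auto simp: restr_mod_def)

text \<open>Commutativity of B: multiplying by an element of B commutes with multiplying by the
  image of an element of A.\<close>

lemma linear_action_alg:
  assumes A: "commutative_monoid C A" and B: "commutative_monoid C B" and h: "monoid_hom C A B h"
  shows "linear_action A (alg_mod C B h) (Car B) (Mul B)"
  using A B monoid_hom_arr[OF h]
  by (simp add: linear_action_def alg_mod_simps[OF A B h] dj_commute Mul_left_commute[OF B] del: split_paired_All)

lemma ext_mod_simps:
  assumes A: "commutative_monoid C A" and B: "commutative_monoid C B" and h: "monoid_hom C A B h"
    and X: "is_module C A X"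
  shows "fst (ext_mod C A B h X) = rtens_obj C A (alg_mod C B h) X"
    "snd (ext_mod C A B h X) \<in> Arr C"
    "Dom C (snd (ext_mod C A B h X)) = Car B \<otimes> rtens_obj C A (alg_mod C B h) X"
    "Cod C (snd (ext_mod C A B h X)) = rtens_obj C A (alg_mod C B h) X"
    "\<lbrakk>elt b; elt c; elt m; ty b = Car B; ty c = Car B; ty m = fst X; dj b c; dj b m; dj c m\<rbrakk> \<Longrightarrow>
      snd (ext_mod C A B h X) \<rhd> \<langle>b, rtens_proj C A (alg_mod C B h) X \<rhd> \<langle>c, m\<rangle>\<rangle> =
      rtens_proj C A (alg_mod C B h) X \<rhd> \<langle>Mul B \<rhd> \<langle>b, c\<rangle>, m\<rangle>"
  using rtens_act_arr[OF A alg_module[OF A B h] X linear_action_alg[OF A B h]]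
    rtens_act_app[OF A alg_module[OF A B h] X linear_action_alg[OF A B h]]
  by (simp_all add: ext_mod_def alg_mod_simps[OF A B h])

lemma ext_module:
  assumes A: "commutative_monoid C A" and B: "commutative_monoid C B" and h: "monoid_hom C A B h"
    and X: "is_module C A X"
  shows "is_module C B (ext_mod C A B h X)"
proof -
  note [simp] = A B module_arr[OF X] rtens_arr[OF A alg_module[OF A B h] X] alg_mod_simps[OF A B h]
    ext_mod_simps[OF A B h X]
  have "is_module C B (fst (ext_mod C A B h X), snd (ext_mod C A B h X))"
    by (rule is_moduleI[OF B, of _ _ "var 0 (Car B)" "var 1 (Car B)"
        "rtens_proj C A (alg_mod C B h) X \<rhd> \<langle>var 2 (Car B), var 3 (fst X)\<rangle>"])
      (simp_all add: Mul_assoc[OF B])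
  then show ?thesis by (simp only: prod.collapse)
qed

text \<open>Linearity and both functor laws are tested on generators b \<otimes> x, on which the
  induced map only changes x.\<close>

lemma ext_functor:
  assumes A: "commutative_monoid C A" and B: "commutative_monoid C B" and h: "monoid_hom C A B h"
  shows "is_functor (Mod C A) (Mod C B) (ext C A B h)"
proof (rule Mod_functorI[OF A B])
  let ?B = "alg_mod C B h"
  have Bm: "is_module C A ?B" by (rule alg_module[OF A B h])
  have IB: "module_hom C A ?B ?B (Id C (Car B))"
    using module_hom_Id[OF A Bm] by (simp add: alg_mod_simps[OF A B h])
  note [simp] = A B alg_mod_simps[OF A B h]
  note m = ext_module[OF A B h] rtens_arr[OF A Bm] ext_mod_simps[OF A B h]
  show "FA (ext C A B h) (X, Y, f) = (FO (ext C A B h) X, FO (ext C A B h) Y,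
      rtens_map C A (?B, ?B, Id C (Car B)) (X, Y, f))" for X Y f
    by (simp add: ext_def Mod_simps)
  show "is_module C A X \<Longrightarrow> is_module C B (FO (ext C A B h) X)" for X
    by (simp add: ext_def m)
  show "module_hom C B (FO (ext C A B h) X) (FO (ext C A B h) Y) (rtens_map C A (?B, ?B, Id C (Car B)) (X, Y, f))"
    if X: "is_module C A X" and Y: "is_module C A Y" and f: "module_hom C A X Y f" for X Y f
  proof -
    note [simp] = module_arr[OF X] module_arr[OF Y] module_hom_arr[OF f] rtens_arr[OF A Bm X] rtens_arr[OF A Bm Y]
      ext_mod_simps[OF A B h X] ext_mod_simps[OF A B h Y]
      rtens_map_arr[OF A Bm X Bm Y IB f] rtens_map_app[OF A Bm X Bm Y IB f]
    have "module_hom C B (ext_mod C A B h X) (ext_mod C A B h Y) (rtens_map C A (?B, ?B, Id C (Car B)) (X, Y, f))"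
      by (rule module_homI[OF B ext_module[OF A B h X] ext_module[OF A B h Y], of _ "var 0 (Car B)"
            "rtens_proj C A ?B X \<rhd> \<langle>var 1 (Car B), var 2 (fst X)\<rangle>"]) simp_all
    then show ?thesis by (simp add: ext_def)
  qed
  show "rtens_map C A (?B, ?B, Id C (Car B)) (X, X, Id C (fst X)) = Id C (fst (FO (ext C A B h) X))"
    if X: "is_module C A X" for X
  proof -
    note f = module_hom_Id[OF A X]
    note [simp] = module_arr[OF X] rtens_arr[OF A Bm X] ext_mod_simps[OF A B h X]
      rtens_map_arr[OF A Bm X Bm X IB f] rtens_map_app[OF A Bm X Bm X IB f]
    have "rtens_map C A (?B, ?B, Id C (Car B)) (X, X, Id C (fst X)) = Id C (rtens_obj C A ?B X)"
      by (rule cover_ext[of _ "rtens_proj C A ?B X \<rhd> \<langle>var 1 (Car B), var 2 (fst X)\<rangle>"]) simp_all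
    then show ?thesis by (simp add: ext_def)
  qed
  show "rtens_map C A (?B, ?B, Id C (Car B)) (X, Z, g \<cdot> f) =
      rtens_map C A (?B, ?B, Id C (Car B)) (Y, Z, g) \<cdot> rtens_map C A (?B, ?B, Id C (Car B)) (X, Y, f)"
    if X: "is_module C A X" and Y: "is_module C A Y" and Z: "is_module C A Z"
      and f: "module_hom C A X Y f" and g: "module_hom C A Y Z g" for X Y Z f g
  proof -
    note gf = module_hom_comp[OF A X Y Z f g]
    note [simp] = module_arr[OF X] module_arr[OF Y] module_arr[OF Z] module_hom_arr[OF f] module_hom_arr[OF g]
      rtens_arr[OF A Bm X] rtens_arr[OF A Bm Y] rtens_arr[OF A Bm Z]
      rtens_map_arr[OF A Bm X Bm Y IB f] rtens_map_app[OF A Bm X Bm Y IB f]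
      rtens_map_arr[OF A Bm Y Bm Z IB g] rtens_map_app[OF A Bm Y Bm Z IB g]
      rtens_map_arr[OF A Bm X Bm Z IB gf] rtens_map_app[OF A Bm X Bm Z IB gf]
    show ?thesis
      by (rule cover_ext[of _ "rtens_proj C A ?B X \<rhd> \<langle>var 1 (Car B), var 2 (fst X)\<rangle>"]) simp_all
  qed
qed

text \<open>Balance is a symmetric condition, so exchanging factors descends in both directions, and
  the two maps are inverse on generators.\<close>

lemma rtens_sym:
  assumes A: "commutative_monoid C A" and X: "is_module C A X" and Y: "is_module C A Y"
  obtains d where "is_iso C d" "d \<in> Arr C" "Dom C d = rtens_obj C A X Y" "Cod C d = rtens_obj C A Y X"
    "\<And>m n. \<lbrakk>elt m; elt n; ty m = fst X; ty n = fst Y; dj m n\<rbrakk> \<Longrightarrow>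
      d \<rhd> rtens_proj C A X Y \<rhd> \<langle>m, n\<rangle> = rtens_proj C A Y X \<rhd> \<langle>n, m\<rangle>"
proof -
  have ex: "\<exists>d. d \<in> Arr C \<and> Dom C d = rtens_obj C A X Y \<and> Cod C d = rtens_obj C A Y X \<and>
    d \<cdot> rtens_proj C A X Y = rtens_proj C A Y X \<cdot> Sym C (fst X) (fst Y)"
    if X: "is_module C A X" and Y: "is_module C A Y" for X Y
  proof -
    note [simp] = A module_arr[OF X] module_arr[OF Y] rtens_arr[OF A X Y] rtens_arr[OF A Y X]
    have "\<exists>h. h \<in> Hom C (rtens_obj C A X Y) (Cod C (rtens_proj C A Y X \<cdot> Sym C (fst X) (fst Y))) \<and>
      h \<cdot> rtens_proj C A X Y = rtens_proj C A Y X \<cdot> Sym C (fst X) (fst Y)"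
      by (rule rtens_induced[OF A X Y, of _ "var 0 (Car A)" "var 1 (fst X)" "var 2 (fst Y)"])
        (simp_all add: rtens_balance[OF A Y X])
    then show ?thesis by (auto simp: in_Hom)
  qed
  note [simp] = A module_arr[OF X] module_arr[OF Y] rtens_arr[OF A X Y] rtens_arr[OF A Y X]
  obtain d where d [simp]: "d \<in> Arr C" "Dom C d = rtens_obj C A X Y" "Cod C d = rtens_obj C A Y X"
    and dq: "d \<cdot> rtens_proj C A X Y = rtens_proj C A Y X \<cdot> Sym C (fst X) (fst Y)" using ex[OF X Y] by blast
  obtain e where e [simp]: "e \<in> Arr C" "Dom C e = rtens_obj C A Y X" "Cod C e = rtens_obj C A X Y"
    and eq: "e \<cdot> rtens_proj C A Y X = rtens_proj C A X Y \<cdot> Sym C (fst Y) (fst X)" using ex[OF Y X] by blast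
  have d': "d \<rhd> rtens_proj C A X Y \<rhd> \<langle>m, n\<rangle> = rtens_proj C A Y X \<rhd> \<langle>n, m\<rangle>"
    if "elt m" "elt n" "ty m = fst X" "ty n = fst Y" "dj m n" for m n
    using arg_cong[OF dq, of "\<lambda>F. F \<rhd> \<langle>m, n\<rangle>"] that by simp
  have e': "e \<rhd> rtens_proj C A Y X \<rhd> \<langle>n, m\<rangle> = rtens_proj C A X Y \<rhd> \<langle>m, n\<rangle>"
    if "elt m" "elt n" "ty m = fst X" "ty n = fst Y" "dj n m" for m n
    using arg_cong[OF eq, of "\<lambda>F. F \<rhd> \<langle>n, m\<rangle>"] that by simp
  have "e \<cdot> d = Id C (rtens_obj C A X Y)"
    by (rule cover_ext[of _ "rtens_proj C A X Y \<rhd> \<langle>var 0 (fst X), var 1 (fst Y)\<rangle>"]) (simp_all add: d' e')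
  moreover have "d \<cdot> e = Id C (rtens_obj C A Y X)"
    by (rule cover_ext[of _ "rtens_proj C A Y X \<rhd> \<langle>var 0 (fst Y), var 1 (fst X)\<rangle>"]) (simp_all add: d' e')
  ultimately have "is_iso C d" by (intro is_isoI[of d e]) simp_all
  then show ?thesis by (rule that[OF _ d]) (rule d')
qed

text \<open>The four-element formula reduces the iterated associators and the symmetry in
  \<open>interchange\<close> to an exchange of the two middle entries.\<close>

lemma interchange_simps:
  assumes "W \<in> Obj C" "X \<in> Obj C" "Y \<in> Obj C" "Z \<in> Obj C"
  shows "interchange C W X Y Z \<in> Arr C" "Dom C (interchange C W X Y Z) = (W \<otimes> X) \<otimes> (Y \<otimes> Z)"
    "Cod C (interchange C W X Y Z) = (W \<otimes> Y) \<otimes> (X \<otimes> Z)"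
    "\<lbrakk>elt a; elt b; elt c; elt d; ty a = W; ty b = X; ty c = Y; ty d = Z;
      dj a b; dj a c; dj a d; dj b c; dj b d; dj c d\<rbrakk> \<Longrightarrow>
      interchange C W X Y Z \<rhd> \<langle>\<langle>a, b\<rangle>, \<langle>c, d\<rangle>\<rangle> = \<langle>\<langle>a, c\<rangle>, \<langle>b, d\<rangle>\<rangle>"
  using assms by (simp_all add: interchange_def dj_commute)

section \<open>Base change along a square\<close>

text \<open>Justifies the \<open>THE\<close> in the multiplication of \<open>alg_tens\<close>. The
  map has to descend along two projections, which is done for one tensor factor at a time.\<close>

lemma alg_tens_Mul:
  assumes A: "commutative_monoid C A" and B: "commutative_monoid C B" and D: "commutative_monoid C D"
    and h: "monoid_hom C A B h" and k: "monoid_hom C A D k"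
  defines "q \<equiv> rtens_proj C A (alg_mod C B h) (alg_mod C D k)"
    and "T \<equiv> rtens_obj C A (alg_mod C B h) (alg_mod C D k)"
  shows "Mul (alg_tens C A B h D k) \<in> Hom C (T \<otimes> T) T \<and>
    Mul (alg_tens C A B h D k) \<cdot> (q \<odot> q) =
      q \<cdot> (Mul B \<odot> Mul D) \<cdot> interchange C (Car B) (Car D) (Car B) (Car D)"
proof -
  let ?X = "alg_mod C B h" and ?Y = "alg_mod C D k"
  have X: "is_module C A ?X" and Y: "is_module C A ?Y"
    by (rule alg_module[OF A B h], rule alg_module[OF A D k])
  have [simp]: "fst ?X = Car B" "fst ?Y = Car D"
    by (simp_all add: alg_mod_simps[OF A B h] alg_mod_simps[OF A D k])
  have q [simp]: "q \<in> Arr C" "Dom C q = Car B \<otimes> Car D" "Cod C q = T" "T \<in> Obj C" "epi q"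
    using rtens_arr[OF A X Y] by (simp_all add: q_def T_def)
  note act = alg_mod_simps(2)[OF A B h] alg_mod_simps(2)[OF A D k]
  have bal: "q \<rhd> \<langle>Mul B \<rhd> \<langle>h \<rhd> a, b\<rangle>, d\<rangle> = q \<rhd> \<langle>b, Mul D \<rhd> \<langle>k \<rhd> a, d\<rangle>\<rangle>"
    if "elt a" "elt b" "elt d" "ty a = Car A" "ty b = Car B" "ty d = Car D" "dj a b" "dj a d" "dj b d" for a b d
    using rtens_balance[OF A X Y, of a b d] that by (simp add: act q_def)
  note [simp] = A B D monoid_hom_arr[OF h] monoid_hom_arr[OF k] interchange_simps
  let ?k = "q \<cdot> (Mul B \<odot> Mul D) \<cdot> interchange C (Car B) (Car D) (Car B) (Car D)"
  \<comment> \<open>The left factor descends, with a pair from B and D as spectator.\<close>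
  have "\<exists>l. l \<in> Hom C (T \<otimes> (Car B \<otimes> Car D)) (Cod C ?k) \<and> l \<cdot> (q \<odot> Id C (Car B \<otimes> Car D)) = ?k"
    unfolding q_def T_def
    by (rule rtens_induced_right[OF A X Y, of _ _ "var 0 (Car A)" "var 1 (Car B)" "var 2 (Car D)" "\<langle>var 3 (Car B), var 4 (Car D)\<rangle>"])
      (simp_all add: act Mul_assoc[OF B] Mul_assoc[OF D] bal flip: q_def)
  then obtain l where l [simp]: "l \<in> Arr C" "Dom C l = T \<otimes> (Car B \<otimes> Car D)" "Cod C l = T"
    and lq: "l \<cdot> (q \<odot> Id C (Car B \<otimes> Car D)) = ?k" by (auto simp: in_Hom)
  have l': "l \<rhd> \<langle>q \<rhd> \<langle>a, b\<rangle>, \<langle>c, d\<rangle>\<rangle> = q \<rhd> \<langle>Mul B \<rhd> \<langle>a, c\<rangle>, Mul D \<rhd> \<langle>b, d\<rangle>\<rangle>"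
    if "elt a" "elt b" "elt c" "elt d" "ty a = Car B" "ty b = Car D" "ty c = Car B" "ty d = Car D"
      "dj a b" "dj a c" "dj a d" "dj b c" "dj b d" "dj c d" for a b c d
    using arg_cong[OF lq, of "\<lambda>F. F \<rhd> \<langle>\<langle>a, b\<rangle>, \<langle>c, d\<rangle>\<rangle>"] that by (simp add: dj_commute)
  \<comment> \<open>The right factor descends, now with a generator of T as spectator. Commutativity
    of B and D moves the scalar to the front, where balance applies.\<close>
  have "\<exists>m. m \<in> Hom C (T \<otimes> T) (Cod C l) \<and> m \<cdot> (Id C T \<odot> q) = l"
    unfolding q_def T_def
    by (rule rtens_induced_left[OF A X Y, of _ _ "var 0 (Car A)" "var 1 (Car B)" "var 2 (Car D)" "q \<rhd> \<langle>var 3 (Car B), var 4 (Car D)\<rangle>"])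
      (simp_all add: act l' Mul_left_commute[OF B, of _ "h \<rhd> _"] Mul_left_commute[OF D, of _ "k \<rhd> _"] bal
        flip: q_def T_def)
  then obtain m where m: "m \<in> Arr C" "Dom C m = T \<otimes> T" "Cod C m = T" and mq: "m \<cdot> (Id C T \<odot> q) = l"
    by (auto simp: in_Hom)
  have "m \<cdot> (q \<odot> q) = (m \<cdot> (Id C T \<odot> q)) \<cdot> (q \<odot> Id C (Car B \<otimes> Car D))" using m by simp
  also have "\<dots> = ?k" unfolding mq by (rule lq)
  finally have "m \<in> Hom C (T \<otimes> T) T \<and> m \<cdot> (q \<odot> q) = ?k" using m by (simp add: in_Hom)
  moreover have "m = m'" if "m' \<in> Hom C (T \<otimes> T) T \<and> m' \<cdot> (q \<odot> q) = ?k" for m'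
    by (rule epi_cancel[of _ "q \<odot> q"]) (use that calculation in \<open>simp_all add: epi_tens in_Hom\<close>)
  ultimately have "\<exists>!m. m \<in> Hom C (T \<otimes> T) T \<and> m \<cdot> (q \<odot> q) = ?k" by blast
  from theI'[OF this] show ?thesis
    by (simp only: alg_tens_def Let_def mon.simps q_def T_def)
qed

text \<open>On generators a comparison map is \<open>s \<otimes> r \<mapsto> \<theta> s \<cdot> g r\<close>, because
  \<open>s \<otimes> r = (s \<otimes> 1) (1 \<otimes> r)\<close>.\<close>

lemma comparison_app:
  assumes S': "commutative_monoid C S'" and S: "commutative_monoid C S"
    and R': "commutative_monoid C R'" and R: "commutative_monoid C R"
    and f: "monoid_hom C S' S f" and \<psi>: "monoid_hom C S' R' \<psi>"
    and \<theta>: "monoid_hom C S R \<theta>" and g: "monoid_hom C R' R g"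
    and c: "comparison C S' S R' R f g \<theta> \<psi> c"
  shows "c \<in> Arr C" "Dom C c = rtens_obj C S' (alg_mod C S f) (alg_mod C R' \<psi>)" "Cod C c = Car R"
    "\<lbrakk>elt s; elt r; ty s = Car S; ty r = Car R'; dj s r\<rbrakk> \<Longrightarrow>
      c \<rhd> rtens_proj C S' (alg_mod C S f) (alg_mod C R' \<psi>) \<rhd> \<langle>s, r\<rangle> = Mul R \<rhd> \<langle>\<theta> \<rhd> s, g \<rhd> r\<rangle>"
proof -
  let ?X = "alg_mod C S f" and ?Y = "alg_mod C R' \<psi>" and ?T = "alg_tens C S' S f R' \<psi>"
  have X: "is_module C S' ?X" and Y: "is_module C S' ?Y"
    by (rule alg_module[OF S' S f], rule alg_module[OF S' R' \<psi>])
  note [simp] = S' S R' R monoid_hom_arr[OF g] monoid_hom_arr[OF \<theta>] rtens_arr[OF S' X Y] interchange_simps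
    alg_mod_simps(1)[OF S' S f] alg_mod_simps(1)[OF S' R' \<psi>]
  let ?q = "rtens_proj C S' ?X ?Y"
  have hom: "monoid_hom C ?T R c" and in2: "c \<cdot> alg_in2 C S' S f R' \<psi> = g" and in1: "c \<cdot> alg_in1 C S' S f R' \<psi> = \<theta>"
    using c by (auto simp: comparison_def algebra_hom_def)
  have car: "Car ?T = rtens_obj C S' ?X ?Y" by (simp add: alg_tens_def Let_def)
  show c [simp]: "c \<in> Arr C" "Dom C c = rtens_obj C S' ?X ?Y" "Cod C c = Car R"
    using monoid_hom_arr[OF hom] by (simp_all add: car)
  have M: "Mul ?T \<in> Arr C" "Dom C (Mul ?T) = rtens_obj C S' ?X ?Y \<otimes> rtens_obj C S' ?X ?Y" "Cod C (Mul ?T) = rtens_obj C S' ?X ?Y"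
    "Mul ?T \<cdot> (?q \<odot> ?q) = ?q \<cdot> (Mul S \<odot> Mul R') \<cdot> interchange C (Car S) (Car R') (Car S) (Car R')"
    using alg_tens_Mul[OF S' S R' f \<psi>] by (simp_all add: in_Hom)
  note [simp] = M(1-3)
  assume e [simp]: "elt s" "elt r" "ty s = Car S" "ty r = Car R'" "dj s r"
  let ?a = "?q \<rhd> \<langle>s, Unt R' \<rhd> star\<rangle>" and ?b = "?q \<rhd> \<langle>Unt S \<rhd> star, r\<rangle>"
  have a: "c \<rhd> ?a = \<theta> \<rhd> s"
    using arg_cong[OF in1, of "\<lambda>F. F \<rhd> s"] by (simp add: alg_in1_def)
  have b: "c \<rhd> ?b = g \<rhd> r"
    using arg_cong[OF in2, of "\<lambda>F. F \<rhd> r"] by (simp add: alg_in2_def)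
  have m: "Mul ?T \<rhd> \<langle>?a, ?b\<rangle> = ?q \<rhd> \<langle>s, r\<rangle>"
    using arg_cong[OF M(4), of "\<lambda>F. F \<rhd> \<langle>\<langle>s, Unt R' \<rhd> star\<rangle>, \<langle>Unt S \<rhd> star, r\<rangle>\<rangle>"] by simp
  have "c \<cdot> Mul ?T = Mul R \<cdot> (c \<odot> c)" using hom by (simp add: monoid_hom_def)
  from arg_cong[OF this, of "\<lambda>F. F \<rhd> \<langle>?a, ?b\<rangle>"]
  have "c \<rhd> Mul ?T \<rhd> \<langle>?a, ?b\<rangle> = Mul R \<rhd> \<langle>c \<rhd> ?a, c \<rhd> ?b\<rangle>" by simp
  then show "c \<rhd> ?q \<rhd> \<langle>s, r\<rangle> = Mul R \<rhd> \<langle>\<theta> \<rhd> s, g \<rhd> r\<rangle>" by (simp only: m a b)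
qed

text \<open>The inverse is \<open>x \<otimes> (r \<otimes> s) \<mapsto> s \<otimes> r x\<close>.\<close>

lemma base_change_iso:
  assumes S': "commutative_monoid C S'" and S: "commutative_monoid C S" and R': "commutative_monoid C R'"
    and f: "monoid_hom C S' S f" and \<psi>: "monoid_hom C S' R' \<psi>" and X: "is_module C R' X"
  defines "q1 \<equiv> rtens_proj C S' (alg_mod C S f) (restr_mod C \<psi> X)"
    and "Q1 \<equiv> rtens_obj C S' (alg_mod C S f) (restr_mod C \<psi> X)"
    and "q3 \<equiv> rtens_proj C S' (alg_mod C R' \<psi>) (alg_mod C S f)"
    and "T \<equiv> ext_mod C S' R' \<psi> (alg_mod C S f)"
  defines "q2 \<equiv> rtens_proj C R' X T" and "Q2 \<equiv> rtens_obj C R' X T"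
  obtains \<phi> where "is_iso C \<phi>" "\<phi> \<in> Arr C" "Dom C \<phi> = Q1" "Cod C \<phi> = Q2"
    "\<And>s x. \<lbrakk>elt s; elt x; ty s = Car S; ty x = fst X; dj s x\<rbrakk> \<Longrightarrow>
      \<phi> \<rhd> q1 \<rhd> \<langle>s, x\<rangle> = q2 \<rhd> \<langle>x, q3 \<rhd> \<langle>Unt R' \<rhd> star, s\<rangle>\<rangle>"
proof -
  have Sm: "is_module C S' (alg_mod C S f)" and Rm: "is_module C S' (alg_mod C R' \<psi>)"
    and Xm: "is_module C S' (restr_mod C \<psi> X)"
    by (rule alg_module[OF S' S f], rule alg_module[OF S' R' \<psi>], rule restr_module[OF S' R' \<psi> X])
  have T: "is_module C R' T" unfolding T_def by (rule ext_module[OF S' R' \<psi> Sm])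
  note [simp] = S' S R' alg_mod_simps(1)[OF S' S f] alg_mod_simps(1)[OF S' R' \<psi>] restr_mod_simps(1)[OF S' R' \<psi> X]
    monoid_hom_arr[OF f] monoid_hom_arr[OF \<psi>] module_arr[OF X]
  have q1 [simp]: "q1 \<in> Arr C" "Dom C q1 = Car S \<otimes> fst X" "Cod C q1 = Q1" "Q1 \<in> Obj C" "epi q1"
    using rtens_arr[OF S' Sm Xm] by (simp_all add: q1_def Q1_def)
  have q3 [simp]: "q3 \<in> Arr C" "Dom C q3 = Car R' \<otimes> Car S" "Cod C q3 = fst T" "epi q3"
    using rtens_arr[OF S' Rm Sm] by (simp_all add: q3_def T_def ext_mod_simps[OF S' R' \<psi> Sm])
  note T_arr [simp] = module_arr[OF T]
  have q2 [simp]: "q2 \<in> Arr C" "Dom C q2 = fst X \<otimes> fst T" "Cod C q2 = Q2" "Q2 \<in> Obj C" "epi q2"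
    using rtens_arr[OF R' X T] by (simp_all add: q2_def Q2_def)
  note act = alg_mod_simps(2)[OF S' S f] alg_mod_simps(2)[OF S' R' \<psi>] restr_mod_simps(2)[OF S' R' \<psi> X]
  have bal1: "q1 \<rhd> \<langle>Mul S \<rhd> \<langle>f \<rhd> a, s\<rangle>, x\<rangle> = q1 \<rhd> \<langle>s, snd X \<rhd> \<langle>\<psi> \<rhd> a, x\<rangle>\<rangle>"
    if "elt a" "elt s" "elt x" "ty a = Car S'" "ty s = Car S" "ty x = fst X" "dj a s" "dj a x" "dj s x" for a s x
    using rtens_balance[OF S' Sm Xm, of a s x] that by (simp add: act q1_def)
  have bal3: "q3 \<rhd> \<langle>Mul R' \<rhd> \<langle>\<psi> \<rhd> a, r\<rangle>, s\<rangle> = q3 \<rhd> \<langle>r, Mul S \<rhd> \<langle>f \<rhd> a, s\<rangle>\<rangle>"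
    if "elt a" "elt r" "elt s" "ty a = Car S'" "ty r = Car R'" "ty s = Car S" "dj a r" "dj a s" "dj r s" for a r s
    using rtens_balance[OF S' Rm Sm, of a r s] that by (simp add: act q3_def)
  have actT: "snd T \<rhd> \<langle>b, q3 \<rhd> \<langle>r, s\<rangle>\<rangle> = q3 \<rhd> \<langle>Mul R' \<rhd> \<langle>b, r\<rangle>, s\<rangle>"
    if "elt b" "elt r" "elt s" "ty b = Car R'" "ty r = Car R'" "ty s = Car S" "dj b r" "dj b s" "dj r s" for b r s
    using ext_mod_simps(5)[OF S' R' \<psi> Sm, of b r s] that by (simp add: q3_def T_def)
  have bal2: "q2 \<rhd> \<langle>snd X \<rhd> \<langle>b, x\<rangle>, q3 \<rhd> \<langle>r, s\<rangle>\<rangle> = q2 \<rhd> \<langle>x, q3 \<rhd> \<langle>Mul R' \<rhd> \<langle>b, r\<rangle>, s\<rangle>\<rangle>"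
    if "elt b" "elt x" "elt r" "elt s" "ty b = Car R'" "ty x = fst X" "ty r = Car R'" "ty s = Car S"
      "dj b x" "dj b r" "dj b s" "dj x r" "dj x s" "dj r s" for b x r s
    using rtens_balance[OF R' X T, of b x "q3 \<rhd> \<langle>r, s\<rangle>"] that by (simp add: actT q2_def)
  \<comment> \<open>On elements s \<otimes> x \<mapsto> x \<otimes> (1 \<otimes> s). It is balanced
    because f(a) s \<otimes> x and s \<otimes> \<psi>(a) x both go to x \<otimes> (\<psi>(a)
    \<otimes> s), by \<open>bal3\<close> and \<open>bal2\<close>.\<close>
  let ?k = "q2 \<cdot> (Id C (fst X) \<odot> (q3 \<cdot> (Unt R' \<odot> Id C (Car S)) \<cdot> Inv C (LUnit C (Car S)))) \<cdot> Sym C (Car S) (fst X)"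
  have "\<exists>\<phi>. \<phi> \<in> Hom C Q1 (Cod C ?k) \<and> \<phi> \<cdot> q1 = ?k"
    unfolding q1_def Q1_def
    by (rule rtens_induced[OF S' Sm Xm, of _ "var 0 (Car S')" "var 1 (Car S)" "var 2 (fst X)"])
      (simp_all add: act bal2 bal3[symmetric])
  then obtain \<phi> where \<phi> [simp]: "\<phi> \<in> Arr C" "Dom C \<phi> = Q1" "Cod C \<phi> = Q2" and \<phi>q: "\<phi> \<cdot> q1 = ?k"
    by (auto simp: in_Hom)
  have \<phi>': "\<phi> \<rhd> q1 \<rhd> \<langle>s, x\<rangle> = q2 \<rhd> \<langle>x, q3 \<rhd> \<langle>Unt R' \<rhd> star, s\<rangle>\<rangle>"
    if "elt s" "elt x" "ty s = Car S" "ty x = fst X" "dj s x" for s x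
    using arg_cong[OF \<phi>q, of "\<lambda>F. F \<rhd> \<langle>s, x\<rangle>"] that by (simp add: dj_commute)
  \<comment> \<open>On elements x \<otimes> (r \<otimes> s) \<mapsto> s \<otimes> r x. It descends
    along the inner projection \<open>q3\<close> with x as spectator, and then along
    \<open>q2\<close>.\<close>
  let ?l = "q1 \<cdot> (Id C (Car S) \<odot> snd X) \<cdot> Sym C (Car R' \<otimes> fst X) (Car S) \<cdot>
    (Sym C (fst X) (Car R') \<odot> Id C (Car S)) \<cdot> Inv C (Assoc C (fst X) (Car R') (Car S))"
  have fT: "fst T = rtens_obj C S' (alg_mod C R' \<psi>) (alg_mod C S f)"
    by (simp add: T_def ext_mod_simps[OF S' R' \<psi> Sm])
  have "\<exists>l. l \<in> Hom C (fst X \<otimes> fst T) (Cod C ?l) \<and> l \<cdot> (Id C (fst X) \<odot> q3) = ?l"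
    unfolding q3_def fT
    by (rule rtens_induced_left[OF S' Rm Sm, of _ _ "var 0 (Car S')" "var 1 (Car R')" "var 2 (Car S)" "var 3 (fst X)"])
      (simp_all add: act act_Mul[OF R' X] bal1)
  then obtain l where l [simp]: "l \<in> Arr C" "Dom C l = fst X \<otimes> fst T" "Cod C l = Q1" and lq: "l \<cdot> (Id C (fst X) \<odot> q3) = ?l"
    by (auto simp: in_Hom)
  have l': "l \<rhd> \<langle>x, q3 \<rhd> \<langle>r, s\<rangle>\<rangle> = q1 \<rhd> \<langle>s, snd X \<rhd> \<langle>r, x\<rangle>\<rangle>"
    if "elt x" "elt r" "elt s" "ty x = fst X" "ty r = Car R'" "ty s = Car S" "dj x r" "dj x s" "dj r s" for x r s
    using arg_cong[OF lq, of "\<lambda>F. F \<rhd> \<langle>x, \<langle>r, s\<rangle>\<rangle>"] that by (simp add: dj_commute)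
  \<comment> \<open>Balance over R' compares s \<otimes> r (b x) with s \<otimes> (b r) x; they
    agree because R' is commutative.\<close>
  have "\<exists>\<chi>. \<chi> \<in> Hom C Q2 (Cod C l) \<and> \<chi> \<cdot> q2 = l"
    unfolding q2_def Q2_def
    by (rule rtens_induced[OF R' X T, of _ "var 0 (Car R')" "var 1 (fst X)" "q3 \<rhd> \<langle>var 2 (Car R'), var 3 (Car S)\<rangle>"])
      (simp_all add: actT l' act_Mul[OF R' X] act_commute[OF R' X, of "var 2 (Car R')" "var 0 (Car R')"])
  then obtain \<chi> where \<chi> [simp]: "\<chi> \<in> Arr C" "Dom C \<chi> = Q2" "Cod C \<chi> = Q1" and \<chi>q: "\<chi> \<cdot> q2 = l"
    by (auto simp: in_Hom)
  have \<chi>': "\<chi> \<rhd> q2 \<rhd> p = l \<rhd> p" if "elt p" "ty p = fst X \<otimes> fst T" for p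
    using arg_cong[OF \<chi>q, of "\<lambda>F. F \<rhd> p"] that by simp
  have "\<chi> \<cdot> \<phi> = Id C Q1"
    by (rule cover_ext[of _ "q1 \<rhd> \<langle>var 0 (Car S), var 1 (fst X)\<rangle>"])
      (simp_all add: \<phi>' \<chi>' l' act_Unt[OF R' X])
  \<comment> \<open>The composite gives r x \<otimes> (1 \<otimes> s), and \<open>bal2\<close> moves
    r back across the product.\<close>
  moreover have "\<phi> \<cdot> \<chi> = Id C Q2"
    by (rule cover_ext[of _ "q2 \<rhd> \<langle>var 0 (fst X), q3 \<rhd> \<langle>var 1 (Car R'), var 2 (Car S)\<rangle>\<rangle>"])
      (simp_all add: \<phi>' \<chi>' l' bal2)
  ultimately have "is_iso C \<phi>" by (intro is_isoI[of \<phi> \<chi>]) simp_all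
  then show ?thesis by (rule that[OF _ \<phi>]) (rule \<phi>')
qed

text \<open>Both composites restrict along the same monoid map and keep underlying arrows, so they
  agree strictly and identities serve as components.\<close>

lemma restr_restr_iso:
  assumes S': "commutative_monoid C S'" and S: "commutative_monoid C S"
    and R': "commutative_monoid C R'" and R: "commutative_monoid C R"
    and f: "monoid_hom C S' S f" and g: "monoid_hom C R' R g"
    and \<theta>: "monoid_hom C S R \<theta>" and \<psi>: "monoid_hom C S' R' \<psi>" and sq: "\<theta> \<cdot> f = g \<cdot> \<psi>"
  shows "nat_iso (Mod C R) (Mod C S') (restr C f \<circ>\<^sub>F restr C \<theta>) (restr C \<psi> \<circ>\<^sub>F restr C g)
    (\<lambda>X. Id (Mod C S') (restr_mod C f (restr_mod C \<theta> X)))"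
proof -
  have eq: "restr_mod C \<psi> (restr_mod C g X) = restr_mod C f (restr_mod C \<theta> X)" if "is_module C R X" for X
    using sq module_arr[OF that] monoid_hom_arr[OF f] monoid_hom_arr[OF g] monoid_hom_arr[OF \<theta>] monoid_hom_arr[OF \<psi>] R
    by (simp add: restr_mod_def)
  note cat = category_Mod[OF S']
  have F: "is_functor (Mod C R) (Mod C S') (restr C f \<circ>\<^sub>F restr C \<theta>)"
    "is_functor (Mod C R) (Mod C S') (restr C \<psi> \<circ>\<^sub>F restr C g)"
    by (rule functor_comp restr_functor S' S R' R f g \<theta> \<psi>)+
  have m: "is_module C S' (restr_mod C f (restr_mod C \<theta> X))" if "is_module C R X" for X
    by (rule restr_module[OF S' S f restr_module[OF S R \<theta> that]])
  have hom: "module_hom C S' (restr_mod C f (restr_mod C \<theta> X)) (restr_mod C f (restr_mod C \<theta> Y)) k"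
    if "is_module C R X" "is_module C R Y" "module_hom C R X Y k" for X Y k
    using that by (intro restr_module_hom[OF S' S f] restr_module[OF S R \<theta>] restr_module_hom[OF S R \<theta>])
  show ?thesis
    unfolding nat_iso_def nat_trans_def
  proof (intro conjI ballI allI F)
    fix X assume X: "X \<in> Obj (Mod C R)"
    then have Xm: "is_module C R X" by (simp add: Mod_simps)
    show "Id (Mod C S') (restr_mod C f (restr_mod C \<theta> X)) \<in>
      Hom (Mod C S') (FO (restr C f \<circ>\<^sub>F restr C \<theta>) X) (FO (restr C \<psi> \<circ>\<^sub>F restr C g) X)"
      using category.Id_Hom[OF cat] m[OF Xm] by (simp add: fcomp_def restr_def eq[OF Xm] Mod_simps(1))
    show "is_iso (Mod C S') (Id (Mod C S') (restr_mod C f (restr_mod C \<theta> X)))"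
      by (rule category.iso_Id[OF cat]) (simp add: Mod_simps m[OF Xm])
  next
    fix X Y k assume "k \<in> Hom (Mod C R) X Y"
    then obtain k' where k: "k = (X, Y, k')" "is_module C R X" "is_module C R Y" "module_hom C R X Y k'"
      by (auto simp: in_Hom_Mod)
    show "Id (Mod C S') (restr_mod C f (restr_mod C \<theta> Y)) \<cdot>\<^bsub>Mod C S'\<^esub> FA (restr C f \<circ>\<^sub>F restr C \<theta>) k =
      FA (restr C \<psi> \<circ>\<^sub>F restr C g) k \<cdot>\<^bsub>Mod C S'\<^esub> Id (Mod C S') (restr_mod C f (restr_mod C \<theta> X))"
      using module_hom_arr[OF hom[OF k(2-4)]]
      by (simp add: k fcomp_def restr_def eq Mod_simps)
  qed
qed

end

section \<open>The natural map between the two base changes\<close>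

locale monoid_square = symmetric_monoidal_model_category C small M
  for C :: "('o, 'm, 'z) moncat_scheme" (structure) and small :: "'u::infinite itself" and M :: "'m model" +
  fixes S' S R' R :: "('o, 'm) mon" and f g \<theta> \<psi> :: 'm
  assumes S': "commutative_monoid C S'" and S: "commutative_monoid C S"
    and R': "commutative_monoid C R'" and R: "commutative_monoid C R"
    and f: "monoid_hom C S' S f" and g: "monoid_hom C R' R g"
    and \<theta>: "monoid_hom C S R \<theta>" and \<psi>: "monoid_hom C S' R' \<psi>"
    and square: "\<theta> \<cdot> f = g \<cdot> \<psi>"
begin

abbreviation src :: "'o \<times> 'm \<Rightarrow> 'o \<times> 'm" where
  "src X \<equiv> ext_mod C S' S f (restr_mod C \<psi> X)"

abbreviation tgt :: "'o \<times> 'm \<Rightarrow> 'o \<times> 'm" where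
  "tgt X \<equiv> restr_mod C \<theta> (ext_mod C R' R g X)"

abbreviation qsrc :: "'o \<times> 'm \<Rightarrow> 'm" where
  "qsrc X \<equiv> rtens_proj C S' (alg_mod C S f) (restr_mod C \<psi> X)"

abbreviation qtgt :: "'o \<times> 'm \<Rightarrow> 'm" where
  "qtgt X \<equiv> rtens_proj C R' (alg_mod C R g) X"

lemmas [simp] = S' S R' R monoid_hom_arr[OF f] monoid_hom_arr[OF g] monoid_hom_arr[OF \<theta>] monoid_hom_arr[OF \<psi>]
  alg_mod_simps(1)[OF S' S f] alg_mod_simps(1)[OF S' R' \<psi>] alg_mod_simps(1)[OF R' R g]

lemmas Sm = alg_module[OF S' S f]
  and Rm = alg_module[OF R' R g]
  and Xm = restr_module[OF S' R' \<psi>]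
  and src_module = ext_module[OF S' S f restr_module[OF S' R' \<psi>]]
  and tgt_module = restr_module[OF S R \<theta> ext_module[OF R' R g]]

lemma qsrc_arr:
  assumes X: "is_module C R' X"
  shows "qsrc X \<in> Arr C" "Dom C (qsrc X) = Car S \<otimes> fst X" "Cod C (qsrc X) = fst (src X)" "epi (qsrc X)"
  using rtens_arr[OF S' Sm Xm[OF X]]
  by (simp_all add: ext_mod_simps[OF S' S f Xm[OF X]] restr_mod_simps(1)[OF S' R' \<psi> X])

lemma qtgt_arr:
  assumes X: "is_module C R' X"
  shows "qtgt X \<in> Arr C" "Dom C (qtgt X) = Car R \<otimes> fst X" "Cod C (qtgt X) = fst (tgt X)" "epi (qtgt X)"
  using rtens_arr[OF R' Rm X]
  by (simp_all add: ext_mod_simps[OF R' R g X] restr_mod_simps(1)[OF S R \<theta> ext_module[OF R' R g X]])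

lemma src_act:
  assumes X: "is_module C R' X" and "elt b" "elt s" "elt x" "ty b = Car S" "ty s = Car S" "ty x = fst X"
    "dj b s" "dj b x" "dj s x"
  shows "snd (src X) \<rhd> \<langle>b, qsrc X \<rhd> \<langle>s, x\<rangle>\<rangle> = qsrc X \<rhd> \<langle>Mul S \<rhd> \<langle>b, s\<rangle>, x\<rangle>"
  using ext_mod_simps(5)[OF S' S f Xm[OF X]] assms by (simp add: restr_mod_simps(1)[OF S' R' \<psi> X])

lemma tgt_act:
  assumes X: "is_module C R' X" and "elt b" "elt r" "elt x" "ty b = Car S" "ty r = Car R" "ty x = fst X"
    "dj b r" "dj b x" "dj r x"
  shows "snd (tgt X) \<rhd> \<langle>b, qtgt X \<rhd> \<langle>r, x\<rangle>\<rangle> = qtgt X \<rhd> \<langle>Mul R \<rhd> \<langle>\<theta> \<rhd> b, r\<rangle>, x\<rangle>"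
  using assms qtgt_arr[OF X] module_arr[OF X] ext_mod_simps[OF R' R g X]
  by (simp add: restr_mod_simps[OF S R \<theta> ext_module[OF R' R g X]])

lemma square_app: "\<lbrakk>elt a; ty a = Car S'\<rbrakk> \<Longrightarrow> \<theta> \<rhd> f \<rhd> a = g \<rhd> \<psi> \<rhd> a"
  using arg_cong[OF square, of "\<lambda>F. F \<rhd> a"] by simp

text \<open>Commutativity of the square gives balance: \<theta>(f a) \<theta>(s) \<otimes> x =
  g(\<psi> a) \<theta>(s) \<otimes> x = \<theta>(s) \<otimes> \<psi>(a) x.\<close>

lemma ex_base_change:
  assumes X: "is_module C R' X"
  shows "\<exists>t. t \<in> Arr C \<and> Dom C t = fst (src X) \<and> Cod C t = fst (tgt X) \<and>
    t \<cdot> qsrc X = qtgt X \<cdot> (\<theta> \<odot> Id C (fst X))"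
proof -
  note [simp] = module_arr[OF X] qtgt_arr[OF X] restr_mod_simps(1)[OF S' R' \<psi> X]
  have bal: "qtgt X \<rhd> \<langle>Mul R \<rhd> \<langle>g \<rhd> b, r\<rangle>, x\<rangle> = qtgt X \<rhd> \<langle>r, snd X \<rhd> \<langle>b, x\<rangle>\<rangle>"
    if "elt b" "elt r" "elt x" "ty b = Car R'" "ty r = Car R" "ty x = fst X" "dj b r" "dj b x" "dj r x" for b r x
    using rtens_balance[OF R' Rm X, of b r x] that by (simp add: alg_mod_simps(2)[OF R' R g])
  have "\<exists>t. t \<in> Hom C (rtens_obj C S' (alg_mod C S f) (restr_mod C \<psi> X)) (Cod C (qtgt X \<cdot> (\<theta> \<odot> Id C (fst X)))) \<and>
    t \<cdot> qsrc X = qtgt X \<cdot> (\<theta> \<odot> Id C (fst X))"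
    by (rule rtens_induced[OF S' Sm Xm[OF X], of _ "var 0 (Car S')" "var 1 (Car S)" "var 2 (fst X)"])
      (simp_all add: alg_mod_simps(2)[OF S' S f] restr_mod_simps(2)[OF S' R' \<psi> X] monoid_hom_Mul[OF S R \<theta>] square_app bal)
  then show ?thesis
    by (auto simp: in_Hom ext_mod_simps[OF S' S f Xm[OF X]])
qed

text \<open>The choice is harmless: \<open>qsrc X\<close> is epi, so its composite with the map
  determines the map.\<close>

definition base_change :: "'o \<times> 'm \<Rightarrow> 'm" where
  "base_change X = (SOME t. t \<in> Arr C \<and> Dom C t = fst (src X) \<and> Cod C t = fst (tgt X) \<and>
     t \<cdot> qsrc X = qtgt X \<cdot> (\<theta> \<odot> Id C (fst X)))"

lemma base_change_arr:
  assumes X: "is_module C R' X"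
  shows "base_change X \<in> Arr C" "Dom C (base_change X) = fst (src X)" "Cod C (base_change X) = fst (tgt X)"
    "base_change X \<cdot> qsrc X = qtgt X \<cdot> (\<theta> \<odot> Id C (fst X))"
  using someI_ex[OF ex_base_change[OF X]] by (simp_all add: base_change_def)

lemma base_change_app:
  assumes X: "is_module C R' X" and "elt s" "elt x" "ty s = Car S" "ty x = fst X" "dj s x"
  shows "base_change X \<rhd> qsrc X \<rhd> \<langle>s, x\<rangle> = qtgt X \<rhd> \<langle>\<theta> \<rhd> s, x\<rangle>"
  using arg_cong[OF base_change_arr(4)[OF X], of "\<lambda>F. F \<rhd> \<langle>s, x\<rangle>"] assms(2-)
    base_change_arr(1-3)[OF X] module_arr[OF X] qsrc_arr[OF X] qtgt_arr[OF X] by simp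

lemma base_change_hom:
  assumes X: "is_module C R' X"
  shows "module_hom C S (src X) (tgt X) (base_change X)"
  by (rule module_homI[OF S src_module[OF X] tgt_module[OF X], of _ "var 0 (Car S)" "qsrc X \<rhd> \<langle>var 1 (Car S), var 2 (fst X)\<rangle>"])
    (simp_all add: base_change_arr(1-3)[OF X] module_arr[OF X] qsrc_arr[OF X] src_act[OF X] base_change_app[OF X]
      tgt_act[OF X] monoid_hom_Mul[OF S R \<theta>])

text \<open>On a generator s \<otimes> x both sides give \<theta>(s) \<otimes> k(x).\<close>

lemma base_change_natural:
  assumes X: "is_module C R' X" and Y: "is_module C R' Y" and k: "module_hom C R' X Y k"
  shows "base_change Y \<cdot> rtens_map C S' (alg_mod C S f, alg_mod C S f, Id C (Car S)) (restr_mod C \<psi> X, restr_mod C \<psi> Y, k) =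
    rtens_map C R' (alg_mod C R g, alg_mod C R g, Id C (Car R)) (X, Y, k) \<cdot> base_change X"
proof -
  have IS: "module_hom C S' (alg_mod C S f) (alg_mod C S f) (Id C (Car S))"
    using module_hom_Id[OF S' Sm] by simp
  have IR: "module_hom C R' (alg_mod C R g) (alg_mod C R g) (Id C (Car R))"
    using module_hom_Id[OF R' Rm] by simp
  note k' = restr_module_hom[OF S' R' \<psi> X Y k]
  note Xm' = Xm[OF X] and Ym' = Xm[OF Y]
  note [simp] = module_arr[OF X] module_arr[OF Y] module_hom_arr[OF k] qsrc_arr[OF X] qsrc_arr[OF Y] qtgt_arr[OF X] qtgt_arr[OF Y]
    base_change_arr(1-3)[OF X] base_change_arr(1-3)[OF Y] base_change_app[OF X] base_change_app[OF Y]
    restr_mod_simps(1)[OF S' R' \<psi> X] restr_mod_simps(1)[OF S' R' \<psi> Y]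
    ext_mod_simps(1)[OF S' S f Xm'] ext_mod_simps(1)[OF S' S f Ym'] ext_mod_simps(1)[OF R' R g X] ext_mod_simps(1)[OF R' R g Y]
    restr_mod_simps(1)[OF S R \<theta> ext_module[OF R' R g X]] restr_mod_simps(1)[OF S R \<theta> ext_module[OF R' R g Y]]
    rtens_map_arr[OF S' Sm Xm' Sm Ym' IS k'] rtens_map_app[OF S' Sm Xm' Sm Ym' IS k']
    rtens_map_arr[OF R' Rm X Rm Y IR k] rtens_map_app[OF R' Rm X Rm Y IR k]
  show ?thesis
    by (rule cover_ext[of _ "qsrc X \<rhd> \<langle>var 0 (Car S), var 1 (fst X)\<rangle>"]) simp_all
qed

lemma base_change_nat_trans:
  "nat_trans (Mod C R') (Mod C S) (ext C S' S f \<circ>\<^sub>F restr C \<psi>) (restr C \<theta> \<circ>\<^sub>F ext C R' R g)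
     (\<lambda>X. (src X, tgt X, base_change X))"
  unfolding nat_trans_def
proof (intro conjI ballI allI)
  show "is_functor (Mod C R') (Mod C S) (ext C S' S f \<circ>\<^sub>F restr C \<psi>)"
    by (rule functor_comp[OF restr_functor[OF S' R' \<psi>] ext_functor[OF S' S f]])
  show "is_functor (Mod C R') (Mod C S) (restr C \<theta> \<circ>\<^sub>F ext C R' R g)"
    by (rule functor_comp[OF ext_functor[OF R' R g] restr_functor[OF S R \<theta>]])
  show "(src X, tgt X, base_change X) \<in> Hom (Mod C S) (FO (ext C S' S f \<circ>\<^sub>F restr C \<psi>) X) (FO (restr C \<theta> \<circ>\<^sub>F ext C R' R g) X)"
    if "X \<in> Obj (Mod C R')" for X
    using that by (simp add: Mod_simps(1) in_Hom_Mod fcomp_def restr_def ext_def src_module tgt_module base_change_hom)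
  show "(src Y, tgt Y, base_change Y) \<cdot>\<^bsub>Mod C S\<^esub> FA (ext C S' S f \<circ>\<^sub>F restr C \<psi>) k =
      FA (restr C \<theta> \<circ>\<^sub>F ext C R' R g) k \<cdot>\<^bsub>Mod C S\<^esub> (src X, tgt X, base_change X)"
    if "k \<in> Hom (Mod C R') X Y" for X Y k
  proof -
    obtain k' where k: "k = (X, Y, k')" "is_module C R' X" "is_module C R' Y" "module_hom C R' X Y k'"
      using \<open>k \<in> Hom (Mod C R') X Y\<close> by (auto simp: in_Hom_Mod)
    show ?thesis
      by (simp add: k(1) fcomp_def restr_def ext_def Mod_simps base_change_natural[OF k(2-4)])
  qed
qed

text \<open>The map is written as \<open>e \<cdot> ?W \<cdot> \<phi>\<close>, with isomorphisms
  outside and the tensor of X with the comparison map inside. Flatness of X makes the middle map a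
  weak equivalence.\<close>

lemma base_change_weq:
  assumes flat: "cofibrants_flat (Mod C R') (lifted_model C M R') (mod_tens_ftor C R')"
    and c: "comparison C S' S R' R f g \<theta> \<psi> c" and cw: "c \<in> Weq M"
    and X: "cofibrant (Mod C R') (lifted_model C M R') X"
  shows "(src X, tgt X, base_change X) \<in> Weq (lifted_model C M S)"
proof -
  have X': "is_module C R' X" using X by (simp add: cofibrant_def Mod_simps(1))
  have Rm': "is_module C S' (alg_mod C R' \<psi>)" by (rule alg_module[OF S' R' \<psi>])
  let ?T = "ext_mod C S' R' \<psi> (alg_mod C S f)" and ?q = "rtens_proj C S' (alg_mod C S f) (alg_mod C R' \<psi>)"
    and ?q3 = "rtens_proj C S' (alg_mod C R' \<psi>) (alg_mod C S f)"
  have T: "is_module C R' ?T" by (rule ext_module[OF S' R' \<psi> Sm])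
  note [simp] = module_arr[OF X'] module_arr[OF T] rtens_arr[OF S' Sm Rm'] rtens_arr[OF S' Rm' Sm]
    ext_mod_simps[OF S' R' \<psi> Sm] comparison_app[OF S' S R' R f \<psi> \<theta> g c]
  \<comment> \<open>The extension of S along \<psi> has R' on the left, where its scalars act;
    \<open>d\<close> exchanges the factors to reach the source of \<open>c\<close>.\<close>
  obtain d where d [simp]: "is_iso C d" "d \<in> Arr C" "Dom C d = fst ?T" "Cod C d = rtens_obj C S' (alg_mod C S f) (alg_mod C R' \<psi>)"
    and d': "\<And>r s. \<lbrakk>elt r; elt s; ty r = Car R'; ty s = Car S; dj r s\<rbrakk> \<Longrightarrow> d \<rhd> ?q3 \<rhd> \<langle>r, s\<rangle> = ?q \<rhd> \<langle>s, r\<rangle>"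
    using rtens_sym[OF S' Rm' Sm] by auto
  let ?c = "c \<cdot> d"
  have c'w: "?c \<in> Weq M" by (intro weq_comp cw iso_weq) simp_all
  have c'_app: "?c \<rhd> ?q3 \<rhd> \<langle>r, s\<rangle> = Mul R \<rhd> \<langle>\<theta> \<rhd> s, g \<rhd> r\<rangle>"
    if "elt r" "elt s" "ty r = Car R'" "ty s = Car S" "dj r s" for r s
    using that by (simp add: d' dj_commute)
  \<comment> \<open>Flatness concerns arrows of R'-modules, so linearity is required: (b r)
    \<otimes> s goes to \<theta>(s) g(b) g(r), and g(b) moves to the front because R is
    commutative.\<close>
  have c'_hom: "module_hom C R' ?T (alg_mod C R g) ?c"
    by (rule module_homI[OF R' T Rm, of _ "var 0 (Car R')" "?q3 \<rhd> \<langle>var 1 (Car R'), var 2 (Car S)\<rangle>"])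
      (simp_all add: d' alg_mod_simps(2)[OF R' R g] monoid_hom_Mul[OF R' R g] Mul_left_commute[OF R, of "\<theta> \<rhd> _"])
  have "(?T, alg_mod C R g, ?c) \<in> Weq (lifted_model C M R')"
    using T Rm c'_hom c'w by (simp add: lifted_model_def Let_def Mod_simps(3-5) in_Hom_Mod)
  then have "FA (mod_tens_ftor C R' X) (?T, alg_mod C R g, ?c) \<in> Weq (lifted_model C M R')"
    using flat X unfolding cofibrants_flat_def by blast
  then have Ww: "rtens_map C R' (X, X, Id C (fst X)) (?T, alg_mod C R g, ?c) \<in> Weq M" (is "?W \<in> _")
    by (simp add: mod_tens_ftor_def lifted_model_def Let_def Mod_simps)
  note IX = module_hom_Id[OF R' X']
  note [simp] = rtens_map_arr[OF R' X' T X' Rm IX c'_hom] rtens_arr[OF R' X' T] rtens_arr[OF R' X' Rm]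
    qsrc_arr[OF X'] qtgt_arr[OF X'] base_change_arr(1-3)[OF X']
  note W_app = rtens_map_app[OF R' X' T X' Rm IX c'_hom]
  obtain \<phi> where \<phi> [simp]: "is_iso C \<phi>" "\<phi> \<in> Arr C" "Dom C \<phi> = fst (src X)" "Cod C \<phi> = rtens_obj C R' X ?T"
    and \<phi>': "\<And>s x. \<lbrakk>elt s; elt x; ty s = Car S; ty x = fst X; dj s x\<rbrakk> \<Longrightarrow>
      \<phi> \<rhd> qsrc X \<rhd> \<langle>s, x\<rangle> = rtens_proj C R' X ?T \<rhd> \<langle>x, ?q3 \<rhd> \<langle>Unt R' \<rhd> star, s\<rangle>\<rangle>"
    using base_change_iso[OF S' S R' f \<psi> X'] ext_mod_simps(1)[OF S' S f Xm[OF X']] by metis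
  obtain e where e [simp]: "is_iso C e" "e \<in> Arr C" "Dom C e = rtens_obj C R' X (alg_mod C R g)" "Cod C e = fst (tgt X)"
    and e': "\<And>x r. \<lbrakk>elt x; elt r; ty x = fst X; ty r = Car R; dj x r\<rbrakk> \<Longrightarrow>
      e \<rhd> rtens_proj C R' X (alg_mod C R g) \<rhd> \<langle>x, r\<rangle> = qtgt X \<rhd> \<langle>r, x\<rangle>"
    using rtens_sym[OF R' X' Rm] rtens_arr(3)[OF R' Rm X'] qtgt_arr(3)[OF X'] by (metis alg_mod_simps(1)[OF R' R g])
  \<comment> \<open>On a generator the composite is s \<otimes> x \<mapsto> x \<otimes> (1 \<otimes>
    s) \<mapsto> x \<otimes> \<theta>(s) g(1) \<mapsto> \<theta>(s) \<otimes> x, using g(1) =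
    1.\<close>
  have "base_change X = e \<cdot> ?W \<cdot> \<phi>"
    by (rule cover_ext[of _ "qsrc X \<rhd> \<langle>var 0 (Car S), var 1 (fst X)\<rangle>"])
      (simp_all add: base_change_app[OF X'] \<phi>' W_app e' d' monoid_hom_Unt[OF R' g])
  moreover have "e \<cdot> ?W \<cdot> \<phi> \<in> Weq M"
    by (intro weq_comp iso_weq Ww) simp_all
  ultimately show ?thesis
    using src_module[OF X'] tgt_module[OF X'] base_change_hom[OF X']
    by (simp add: lifted_model_def Let_def Mod_simps(3-5) in_Hom_Mod)
qed

end

theorem proposition4p6:
  fixes C :: "('o, 'm, 'z) moncat_scheme"
    and M :: "'m model"
    and S' S R' R :: "('o, 'm) mon"
    and f g \<theta> \<psi> :: 'm
  assumes "symmetric_monoidal_model_category C TYPE('u::infinite) M"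
    and "commutative_monoid C S'" and "commutative_monoid C S"
    and "commutative_monoid C R'" and "commutative_monoid C R"
    and "monoid_hom C S' S f" and "monoid_hom C R' R g"
    and "monoid_hom C S R \<theta>" and "monoid_hom C S' R' \<psi>"
    and "\<theta> \<cdot>\<^bsub>C\<^esub> f = g \<cdot>\<^bsub>C\<^esub> \<psi>"
    and "\<forall>A \<in> {S', S, R', R}. model_category (Mod C A) TYPE('u) (lifted_model C M A)"
  shows "(\<exists>\<eta>. nat_iso (Mod C R) (Mod C S')
            (restr C f \<circ>\<^sub>F restr C \<theta>) (restr C \<psi> \<circ>\<^sub>F restr C g) \<eta>) \<and>
         (cofibrants_flat (Mod C R') (lifted_model C M R') (mod_tens_ftor C R') \<and>
          (\<exists>c. comparison C S' S R' R f g \<theta> \<psi> c \<and> c \<in> Weq M) \<longrightarrow>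
          (\<exists>\<tau>. nat_trans (Mod C R') (Mod C S)
                 (ext C S' S f \<circ>\<^sub>F restr C \<psi>) (restr C \<theta> \<circ>\<^sub>F ext C R' R g) \<tau> \<and>
               (\<forall>X. cofibrant (Mod C R') (lifted_model C M R') X \<longrightarrow>
                  \<tau> X \<in> Weq (lifted_model C M S))))"
proof -
  interpret monoid_square C "TYPE('u)" M S' S R' R f g \<theta> \<psi>
    using assms by (simp add: monoid_square_def monoid_square_axioms_def)
  show ?thesis
    using restr_restr_iso[OF S' S R' R f g \<theta> \<psi> square] base_change_nat_trans base_change_weq by blast
qed

end
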